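(* Let $\alpha>1$ and $2-\alpha<\beta\le1$ with $\beta>0$. There exist $\varepsilon>0$ and $b>\frac12$ such that, for all sufficiently small $T>0$ and all $u,v\in Z^b_T$, $$\left\|D^{-\beta(b-\frac12)}\partial_x(uv)\right\|_{Z^{b-1}_T}\lesssim_{\varepsilon,b}T^\varepsilon\|u\|_{Z^b_T}\|v\|_{Z^b_T},$$ with implicit constant independent of $T,u,v$.
   Context: $\mathbb T=[-\pi,\pi]$ is the torus. Fourier coefficients: $f_k=\int_{\mathbb T}f(x)e^{-ikx}\,dx$; time Fourier transform: $\widehat u(\tau)=\int_{\mathbb R}u(t)e^{-it\tau}\,dt$. $D^s$ is the Fourier multiplier with symbol $|k|^s$ on the modes $k\ne0$. $\langle y\rangle=(1+|y|^2)^{1/2}$. For $b\in\mathbb R$, with $L_k=k|k|^\alpha$, the space $Z^b$ consists of $u$ on $\mathbb R\times\mathbb T$ with zero spatial mean and finite norm $$\|u\|_{Z^b}=\left\|\langle k\rangle^{b\beta}\left\langle\frac{\tau-L_k}{\langle k\rangle^\beta}\right\rangle^b\widehat u_k(\tau)\right\|_{L^2_\tau \ell^2_k(\mathbb R\times(\mathbb Z\setminus\{0\}))}\quad\text{if } b\in(-\tfrac12,\tfrac12),$$ $$\|u\|_{Z^b}=\left\|\langle k\rangle^{\mathrm{sgn}(b)\beta/2}\left\langle\frac{\tau-L_k}{\langle k\rangle^\beta}\right\rangle^b\widehat u_k(\tau)\right\|_{L^2_\tau \ell^2_k(\mathbb R\times(\mathbb Z\setminus\{0\}))}\quad\text{otherwise.}$$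 $\|u\|_{Z^b_T}=\inf\{\|w\|_{Z^b}:w(t)=u(t)\text{ for }t\in[0,T]\}$. *)

theory Defs
  imports "HOL-Analysis.Analysis"
begin

text \<open>
  Functions on \<open>[-\<pi>,\<pi>]\<close> are paired with \<open>e^{-ikx}\<close>, functions of time with \<open>e^{-it\<tau>}\<close>,
  both without a normalising factor.
\<close>

definition fcoeff :: "(real \<Rightarrow> complex) \<Rightarrow> int \<Rightarrow> complex" where
  "fcoeff f k = (LINT x:{-pi..pi}|lborel. f x * exp (- \<i> * of_int k * of_real x))"

definition time_ft :: "(real \<Rightarrow> complex) \<Rightarrow> real \<Rightarrow> complex" where
  "time_ft \<phi> \<tau> = (LINT t|lborel. \<phi> t * exp (- \<i> * of_real t * of_real \<tau>))"

definition vderiv :: "(real \<Rightarrow> complex) \<Rightarrow> real \<Rightarrow> complex" where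
  "vderiv \<phi> t = vector_derivative \<phi> (at t)"

definition smooth :: "(real \<Rightarrow> complex) \<Rightarrow> bool" where
  "smooth \<phi> \<longleftrightarrow> (\<forall>n t. (vderiv ^^ n) \<phi> differentiable (at t))"

definition schwartz :: "(real \<Rightarrow> complex) \<Rightarrow> bool" where
  "schwartz \<phi> \<longleftrightarrow>
     smooth \<phi> \<and> (\<forall>m n. bounded (range (\<lambda>t. of_real (t ^ m) * (vderiv ^^ n) \<phi> t)))"

definition test_function :: "real \<Rightarrow> (real \<Rightarrow> complex) \<Rightarrow> bool" where
  "test_function T \<phi> \<longleftrightarrow>
     smooth \<phi> \<and> (\<exists>a c. 0 < a \<and> c < T \<and> (\<forall>t. t \<notin> {a..c} \<longrightarrow> \<phi> t = 0))"

text \<open>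
  Elements of \<open>Z\<^sup>b\<close> with \<open>b < 0\<close> are only distributions in time.  A distribution that is periodic
  in \<open>x\<close> is given by the family of its spatial Fourier coefficients \<open>u\<^sub>k\<close>, each of which
  is a functional on test functions of \<open>t\<close>.  The value of such a functional matters only
  on Schwartz functions (on the line), respectively on smooth functions with compact support
  in \<open>(0,T)\<close>.
\<close>

type_synonym tdist = "(real \<Rightarrow> complex) \<Rightarrow> complex"
type_synonym xtdist = "int \<Rightarrow> tdist"

text \<open>
  The Fourier transform of a tempered distribution, defined by duality, is the function \<open>F\<close>.
  Since \<open>time_ft\<close> is a bijection of the Schwartz space, this determines \<open>f\<close> on all
  Schwartz functions; linearity and continuity of \<open>f\<close> there need not be
  required separately.
\<close>

definition has_ft :: "tdist \<Rightarrow> (real \<Rightarrow> complex) \<Rightarrow> bool" where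
  "has_ft f F \<longleftrightarrow> F \<in> borel_measurable borel \<and>
     (\<forall>\<phi>. schwartz \<phi> \<longrightarrow>
        integrable lborel (\<lambda>\<tau>. F \<tau> * \<phi> \<tau>) \<and> f (time_ft \<phi>) = (LINT \<tau>|lborel. F \<tau> * \<phi> \<tau>))"

definition bracket :: "real \<Rightarrow> real" where
  "bracket y = sqrt (1 + \<bar>y\<bar>\<^sup>2)"

definition disp :: "real \<Rightarrow> int \<Rightarrow> real" where
  "disp \<alpha> k = of_int k * \<bar>of_int k\<bar> powr \<alpha>"

definition Z_weight :: "real \<Rightarrow> real \<Rightarrow> real \<Rightarrow> int \<Rightarrow> real \<Rightarrow> real" where
  "Z_weight \<alpha> \<beta> b k \<tau> =
     bracket (of_int k) powr (if - 1/2 < b \<and> b < 1/2 then b * \<beta> else sgn b * \<beta> / 2) *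
     bracket ((\<tau> - disp \<alpha> k) / bracket (of_int k) powr \<beta>) powr b"

text \<open>
  \<open>has_Z_norm \<alpha> \<beta> b w N\<close>: the distribution \<open>w\<close> on the line times the torus belongs to \<open>Z\<^sup>b\<close>
  and has norm \<open>N\<close>.  The choice of \<open>F\<close> is immaterial, as a Fourier transform is unique
  almost everywhere.
\<close>

definition has_Z_norm :: "real \<Rightarrow> real \<Rightarrow> real \<Rightarrow> xtdist \<Rightarrow> real \<Rightarrow> bool" where
  "has_Z_norm \<alpha> \<beta> b w N \<longleftrightarrow>
     (\<forall>\<phi>. schwartz \<phi> \<longrightarrow> w 0 \<phi> = 0) \<and>
     (\<exists>F. (\<forall>k. k \<noteq> 0 \<longrightarrow> has_ft (w k) (F k)) \<and>
          integrable (lborel \<Otimes>\<^sub>M count_space (- {0}))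
            (\<lambda>(\<tau>, k). (Z_weight \<alpha> \<beta> b k \<tau> * cmod (F k \<tau>))\<^sup>2) \<and>
          N = sqrt (LINT (\<tau>, k)|(lborel \<Otimes>\<^sub>M count_space (- {0})).
                      (Z_weight \<alpha> \<beta> b k \<tau> * cmod (F k \<tau>))\<^sup>2))"

definition agree_on :: "real \<Rightarrow> xtdist \<Rightarrow> xtdist \<Rightarrow> bool" where
  "agree_on T w g \<longleftrightarrow> (\<forall>k \<phi>. test_function T \<phi> \<longrightarrow> w k \<phi> = g k \<phi>)"

text \<open>
  Restrictions to \<open>[0,T]\<close>.  For \<open>b > - 1/2\<close> no element of \<open>Z\<^sup>b\<close> is supported in the
  two time slices \<open>t = 0\<close> and \<open>t = T\<close>, so testing on \<open>(0,T)\<close> loses nothing.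
\<close>

definition ZT_space :: "real \<Rightarrow> real \<Rightarrow> real \<Rightarrow> real \<Rightarrow> xtdist set" where
  "ZT_space \<alpha> \<beta> b T = {g. \<exists>w N. has_Z_norm \<alpha> \<beta> b w N \<and> agree_on T w g}"

definition ZT_norm :: "real \<Rightarrow> real \<Rightarrow> real \<Rightarrow> real \<Rightarrow> xtdist \<Rightarrow> real" where
  "ZT_norm \<alpha> \<beta> b T g = Inf {N. \<exists>w. has_Z_norm \<alpha> \<beta> b w N \<and> agree_on T w g}"

text \<open>The distribution on \<open>(0,T)\<close> times the torus given by a function \<open>u(t,x)\<close>.\<close>

definition fun_dist :: "real \<Rightarrow> (real \<Rightarrow> real \<Rightarrow> complex) \<Rightarrow> xtdist" where
  "fun_dist T u k \<phi> = (LINT t:{0..T}|lborel. fcoeff (u t) k * \<phi> t)"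

text \<open>
  For \<open>b > 1/2\<close> every element of \<open>Z\<^sup>b\<close> is a bounded continuous function of time with values in
  \<open>L\<^sup>2\<close> of the torus.  Hence the functions below represent all of the restricted space,
  and products of two of them are integrable.
\<close>

definition ZT_functions ::
    "real \<Rightarrow> real \<Rightarrow> real \<Rightarrow> real \<Rightarrow> (real \<Rightarrow> real \<Rightarrow> complex) set" where
  "ZT_functions \<alpha> \<beta> b T =
     {u. set_integrable lborel ({0..T} \<times> {-pi..pi}) (\<lambda>(t, x). u t x) \<and>
         fun_dist T u \<in> ZT_space \<alpha> \<beta> b T}"

definition fourier_mult :: "(int \<Rightarrow> complex) \<Rightarrow> xtdist \<Rightarrow> xtdist" where
  "fourier_mult m g k \<phi> = m k * g k \<phi>"

definition D_pow :: "real \<Rightarrow> xtdist \<Rightarrow> xtdist" where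
  "D_pow s = fourier_mult (\<lambda>k. if k = 0 then 0 else of_real (\<bar>of_int k\<bar> powr s))"

definition d_x :: "xtdist \<Rightarrow> xtdist" where
  "d_x = fourier_mult (\<lambda>k. \<i> * of_int k)"

end

theory Submission
  imports Defs "HOL-Probability.Probability" "HOL-Real_Asymp.Real_Asymp"
begin

text \<open>
  Let \<open>F\<close>, \<open>G\<close> be the space-time Fourier transforms of extensions of \<open>u\<close>, \<open>v\<close>, and write
  \<open>\<sigma> = \<tau> - L\<^sub>k\<close> for the modulation. If \<open>k = k\<^sub>1 + k\<^sub>2\<close> with all three frequencies nonzero, one of the
  modulations \<open>\<sigma>, \<sigma>\<^sub>1, \<sigma>\<^sub>2\<close> is at least a constant times \<open>min |k\<^sub>i| (max |k\<^sub>i|)\<^sup>\<alpha>\<close>. If it is an input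
  modulation, the weight of that input pays for the derivative; if it is the output modulation, the negative
  power of it in the norm of \<open>Z\<^sup>b\<^sup>-\<^sup>1\<close> pays, together with the factor \<open>|k\<^sub>i|\<^sup>-\<^sup>\<beta>\<^sup>/\<^sup>2\<close> of the input of
  higher frequency. Because \<open>\<alpha> + \<beta> > 2\<close> a negative power of the largest frequency is left over, and two
  applications of the Cauchy--Schwarz inequality give the bilinear estimate, even with a little less than
  the weight \<open>\<langle>\<sigma>/\<langle>k\<rangle>\<^sup>\<beta>\<rangle>\<^sup>b\<^sup>-\<^sup>1\<close> on the left. Multiplication by a cutoff at time scale \<open>T\<close> trades
  the part of the weight that was saved for the power of \<open>T\<close>. A trapezoid suffices as cutoff, since its Fourier
  transform decays quadratically.

  That the function \<open>u\<close> on \<open>(0,T)\<close> really has the modes prescribed by \<open>F\<close> follows from testing with smooth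
  bumps; that the modes of \<open>uv\<close> are the convolution of those of \<open>u\<close> and \<open>v\<close> holds because an integrable
  function on the torus with square summable Fourier coefficients is square integrable.
\<close>

section \<open>The Fourier transform in time\<close>

text \<open>\<open>has_ft\<close> determines a functional only at arguments presented as
  \<open>time_ft\<close> of a Schwartz function. Reading off modes on (0,T) therefore needs test
  functions that are transforms of Schwartz functions; this is why an explicit family of bumps is
  built whose inverse transforms are closed under differentiation and under multiplication by the
  variable. In the other direction there is freedom: the extension of the product pairs an
  integrable symbol with \<open>inv_ft\<close> of the argument, a formula that makes sense at every
  argument, Schwartz function or test function.

  The exponents: b = 1/2 + \<theta>/2. Twice \<delta> is the excess (\<alpha> + \<beta>)/2 - 1; one
  \<delta> pays for all losses in \<theta>, the other remains as decay in the largest frequency. The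
  bilinear estimate carries the modulation exponent \<theta> - 1/2 = (b - 1) + \<theta>/2. After
  squaring, the difference is \<theta>, and localisation at time scale T converts it into (T
  K)^\<theta> with K = <k>^\<beta>. The factor K^\<theta> is absorbed by the frequency exponents,
  and T^\<theta> gives \<epsilon> = \<theta>/2.\<close>

definition inv_ft :: "(real \<Rightarrow> complex) \<Rightarrow> real \<Rightarrow> complex" where
  "inv_ft F t = time_ft F (- t) / of_real (2 * pi)"

lemma exp_eq_cis: "exp (- \<i> * of_real t * of_real s) = cis (- (t * s))"
  by (simp add: cis_conv_exp mult_ac)

lemma time_ft_cis: "time_ft f s = (LINT t|lborel. f t * cis (- (t * s)))"
  unfolding time_ft_def exp_eq_cis ..

lemma inv_ft_cis: "inv_ft f s = (LINT t|lborel. f t * cis (t * s)) / of_real (2 * pi)"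
  unfolding inv_ft_def time_ft_cis by simp

lemma borel_measurable_cis [measurable]: "cis \<in> borel_measurable borel"
  by (intro borel_measurable_continuous_onI continuous_intros)

lemma integrable_mult_cis:
  fixes f :: "'a \<Rightarrow> complex"
  assumes "integrable M f" "g \<in> borel_measurable M"
  shows "integrable M (\<lambda>t. f t * cis (g t))"
proof (rule Bochner_Integration.integrable_bound[OF assms(1)])
  show "(\<lambda>t. f t * cis (g t)) \<in> borel_measurable M"
    using assms by (intro borel_measurable_times measurable_compose[OF assms(2) borel_measurable_cis]) auto
qed (simp add: norm_mult)

lemma time_ft_measurable:
  assumes [measurable]: "f \<in> borel_measurable borel"
  shows "time_ft f \<in> borel_measurable borel"
  unfolding time_ft_cis by measurable

lemma norm_time_ft_le: "norm (time_ft f s) \<le> (LINT t|lborel. norm (f t))"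
  unfolding time_ft_cis
  by (rule order_trans[OF integral_norm_bound]) (simp add: norm_mult)

section \<open>Gaussian regularisation and Fourier inversion\<close>

lemma gaussian_ft:
  assumes "\<delta> > 0"
  shows "(LINT t|lborel. of_real (std_normal_density (\<delta> * t)) * cis (t * s))
     = of_real (exp (- (s / \<delta>)\<^sup>2 / 2) / \<delta>)"
proof -
  have "of_real (exp (- (s / \<delta>)\<^sup>2 / 2)) = char std_normal_distribution (s / \<delta>)"
    by (simp add: char_std_normal_distribution)
  also have "\<dots> = (LINT y|lborel. std_normal_density y *\<^sub>R iexp (s / \<delta> * y))"
    unfolding char_def by (subst integral_density) auto
  also have "\<dots> = \<bar>\<delta>\<bar> *\<^sub>R (LINT t|lborel. std_normal_density (0 + \<delta> * t) *\<^sub>R iexp (s / \<delta> * (0 + \<delta> * t)))"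
    using assms by (subst lborel_integral_real_affine[where c = \<delta> and t = 0]) auto
  finally show ?thesis
    using assms by (simp add: cis_conv_exp scaleR_conv_of_real mult_ac field_simps)
qed

text \<open>A Gaussian factor of width 1 / \<open>d n\<close> is inserted into the inversion
  integral and the result \<open>L n\<close> is computed twice. Integrability of
  \<open>time_ft f\<close> removes the factor in the limit; Fubini turns the same integral into an
  average of \<open>f\<close> against a Gaussian of width \<open>d n\<close> around
  \<open>x\<close>, which tends to \<open>f x\<close> by continuity and boundedness.\<close>

lemma time_ft_inversion:
  assumes cont: "continuous_on UNIV f" and bdd: "bounded (range f)"
    and int: "integrable lborel f" and int': "integrable lborel (time_ft f)"
  shows "inv_ft (time_ft f) x = f x"
proof -
  define d :: "nat \<Rightarrow> real" where "d n = inverse (of_nat (Suc n))" for n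
  have d0: "d n > 0" for n by (simp add: d_def)
  have dlim: "d \<longlonglongrightarrow> 0" unfolding d_def by (rule LIMSEQ_inverse_real_of_nat)
  have [measurable]: "f \<in> borel_measurable borel" using int by auto
  have [measurable]: "time_ft f \<in> borel_measurable borel" using int' by auto
  have nd_cont: "continuous_on UNIV (std_normal_density)"
    unfolding std_normal_density_def by (intro continuous_intros) auto
  obtain B where B: "\<And>x. norm (f x) \<le> B" using bdd by (auto simp: bounded_iff)
  define L where "L n = (LINT \<tau>|lborel. time_ft f \<tau> * cis (\<tau> * x) * of_real (std_normal_density (d n * \<tau>)))" for n
  have "L \<longlonglongrightarrow> (LINT \<tau>|lborel. time_ft f \<tau> * cis (\<tau> * x) * of_real (std_normal_density 0))"
    unfolding L_def
  proof (rule integral_dominated_convergence[where w = "\<lambda>\<tau>. norm (time_ft f \<tau>)"])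
    show "AE \<tau> in lborel. (\<lambda>n. time_ft f \<tau> * cis (\<tau> * x) * of_real (std_normal_density (d n * \<tau>)))
       \<longlonglongrightarrow> time_ft f \<tau> * cis (\<tau> * x) * of_real (std_normal_density 0)"
    proof (intro AE_I2 tendsto_intros)
      fix \<tau>
      have "(\<lambda>n. d n * \<tau>) \<longlonglongrightarrow> 0" using tendsto_mult_left_zero[OF dlim] .
      then show "(\<lambda>n. std_normal_density (d n * \<tau>)) \<longlonglongrightarrow> std_normal_density 0"
        using nd_cont by (auto intro: continuous_on_tendsto_compose)
    qed
    have nd1: "std_normal_density y \<le> 1" for y
    proof -
      have "exp (- y\<^sup>2 / 2) \<le> 1" by simp
      also have "1 \<le> sqrt (2 * pi)" using pi_gt3 by simp
      finally show ?thesis unfolding std_normal_density_def by (simp add: divide_simps)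
    qed
    show "AE \<tau> in lborel. norm (time_ft f \<tau> * cis (\<tau> * x) * of_real (std_normal_density (d n * \<tau>))) \<le> norm (time_ft f \<tau>)" for n
      using nd1 by (intro AE_I2) (simp add: norm_mult mult_left_le)
  qed (use int' in \<open>auto intro: integrable_norm\<close>)
  \<comment> \<open>The density at 0 is 1 / sqrt (2 * pi), so of the factor 2 * pi in
    \<open>inv_ft\<close> a square root survives; the second computation produces the same
    factor.\<close>
  also have "(LINT \<tau>|lborel. time_ft f \<tau> * cis (\<tau> * x) * of_real (std_normal_density 0)) =
     inv_ft (time_ft f) x * of_real (sqrt (2 * pi))"
    unfolding inv_ft_cis by (simp add: std_normal_density_def field_simps flip: of_real_mult)
  finally have lim1: "L \<longlonglongrightarrow> inv_ft (time_ft f) x * of_real (sqrt (2 * pi))" .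
  have Leq: "L n = (LINT y|lborel. f (x + d n * y) * of_real (sqrt (2 * pi) * std_normal_density y))" for n
  proof -
    let ?g = "\<lambda>t \<tau>. f t * cis (\<tau> * (x - t)) * of_real (std_normal_density (d n * \<tau>))"
    have nint: "integrable lborel (\<lambda>\<tau>. std_normal_density (d n * \<tau>))"
      using lborel_integrable_real_affine[of std_normal_density "d n" 0] d0[of n] by simp
    have int2: "integrable (lborel \<Otimes>\<^sub>M lborel) (case_prod ?g)"
    proof (rule lborel_pair.Fubini_integrable)
      have "(LINT \<tau>|lborel. norm (?g t \<tau>)) = norm (f t) * (LINT \<tau>|lborel. std_normal_density (d n * \<tau>))" for t
        by (simp add: norm_mult)
      then show "integrable lborel (\<lambda>t. LINT \<tau>|lborel. norm (case (t, \<tau>) of (t, \<tau>) \<Rightarrow> ?g t \<tau>))"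
        using int by (simp add: integrable_norm)
      have "integrable lborel (\<lambda>\<tau>. of_real (std_normal_density (d n * \<tau>)) * cis (\<tau> * (x - t)))" for t
        using nint by (intro integrable_mult_cis) auto
      then show "AE t in lborel. integrable lborel (\<lambda>\<tau>. case (t, \<tau>) of (t, \<tau>) \<Rightarrow> ?g t \<tau>)"
        by (auto simp: mult.assoc mult.commute[of "cis _"])
    qed simp
    have "L n = (LINT \<tau>|lborel. LINT t|lborel. ?g t \<tau>)"
      unfolding L_def time_ft_cis
      by (simp add: right_diff_distrib cis_mult mult_ac flip: integral_mult_left_zero integral_mult_right_zero)
    also have "\<dots> = (LINT t|lborel. LINT \<tau>|lborel. ?g t \<tau>)"
      by (rule lborel_pair.Fubini_integral[OF int2])
    also have "\<dots> = (LINT t|lborel. f t * of_real (exp (- ((x - t) / d n)\<^sup>2 / 2) / d n))"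
    proof (rule Bochner_Integration.integral_cong[OF refl])
      fix t
      have "(LINT \<tau>|lborel. ?g t \<tau>) = (LINT \<tau>|lborel. f t * (of_real (std_normal_density (d n * \<tau>)) * cis (\<tau> * (x - t))))"
        by (simp add: mult_ac)
      then show "(LINT \<tau>|lborel. ?g t \<tau>) = f t * of_real (exp (- ((x - t) / d n)\<^sup>2 / 2) / d n)"
        using gaussian_ft[OF d0, of n "x - t"] by simp
    qed
    also have "\<dots> = \<bar>d n\<bar> *\<^sub>R (LINT y|lborel. f (x + d n * y) * of_real (exp (- ((x - (x + d n * y)) / d n)\<^sup>2 / 2) / d n))"
      using d0[of n] by (subst lborel_integral_real_affine[where c = "d n" and t = x]) auto
    also have "\<dots> = (LINT y|lborel. f (x + d n * y) * of_real (sqrt (2 * pi) * std_normal_density y))"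
      using d0[of n] by (simp add: std_normal_density_def flip: integral_scaleR_right)
         (simp add: scaleR_conv_of_real)
    finally show ?thesis .
  qed
  have "(\<lambda>n. LINT y|lborel. f (x + d n * y) * of_real (sqrt (2 * pi) * std_normal_density y))
    \<longlonglongrightarrow> (LINT y|lborel. f x * of_real (sqrt (2 * pi) * std_normal_density y))"
  proof (rule integral_dominated_convergence[where w = "\<lambda>y. B * (sqrt (2 * pi) * std_normal_density y)"])
    show "AE y in lborel. (\<lambda>n. f (x + d n * y) * of_real (sqrt (2 * pi) * std_normal_density y))
        \<longlonglongrightarrow> f x * of_real (sqrt (2 * pi) * std_normal_density y)"
    proof (intro AE_I2 tendsto_mult tendsto_const)
      fix y
      have "(\<lambda>n. x + d n * y) \<longlonglongrightarrow> x" using tendsto_add[OF tendsto_const tendsto_mult_left_zero[OF dlim], of x y] by simp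
      then show "(\<lambda>n. f (x + d n * y)) \<longlonglongrightarrow> f x"
        using cont by (auto intro: continuous_on_tendsto_compose)
    qed
    show "AE y in lborel. norm (f (x + d n * y) * of_real (sqrt (2 * pi) * std_normal_density y)) \<le> B * (sqrt (2 * pi) * std_normal_density y)" for n
      by (intro AE_I2) (simp add: norm_mult B mult_right_mono)
  qed auto
  moreover have "(LINT y|lborel. f x * of_real (sqrt (2 * pi) * std_normal_density y)) = f x * of_real (sqrt (2 * pi))"
    by simp
  moreover have "L = (\<lambda>n. LINT y|lborel. f (x + d n * y) * of_real (sqrt (2 * pi) * std_normal_density y))"
    using Leq by (rule ext)
  ultimately have "L \<longlonglongrightarrow> f x * of_real (sqrt (2 * pi))" by simp
  then have "inv_ft (time_ft f) x * of_real (sqrt (2 * pi)) = f x * of_real (sqrt (2 * pi))"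
    using lim1 LIMSEQ_unique by blast
  then show ?thesis by simp
qed

text \<open>Since \<open>inv_ft\<close> is a reflected and rescaled \<open>time_ft\<close>, the
  substitution t -> - t reduces this order of composition to the previous one.\<close>

lemma time_ft_inv_ft:
  assumes "continuous_on UNIV f" and "bounded (range f)"
    and "integrable lborel f" and "integrable lborel (time_ft f)"
  shows "time_ft (inv_ft f) x = f x"
proof -
  have "time_ft (inv_ft f) x = (LINT t|lborel. time_ft f (- t) * cis (- (t * x))) / of_real (2 * pi)"
    unfolding time_ft_cis[of "inv_ft f"] inv_ft_def by (simp add: field_simps)
  also have "(LINT t|lborel. time_ft f (- t) * cis (- (t * x))) = (LINT t|lborel. time_ft f t * cis (t * x))"
    using lborel_integral_real_affine[where c = "-1" and t = 0 and f = "\<lambda>t. time_ft f t * cis (t * x)"] by simp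
  finally show ?thesis using time_ft_inversion[OF assms, of x]
    unfolding inv_ft_cis[of "time_ft f"] by simp
qed

section \<open>Quadratic decay and transforms of derivatives\<close>

lemma integrable_inverse_1_plus_sq: "integrable lborel (\<lambda>x::real. inverse (1 + x\<^sup>2))"
  using integrable_inverse_1_plus_square by (simp add: set_integrable_def)

text \<open>A class strong enough for integrability, boundedness and vanishing boundary terms, yet
  weak enough that a transform belongs to it as soon as two derivatives of the function are
  integrable.\<close>

definition quad_decay :: "(real \<Rightarrow> complex) \<Rightarrow> bool" where
  "quad_decay g \<longleftrightarrow> (\<exists>C. \<forall>t. norm (g t) \<le> C * inverse (1 + t\<^sup>2))"

lemma quad_decay_integrable:
  assumes "quad_decay g" and [measurable]: "g \<in> borel_measurable borel"
  shows "integrable lborel g"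
proof -
  obtain C where C: "\<And>t. norm (g t) \<le> C * inverse (1 + t\<^sup>2)"
    using assms by (auto simp: quad_decay_def)
  have "integrable lborel (\<lambda>t::real. C * inverse (1 + t\<^sup>2))"
    using integrable_inverse_1_plus_sq by simp
  then show ?thesis
    by (rule Bochner_Integration.integrable_bound) (auto intro!: order_trans[OF C])
qed

lemma quad_decay_bounded:
  assumes "quad_decay g" shows "bounded (range g)"
proof -
  obtain C where C: "\<And>t. norm (g t) \<le> C * inverse (1 + t\<^sup>2)"
    using assms by (auto simp: quad_decay_def)
  have C0: "C \<ge> 0" using order_trans[OF norm_ge_zero C[of 0]] by simp
  have "norm (g t) \<le> C" for t
  proof -
    have "inverse (1 + t\<^sup>2) \<le> 1" by (intro inverse_le_1_iff[THEN iffD2]) auto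
    then show ?thesis using C[of t] mult_left_mono[of "inverse (1 + t\<^sup>2)" 1 C] C0 by simp
  qed
  then show ?thesis by (auto simp: bounded_iff)
qed

lemma quad_decay_tendsto:
  assumes "quad_decay g" and "filterlim X at_infinity sequentially"
  shows "(\<lambda>n::nat. g (X n)) \<longlonglongrightarrow> 0"
proof -
  obtain C where C: "\<And>t. norm (g t) \<le> C * inverse (1 + t\<^sup>2)"
    using assms by (auto simp: quad_decay_def)
  have "((\<lambda>t::real. C * inverse (1 + t\<^sup>2)) \<longlongrightarrow> C * 0) at_infinity"
    unfolding at_infinity_eq_at_top_bot
    by (intro tendsto_mult_left filterlim_sup; real_asymp)
  then have "(\<lambda>n. C * inverse (1 + (X n)\<^sup>2)) \<longlonglongrightarrow> 0"
    using filterlim_compose[OF _ assms(2)] by fastforce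
  then show ?thesis by (rule Lim_null_comparison[rotated]) (simp add: C)
qed

lemma quad_decayI:
  assumes "bounded (range g)" and "bounded (range (\<lambda>t. of_real (t ^ 2) * g t))"
  shows "quad_decay g"
proof -
  obtain A B where A: "\<And>t. norm (g t) \<le> A" and B: "\<And>t. norm (of_real (t ^ 2) * g t) \<le> B"
    using assms by (auto simp: bounded_iff)
  have "norm (g t) \<le> (A + B) * inverse (1 + t\<^sup>2)" for t
  proof -
    have "norm (g t) * (1 + t\<^sup>2) \<le> A + B"
      using A[of t] B[of t] by (simp add: norm_mult algebra_simps norm_power)
    then show ?thesis by (simp add: field_simps pos_le_divide_eq add_pos_nonneg)
  qed
  then show ?thesis by (auto simp: quad_decay_def)
qed

lemma quad_decay_mult_cis: "quad_decay f \<Longrightarrow> quad_decay (\<lambda>t. f t * cis (h t))"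
  by (simp add: quad_decay_def norm_mult)

text \<open>On {-n..n} the fundamental theorem of calculus leaves only boundary values of
  \<open>F\<close>, which decay, while dominated convergence recovers the full integral.\<close>

lemma integral_derivative_eq_0:
  assumes "\<And>t. (F has_vector_derivative f t) (at t)" "continuous_on UNIV f"
    and "integrable lborel f" and "quad_decay F"
  shows "(LINT t|lborel. f t) = 0"
proof -
  have [measurable]: "f \<in> borel_measurable borel" using assms by auto
  have "(\<lambda>n. LINT t|lborel. indicator {- real n..real n} t *\<^sub>R f t) \<longlonglongrightarrow> (LINT t|lborel. f t)"
  proof (rule integral_dominated_convergence[where w = "\<lambda>t. norm (f t)"])
    show "AE t in lborel. (\<lambda>n. indicator {- real n..real n} t *\<^sub>R f t) \<longlonglongrightarrow> f t"
    proof (rule AE_I2)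
      fix t
      have "eventually (\<lambda>n. real n \<ge> \<bar>t\<bar>) sequentially" by real_asymp
      then have "eventually (\<lambda>n. indicator {- real n..real n} t *\<^sub>R f t = f t) sequentially"
        by eventually_elim (auto simp: indicator_def)
      then show "(\<lambda>n. indicator {- real n..real n} t *\<^sub>R f t) \<longlonglongrightarrow> f t"
        by (rule tendsto_eventually)
    qed
  qed (use assms in \<open>auto simp: indicator_def\<close>)
  moreover have "(LINT t|lborel. indicator {- real n..real n} t *\<^sub>R f t) = F (real n) - F (- real n)" for n
    using assms(1,2) by (intro integral_FTC_Icc) (auto intro: has_vector_derivative_at_within continuous_on_subset)
  moreover have "(\<lambda>n. F (real n) - F (- real n)) \<longlonglongrightarrow> 0 - 0"
    by (intro tendsto_diff quad_decay_tendsto[OF assms(4)] filterlim_at_infinity_conv_norm_at_top[THEN iffD2])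
      (simp_all add: filterlim_real_sequentially)
  ultimately show ?thesis using LIMSEQ_unique by fastforce
qed

text \<open>Integration by parts in the form: the derivative of \<open>f t * cis (- (t * s))\<close>
  integrates to zero, and its two summands are the two transforms.\<close>

lemma time_ft_derivative:
  assumes d: "\<And>t. (f has_vector_derivative f' t) (at t)" and "continuous_on UNIV f'"
    and "quad_decay f" "quad_decay f'"
  shows "time_ft f' s = \<i> * of_real s * time_ft f s"
proof -
  have cf: "continuous_on UNIV f"
    using d by (auto simp: continuous_on_eq_continuous_within intro: has_vector_derivative_continuous)
  have [measurable]: "f \<in> borel_measurable borel" "f' \<in> borel_measurable borel"
    using cf assms(2) by (auto intro: borel_measurable_continuous_onI)
  have i: "integrable lborel (\<lambda>t. f t * cis (- (t * s)))" "integrable lborel (\<lambda>t. f' t * cis (- (t * s)))"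
    by (intro integrable_mult_cis quad_decay_integrable assms; simp)+
  have "(LINT t|lborel. f' t * cis (- (t * s)) - \<i> * of_real s * (f t * cis (- (t * s)))) = 0"
  proof (rule integral_derivative_eq_0)
    show "quad_decay (\<lambda>t. f t * cis (- (t * s)))" by (intro quad_decay_mult_cis assms)
    show "((\<lambda>t. f t * cis (- (t * s))) has_vector_derivative
          f' t * cis (- (t * s)) - \<i> * of_real s * (f t * cis (- (t * s)))) (at t)" for t
    proof -
      have "((\<lambda>t. exp ((- \<i> * of_real s) * of_real t)) has_vector_derivative (- \<i> * of_real s) * exp ((- \<i> * of_real s) * of_real t)) (at t)"
        by (rule has_vector_derivative_real_field) (auto intro!: derivative_eq_intros)
      then have "((\<lambda>t. cis (- (t * s))) has_vector_derivative (- \<i> * of_real s) * cis (- (t * s))) (at t)"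
        by (simp add: cis_conv_exp mult_ac)
      from has_vector_derivative_mult[OF d this] show ?thesis by (simp add: algebra_simps)
    qed
    show "continuous_on UNIV (\<lambda>t. f' t * cis (- (t * s)) - \<i> * of_real s * (f t * cis (- (t * s))))"
      by (intro continuous_intros cf assms)
  qed (use i in auto)
  then show ?thesis unfolding time_ft_cis using i by simp
qed

text \<open>Two integrations by parts show that s^2 times the transform is, up to sign, the
  transform of \<open>f''\<close>, which the L1 norm of \<open>f''\<close> bounds.\<close>

lemma time_ft_quad_decay:
  assumes d: "\<And>t. (f has_vector_derivative f' t) (at t)" "\<And>t. (f' has_vector_derivative f'' t) (at t)"
    and "continuous_on UNIV f''"
    and q: "quad_decay f" "quad_decay f'" "quad_decay f''"
  shows "quad_decay (time_ft f)"
proof (rule quad_decayI)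
  have cf: "continuous_on UNIV f" "continuous_on UNIV f'"
    using d by (auto simp: continuous_on_eq_continuous_within intro: has_vector_derivative_continuous)
  have "- (time_ft f'' s) = of_real (s ^ 2) * time_ft f s" for s
    using time_ft_derivative[OF d(1) cf(2) q(1,2)] time_ft_derivative[OF d(2) assms(3) q(2,3)]
    by (simp add: power2_eq_square algebra_simps)
  then have "norm (of_real (s ^ 2) * time_ft f s) \<le> (LINT t|lborel. norm (f'' t))" for s
    using norm_time_ft_le[of f'' s] by (metis norm_minus_cancel)
  then show "bounded (range (\<lambda>s. of_real (s ^ 2) * time_ft f s))"
    unfolding bounded_iff by blast
  show "bounded (range (time_ft f))"
    unfolding bounded_iff using norm_time_ft_le[of f] by blast
qed

section \<open>Smooth and Schwartz functions\<close>

lemma smooth_has_vderiv: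
  assumes "smooth \<phi>"
  shows "((vderiv ^^ n) \<phi> has_vector_derivative (vderiv ^^ Suc n) \<phi> t) (at t)"
  using assms vector_derivative_works by (fastforce simp: smooth_def vderiv_def)

lemma smooth_continuous:
  assumes "smooth \<phi>"
  shows "continuous_on UNIV ((vderiv ^^ n) \<phi>)"
  using smooth_has_vderiv[OF assms]
  by (auto simp: continuous_on_eq_continuous_within intro: has_vector_derivative_continuous)

lemma schwartz_quad_decay: "schwartz \<phi> \<Longrightarrow> quad_decay ((vderiv ^^ n) \<phi>)"
  unfolding schwartz_def
  by (rule quad_decayI) (metis (no_types, lifting) power_0 of_real_1 mult_1 ext image_cong, blast)

lemma schwartz_ft_integrable:
  assumes "schwartz \<phi>"
  shows "integrable lborel \<phi>" "integrable lborel (time_ft \<phi>)"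
    "continuous_on UNIV \<phi>" "bounded (range \<phi>)"
proof -
  have s: "smooth \<phi>" using assms by (simp add: schwartz_def)
  show c: "continuous_on UNIV \<phi>" using smooth_continuous[OF s, of 0] by simp
  have q: "quad_decay \<phi>" using schwartz_quad_decay[OF assms, of 0] by simp
  show "integrable lborel \<phi>" using q c by (auto intro!: quad_decay_integrable borel_measurable_continuous_onI)
  then have [measurable]: "\<phi> \<in> borel_measurable borel" by auto
  show "bounded (range \<phi>)" by (rule quad_decay_bounded[OF q])
  have "quad_decay (time_ft ((vderiv ^^ 0) \<phi>))"
    by (rule time_ft_quad_decay[OF smooth_has_vderiv[OF s] smooth_has_vderiv[OF s] smooth_continuous[OF s]])
      (intro schwartz_quad_decay assms)+
  then show "integrable lborel (time_ft \<phi>)"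
    by (auto intro!: quad_decay_integrable time_ft_measurable)
qed

section \<open>Smooth bump functions\<close>

text \<open>Apply 1 + x \<le> exp x at x = y / n and take the n-th power. With y = l / q it shows
  that exp (- l / q) beats every inverse power of q.\<close>

lemma power_mult_exp_le:
  fixes y :: real
  assumes "y \<ge> 0" "n > 0"
  shows "y ^ n \<le> of_nat n ^ n * exp y"
proof -
  have "(y / n) ^ n \<le> exp (y / n) ^ n"
    using assms exp_ge_add_one_self[of "y / n"] by (intro power_mono) (auto simp del: exp_ge_add_one_self)
  also have "\<dots> = exp y" using assms by (simp flip: exp_of_nat_mult)
  finally show ?thesis using assms by (simp add: power_divide field_simps)
qed

text \<open>One quadratic with zeros at both ends makes a single exponential flat at both ends. It
  is kept as a polynomial so that \<open>pderiv\<close> can describe derivatives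
  symbolically.\<close>

definition bump_quad :: "real \<Rightarrow> real \<Rightarrow> real poly" where
  "bump_quad a c = [:- a * c, a + c, - 1:]"

lemma poly_bump_quad: "poly (bump_quad a c) t = (t - a) * (c - t)"
  by (simp add: bump_quad_def algebra_simps)

text \<open>For fixed \<open>a < c\<close> and \<open>l > 0\<close> the functions below form a family closed under differentiation and
  under multiplication by \<open>t\<close>; all their smoothness and decay properties follow from this.\<close>

definition bump :: "real \<Rightarrow> real \<Rightarrow> real \<Rightarrow> real poly \<Rightarrow> nat \<Rightarrow> real \<Rightarrow> real" where
  "bump a c l p m t = (if a < t \<and> t < c
     then poly p t / poly (bump_quad a c) t ^ m * exp (- l / poly (bump_quad a c) t) else 0)"

text \<open>The numerator of the derivative of p / q^m * exp (- l / q) over the common denominator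
  q^(m + 2): the terms come from p, from q^(- m), and from the exponent, whose derivative is l q' /
  q^2.\<close>

definition bump_deriv :: "real \<Rightarrow> real \<Rightarrow> real \<Rightarrow> real poly \<Rightarrow> nat \<Rightarrow> real poly" where
  "bump_deriv a c l p m = pderiv p * bump_quad a c ^ 2
     - smult (of_nat m) (p * pderiv (bump_quad a c) * bump_quad a c)
     + smult l (p * pderiv (bump_quad a c))"

lemma bump_mult: "t * bump a c l p m t = bump a c l (pCons 0 p) m t"
  by (simp add: bump_def)

text \<open>The exponential yields m + 2 powers of q: m of them cancel the denominator, and the
  remaining two force value and derivative to vanish at the endpoints.\<close>

lemma bump_le_quad_sq:
  assumes "l > 0"
  shows "\<exists>C\<ge>0. \<forall>t. a < t \<longrightarrow> t < c \<longrightarrow> \<bar>bump a c l p m t\<bar> \<le> C * poly (bump_quad a c) t ^ 2"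
proof -
  have "compact (poly p ` {a..c})"
    by (intro compact_continuous_image continuous_intros) auto
  then obtain M where M: "\<And>t. t \<in> {a..c} \<Longrightarrow> \<bar>poly p t\<bar> \<le> M" "M \<ge> 0"
    by (metis (no_types, lifting) bounded_pos compact_imp_bounded image_eqI less_imp_le real_norm_def)
  \<comment> \<open>\<open>power_mult_exp_le\<close> at y = l / q with exponent m + 2, solved for
    exp (- l / q), gives this constant.\<close>
  define K where "K = of_nat (m + 2) ^ (m + 2) / l ^ (m + 2)"
  have K: "K \<ge> 0" using assms by (simp add: K_def)
  define C where "C = M * K"
  have "\<bar>bump a c l p m t\<bar> \<le> C * poly (bump_quad a c) t ^ 2" if t: "a < t" "t < c" for t
  proof -
    define q where "q = poly (bump_quad a c) t"
    have q: "q > 0" using t by (simp add: q_def poly_bump_quad)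
    have "(l / q) ^ (m + 2) \<le> of_nat (m + 2) ^ (m + 2) * exp (l / q)"
      using assms q by (intro power_mult_exp_le) auto
    then have "exp (- l / q) \<le> K * q ^ (m + 2)"
      unfolding K_def using assms q by (simp add: exp_minus field_simps power_divide)
    then have "1 / q ^ m * exp (- l / q) \<le> 1 / q ^ m * (K * q ^ (m + 2))"
      using q by (intro mult_left_mono) auto
    also have "\<dots> = K * q ^ 2"
      using q by (simp add: power_add power2_eq_square)
    finally have "\<bar>poly p t\<bar> * (1 / q ^ m * exp (- l / q)) \<le> M * (K * q ^ 2)"
      using M(1)[of t] M(2) t q by (intro mult_mono[of "\<bar>poly p t\<bar>" M]) auto
    then show ?thesis using t q by (simp add: bump_def C_def abs_mult flip: q_def)
  qed
  moreover have "C \<ge> 0" using M K by (simp add: C_def)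
  ultimately show ?thesis by blast
qed

lemma has_real_derivative_zero_quadratic:
  fixes f :: "real \<Rightarrow> real"
  assumes "\<And>t. \<bar>f t\<bar> \<le> C * (t - x)\<^sup>2"
  shows "(f has_real_derivative 0) (at x)"
proof -
  have f0: "f x = 0" using assms[of x] by simp
  have "((\<lambda>h. (f (x + h) - f x) / h) \<longlongrightarrow> 0) (at 0)"
  proof (rule Lim_null_comparison)
    show "\<forall>\<^sub>F h in at 0. norm ((f (x + h) - f x) / h) \<le> C * \<bar>h\<bar>"
    proof (rule eventually_mono[OF eventually_neq_at_within[of 0 0 UNIV]])
      fix h :: real assume "h \<noteq> 0"
      then show "norm ((f (x + h) - f x) / h) \<le> C * \<bar>h\<bar>"
        using assms[of "x + h"] f0 by (simp add: divide_le_eq power2_eq_square abs_mult)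
    qed
    have "((\<lambda>h. C * \<bar>h\<bar>) \<longlongrightarrow> C * \<bar>0\<bar>) (at 0)" by (intro tendsto_intros)
    then show "((\<lambda>h. C * \<bar>h\<bar>) \<longlongrightarrow> 0) (at 0)" by simp
  qed
  then show ?thesis unfolding DERIV_def .
qed

text \<open>Inside the interval these are the usual rules, outside everything is zero. At an
  endpoint the function is dominated by a multiple of the squared distance to it, so the derivative
  is 0, the value that \<open>bump\<close> takes there by its second branch.\<close>

lemma bump_has_derivative:
  assumes "l > 0" "a < c"
  shows "(bump a c l p m has_real_derivative bump a c l (bump_deriv a c l p m) (m + 2) t) (at t)"
proof -
  consider "a < t \<and> t < c" | "t < a \<or> c < t" | "t = a \<or> t = c" by linarith
  then show ?thesis
  proof cases
    case 1
    define q where "q = poly (bump_quad a c) t"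
    have q: "q > 0" using 1 by (simp add: q_def poly_bump_quad)
    define q' where "q' = poly (pderiv (bump_quad a c)) t"
    define E where "E = exp (- l / q)"
    define N where "N = q ^ m"
    have N: "N > 0" using q by (simp add: N_def)
    \<comment> \<open>Truncated subtraction is harmless: for m = 0 the exponent m - 1 is 0, but both
      sides carry the factor 0.\<close>
    have R: "of_nat m * q ^ (m - 1) = of_nat m * N / q"
      using q by (cases m) (auto simp: N_def)
    have dq: "(poly (bump_quad a c) has_real_derivative q') (at t)"
      unfolding q'_def by (rule poly_DERIV)
    have "((\<lambda>t. poly (bump_quad a c) t ^ m) has_real_derivative of_nat m * q ^ (m - 1) * q') (at t)"
      using DERIV_power[OF dq, of m] by (simp add: q_def mult_ac)
    then have dN: "((\<lambda>t. poly (bump_quad a c) t ^ m) has_real_derivative of_nat m * N / q * q') (at t)"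
      by (simp only: R)
    have dE: "((\<lambda>t. exp (- l / poly (bump_quad a c) t)) has_real_derivative E * (l * q' / q\<^sup>2)) (at t)"
      using q unfolding E_def q_def q'_def by (auto intro!: derivative_eq_intros poly_DERIV simp: power2_eq_square)
    have "((\<lambda>t. poly p t / poly (bump_quad a c) t ^ m * exp (- l / poly (bump_quad a c) t))
      has_real_derivative (poly (pderiv p) t * N - poly p t * (of_nat m * N / q * q')) / (N * N) * E
       + E * (l * q' / q\<^sup>2) * (poly p t / N)) (at t)"
      using DERIV_mult[OF DERIV_divide[OF poly_DERIV[of p] dN] dE] q
      by (simp add: E_def N_def q_def)
    also have "(poly (pderiv p) t * N - poly p t * (of_nat m * N / q * q')) / (N * N) * E
       + E * (l * q' / q\<^sup>2) * (poly p t / N)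
       = (poly (pderiv p) t * q\<^sup>2 - of_nat m * (poly p t * q' * q) + l * (poly p t * q')) / (N * q\<^sup>2) * E"
      using q N by (simp add: field_simps power2_eq_square)
    also have "\<dots> = bump a c l (bump_deriv a c l p m) (m + 2) t"
      using 1 by (simp add: bump_def bump_deriv_def E_def N_def power_add q'_def flip: q_def) (simp add: power2_eq_square)
    finally have "((\<lambda>t. poly p t / poly (bump_quad a c) t ^ m * exp (- l / poly (bump_quad a c) t))
      has_real_derivative bump a c l (bump_deriv a c l p m) (m + 2) t) (at t)" .
    then show ?thesis
      by (rule has_field_derivative_transform_within_open[where S = "{a<..<c}"])
        (use 1 in \<open>auto simp: bump_def\<close>)
  next
    case 2
    have "((\<lambda>_. 0) has_real_derivative 0) (at t)" by simp
    then have "(bump a c l p m has_real_derivative 0) (at t)"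
      by (rule has_field_derivative_transform_within_open[where S = "{..<a} \<union> {c<..}"])
        (use 2 in \<open>auto simp: bump_def\<close>)
    moreover have "bump a c l (bump_deriv a c l p m) (m + 2) t = 0" using 2 by (auto simp: bump_def)
    ultimately show ?thesis by simp
  next
    case 3
    obtain C where C: "C \<ge> 0" "\<And>t. a < t \<Longrightarrow> t < c \<Longrightarrow> \<bar>bump a c l p m t\<bar> \<le> C * poly (bump_quad a c) t ^ 2"
      using bump_le_quad_sq[OF assms(1)] by blast
    have "\<bar>bump a c l p m s\<bar> \<le> C * (c - a)\<^sup>2 * (s - t)\<^sup>2" for s
    proof (cases "a < s \<and> s < c")
      case True
      have "poly (bump_quad a c) s ^ 2 = (s - a)\<^sup>2 * (c - s)\<^sup>2"
        by (simp add: poly_bump_quad power_mult_distrib)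
      \<comment> \<open>Of the two factors s - a and c - s, one equals the distance from s to the
        endpoint t and the other is at most c - a.\<close>
      also have "\<dots> \<le> (c - a)\<^sup>2 * (s - t)\<^sup>2"
        using 3
      proof
        assume "t = a"
        show ?thesis unfolding \<open>t = a\<close> mult.commute[of "(s - a)\<^sup>2"] using True by (intro mult_mono power_mono) auto
      next
        assume "t = c"
        show ?thesis unfolding \<open>t = c\<close> power2_commute[of s c] using True by (intro mult_mono power_mono) auto
      qed
      finally have "C * poly (bump_quad a c) s ^ 2 \<le> C * ((c - a)\<^sup>2 * (s - t)\<^sup>2)"
        using C(1) by (rule mult_left_mono)
      then show ?thesis using C(2)[of s] True by (simp add: mult.assoc)
    next
      case False
      then have "bump a c l p m s = 0" unfolding bump_def by (rule if_not_P)
      then show ?thesis using C(1) by simp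
    qed
    then have "(bump a c l p m has_real_derivative 0) (at t)"
      by (rule has_real_derivative_zero_quadratic)
    moreover have "bump a c l (bump_deriv a c l p m) (m + 2) t = 0" using 3 by (auto simp: bump_def)
    ultimately show ?thesis by simp
  qed
qed

section \<open>Complex bumps and their inverse transforms\<close>

definition cbump :: "real \<Rightarrow> real \<Rightarrow> real \<Rightarrow> real poly \<Rightarrow> nat \<Rightarrow> real \<Rightarrow> complex" where
  "cbump a c l p m t = of_real (bump a c l p m t)"

text \<open>A set closed under differentiation contains all iterated derivatives of its members.
  Smoothness of a whole family then follows from one derivative rule.\<close>

lemma smooth_familyI:
  assumes "f \<in> S" and "\<And>g. g \<in> S \<Longrightarrow> \<exists>h\<in>S. \<forall>t. (g has_vector_derivative h t) (at t)"
  shows "smooth f" "(vderiv ^^ n) f \<in> S"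
proof -
  have *: "(vderiv ^^ n) f \<in> S" for n
  proof (induction n)
    case (Suc n)
    obtain h where h: "h \<in> S" "\<And>t. ((vderiv ^^ n) f has_vector_derivative h t) (at t)"
      using assms(2)[OF Suc] by blast
    then have "vderiv ((vderiv ^^ n) f) = h"
      by (auto simp: vderiv_def intro!: ext vector_derivative_at)
    then show ?case using h by simp
  qed (use assms in simp)
  then show "(vderiv ^^ n) f \<in> S" .
  show "smooth f" unfolding smooth_def
    using assms(2)[OF *] differentiableI_vector by blast
qed

context
  fixes a c l :: real
  assumes l: "l > 0" and ac: "a < c"
begin

lemma cbump_has_derivative:
  "(cbump a c l p m has_vector_derivative cbump a c l (bump_deriv a c l p m) (m + 2) t) (at t)"
  unfolding cbump_def using bump_has_derivative[OF l ac]
  by (rule has_vector_derivative_of_real)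

lemma cbump_continuous: "continuous_on A (cbump a c l p m)"
  using cbump_has_derivative
  by (auto intro!: continuous_at_imp_continuous_on has_vector_derivative_continuous)

lemma cbump_measurable [measurable]: "cbump a c l p m \<in> borel_measurable borel"
  by (intro borel_measurable_continuous_onI cbump_continuous)

lemma cbump_eq_0: "t \<notin> {a..c} \<Longrightarrow> cbump a c l p m t = 0"
  by (auto simp: cbump_def bump_def)

lemma cbump_smooth: "smooth (cbump a c l p m)"
  by (rule smooth_familyI[where S = "{cbump a c l p m |p m. True}"]) (use cbump_has_derivative in blast)+

lemma cbump_integral:
  assumes "continuous_on {a..c} g"
  shows "integrable lborel (\<lambda>t. cbump a c l p m t * g t)"
    and "(LINT t|lborel. cbump a c l p m t * g t) = integral {a..c} (\<lambda>t. cbump a c l p m t * g t)"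
proof -
  have si: "set_integrable lborel {a..c} (\<lambda>t. cbump a c l p m t * g t)"
    by (intro borel_integrable_atLeastAtMost' continuous_intros cbump_continuous assms)
  have eq: "indicator {a..c} t *\<^sub>R (cbump a c l p m t * g t) = cbump a c l p m t * g t" for t
    using cbump_eq_0[of t] by (auto simp: indicator_def)
  show "integrable lborel (\<lambda>t. cbump a c l p m t * g t)"
    using si by (simp add: set_integrable_def eq)
  show "(LINT t|lborel. cbump a c l p m t * g t) = integral {a..c} (\<lambda>t. cbump a c l p m t * g t)"
    using set_borel_integral_eq_integral(2)[OF si] by (simp add: set_lebesgue_integral_def eq)
qed

lemma cbump_integrable: "integrable lborel (cbump a c l p m)"
  using cbump_integral(1)[of "\<lambda>_. 1"] by simp

lemma cbump_bounded: "bounded (range (cbump a c l p m))"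
proof -
  have "bounded (cbump a c l p m ` {a..c})"
    by (intro compact_imp_bounded compact_continuous_image cbump_continuous) auto
  then have "bounded (insert 0 (cbump a c l p m ` {a..c}))" by simp
  then show ?thesis by (rule bounded_subset) (use cbump_eq_0 in blast)
qed

lemma cbump_quad_decay: "quad_decay (cbump a c l p m)"
proof (rule quad_decayI[OF cbump_bounded])
  have eq: "(\<lambda>t. of_real (t ^ 2) * cbump a c l p m t) = cbump a c l (pCons 0 (pCons 0 p)) m"
    by (auto simp: cbump_def power2_eq_square mult.assoc simp flip: bump_mult)
  show "bounded (range (\<lambda>t. of_real (t ^ 2) * cbump a c l p m t))"
    unfolding eq by (rule cbump_bounded)
qed

text \<open>Compact support turns the integral over the line into one over a fixed box, the form in
  which the Leibniz rule for parameters applies.\<close>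

lemma inv_ft_cbump_integral:
  "inv_ft (cbump a c l p m) s = integral (cbox a c) (\<lambda>t. cbump a c l p m t * cis (t * s)) / of_real (2 * pi)"
  unfolding inv_ft_cis by (subst cbump_integral(2)) (auto intro!: continuous_intros)

text \<open>Differentiation in s brings down the factor \<i> t, and the t is absorbed into the
  polynomial as \<open>pCons 0 p\<close>.\<close>

lemma inv_ft_cbump_derivative:
  "(inv_ft (cbump a c l p m) has_vector_derivative \<i> * inv_ft (cbump a c l (pCons 0 p) m) s) (at s)"
proof -
  have "((\<lambda>s. integral (cbox a c) (\<lambda>t. cbump a c l p m t * cis (t * s))) has_vector_derivative
       integral (cbox a c) (\<lambda>t. cbump a c l p m t * (\<i> * of_real t * cis (t * s)))) (at s within UNIV)"
  proof (rule leibniz_rule_vector_derivative)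
    show "((\<lambda>s. cbump a c l p m t * cis (t * s)) has_vector_derivative
        cbump a c l p m t * (\<i> * of_real t * cis (t * x))) (at x within UNIV)" for x t
    proof -
      have "((\<lambda>s. exp ((\<i> * of_real t) * of_real s)) has_vector_derivative (\<i> * of_real t) * exp ((\<i> * of_real t) * of_real x)) (at x)"
        by (rule has_vector_derivative_real_field) (auto intro!: derivative_eq_intros)
      then have "((\<lambda>s. cis (t * s)) has_vector_derivative (\<i> * of_real t) * cis (t * x)) (at x)"
        by (simp add: cis_conv_exp mult_ac)
      then show ?thesis by (intro has_vector_derivative_mult_right) simp
    qed
    show "(\<lambda>t. cbump a c l p m t * cis (t * x)) integrable_on cbox a c" for x
      by (intro integrable_continuous continuous_intros cbump_continuous)
    have "continuous_on (UNIV \<times> cbox a c) (\<lambda>z. cbump a c l p m (snd z))"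
      by (rule continuous_on_compose2[OF cbump_continuous[of UNIV] continuous_on_snd[OF continuous_on_id]]) auto
    then show "continuous_on (UNIV \<times> cbox a c) (\<lambda>(x, t). cbump a c l p m t * (\<i> * of_real t * cis (t * x)))"
      unfolding case_prod_beta by (intro continuous_intros)
  qed auto
  moreover have "cbump a c l p m t * (\<i> * of_real t * cis (t * s)) = \<i> * (cbump a c l (pCons 0 p) m t * cis (t * s))" for t
    by (simp add: cbump_def flip: bump_mult)
  ultimately have "((\<lambda>s. integral (cbox a c) (\<lambda>t. cbump a c l p m t * cis (t * s))) has_vector_derivative
       \<i> * integral (cbox a c) (\<lambda>t. cbump a c l (pCons 0 p) m t * cis (t * s))) (at s)"
    by simp
  then have "((\<lambda>s. integral (cbox a c) (\<lambda>t. cbump a c l p m t * cis (t * s)) / of_real (2 * pi)) has_vector_derivative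
       \<i> * integral (cbox a c) (\<lambda>t. cbump a c l (pCons 0 p) m t * cis (t * s)) / of_real (2 * pi)) (at s)"
    by (rule has_vector_derivative_divide)
  then show ?thesis unfolding inv_ft_cbump_integral[abs_def] by simp
qed

text \<open>The dual rule: multiplication by s is, after integration by parts, differentiation of
  the bump. With the previous rule, every Schwartz seminorm becomes a supremum norm of a member of
  one family.\<close>

lemma inv_ft_cbump_mult:
  "of_real s * inv_ft (cbump a c l p m) s = \<i> * inv_ft (cbump a c l (bump_deriv a c l p m) (m + 2)) s"
  using time_ft_derivative[OF cbump_has_derivative cbump_continuous cbump_quad_decay cbump_quad_decay, of p m "- s"]
  by (simp add: inv_ft_def field_simps)

lemma inv_ft_cbump_schwartz: "schwartz (inv_ft (cbump a c l p m))"
proof -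
  \<comment> \<open>The scalar z collects the powers of \<i> that the two rules produce.\<close>
  define S where "S = {\<lambda>s. z * inv_ft (cbump a c l p m) s |z p m. True}"
  have mem: "inv_ft (cbump a c l p m) \<in> S" for p m
    unfolding S_def mem_Collect_eq by (rule exI[of _ 1], rule exI[of _ p], rule exI[of _ m]) simp
  have der: "\<exists>h\<in>S. \<forall>t. (g has_vector_derivative h t) (at t)" if gS: "g \<in> S" for g
  proof -
    obtain z p m where g: "g = (\<lambda>s. z * inv_ft (cbump a c l p m) s)"
      using gS unfolding S_def mem_Collect_eq by blast
    have "(g has_vector_derivative (\<lambda>s. (z * \<i>) * inv_ft (cbump a c l (pCons 0 p) m) s) s) (at s)" for s
      unfolding g mult.assoc by (intro has_vector_derivative_mult_right inv_ft_cbump_derivative)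
    moreover have "(\<lambda>s. (z * \<i>) * inv_ft (cbump a c l (pCons 0 p) m) s) \<in> S" by (auto simp: S_def)
    ultimately show ?thesis
      by (intro bexI[where x = "\<lambda>s. (z * \<i>) * inv_ft (cbump a c l (pCons 0 p) m) s"] allI)
  qed
  have mult: "(\<lambda>s. of_real (s ^ j) * g s) \<in> S" if gS: "g \<in> S" for g j
  proof (induction j)
    case (Suc j)
    obtain z p m where g: "(\<lambda>s. of_real (s ^ j) * g s) = (\<lambda>s. z * inv_ft (cbump a c l p m) s)"
      using Suc unfolding S_def mem_Collect_eq by blast
    have "of_real (s ^ Suc j) * g s = (z * \<i>) * inv_ft (cbump a c l (bump_deriv a c l p m) (m + 2)) s" for s
    proof -
      have "of_real (s ^ Suc j) * g s = of_real s * (of_real (s ^ j) * g s)" by simp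
      also have "\<dots> = z * (of_real s * inv_ft (cbump a c l p m) s)"
        using fun_cong[OF g, of s] by simp
      finally show ?thesis unfolding inv_ft_cbump_mult by simp
    qed
    then have "(\<lambda>s. of_real (s ^ Suc j) * g s) =
        (\<lambda>s. (z * \<i>) * inv_ft (cbump a c l (bump_deriv a c l p m) (m + 2)) s)" by (rule ext)
    then show ?case unfolding S_def by blast
  qed (use gS in simp)
  have bdd: "bounded (range g)" if gS: "g \<in> S" for g
  proof -
    obtain z p m where g: "g = (\<lambda>s. z * inv_ft (cbump a c l p m) s)"
      using gS unfolding S_def mem_Collect_eq by blast
    have "norm (g s) \<le> norm z * ((LINT t|lborel. norm (cbump a c l p m t)) / (2 * pi))" for s
      unfolding g inv_ft_def norm_mult norm_divide
      by (intro mult_left_mono) (auto intro!: divide_right_mono norm_time_ft_le)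
    then show ?thesis unfolding bounded_iff by blast
  qed
  show ?thesis unfolding schwartz_def
    by (intro conjI allI smooth_familyI(1)[OF mem der] bdd mult smooth_familyI(2)[OF mem der])
qed

lemma cbump_schwartz: "schwartz (cbump a c l p m)"
proof -
  define S where "S = {cbump a c l p m |p m. True}"
  have mem: "cbump a c l p m \<in> S" for p m by (auto simp: S_def)
  have der: "\<exists>h\<in>S. \<forall>t. (g has_vector_derivative h t) (at t)" if gS: "g \<in> S" for g
    using gS cbump_has_derivative unfolding S_def by blast
  have mult: "(\<lambda>s. of_real (s ^ j) * g s) \<in> S" if gS: "g \<in> S" for g j
  proof (induction j)
    case (Suc j)
    obtain p m where g: "(\<lambda>s. of_real (s ^ j) * g s) = cbump a c l p m"
      using Suc unfolding S_def mem_Collect_eq by blast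
    have "of_real (s ^ Suc j) * g s = cbump a c l (pCons 0 p) m s" for s
    proof -
      have "of_real (s ^ Suc j) * g s = of_real s * (of_real (s ^ j) * g s)" by simp
      also have "\<dots> = of_real s * cbump a c l p m s"
        using fun_cong[OF g, of s] by simp
      finally show ?thesis by (simp add: cbump_def flip: bump_mult)
    qed
    then have "(\<lambda>s. of_real (s ^ Suc j) * g s) = cbump a c l (pCons 0 p) m" by (rule ext)
    then show ?case unfolding S_def by blast
  qed (use gS in simp)
  have bdd: "bounded (range g)" if gS: "g \<in> S" for g
    using gS cbump_bounded by (auto simp: S_def)
  then show ?thesis unfolding schwartz_def
    by (intro conjI allI smooth_familyI(1)[OF mem der] bdd mult smooth_familyI(2)[OF mem der])
qed

text \<open>This exhibits each bump as \<open>time_ft\<close> of a Schwartz function, hence as an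
  argument about which \<open>has_ft\<close> makes a statement.\<close>

lemma time_ft_inv_ft_cbump: "time_ft (inv_ft (cbump a c l p m)) = cbump a c l p m"
proof
  have "quad_decay (time_ft (cbump a c l p m))"
    by (rule time_ft_quad_decay[OF cbump_has_derivative cbump_has_derivative])
      (intro cbump_continuous cbump_quad_decay)+
  then have "integrable lborel (time_ft (cbump a c l p m))"
    by (auto intro!: quad_decay_integrable time_ft_measurable)
  then show "time_ft (inv_ft (cbump a c l p m)) x = cbump a c l p m x" for x
    by (intro time_ft_inv_ft cbump_continuous cbump_bounded cbump_integrable)
qed

end

lemma test_function_cbump:
  assumes "0 < a" "a < c" "c < T" "l > 0"
  shows "test_function T (cbump a c l p m)"
  unfolding test_function_def using assms cbump_smooth cbump_eq_0 by blast

section \<open>Identification of the temporal modes\<close>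

text \<open>Open intervals form an intersection-stable generator of the Borel sets, so by Dynkin's
  argument the integral vanishes over every Borel set.\<close>

lemma integral_Ioo_zero_imp_AE_zero:
  fixes g :: "real \<Rightarrow> complex"
  assumes g: "integrable lborel g"
    and zero: "\<And>a b. (LINT t:{a<..<b}|lborel. g t) = 0"
  shows "AE t in lborel. g t = 0"
proof -
  have [measurable]: "g \<in> borel_measurable borel" using g by auto
  \<comment> \<open>The complement step of the induction needs the total integral, obtained as a
    limit over growing intervals.\<close>
  have "(LINT t:UNIV|lborel. g t) = 0"
  proof -
    have "\<exists>n. t \<in> {- real n<..<real n}" for t
    proof -
      obtain n where "\<bar>t\<bar> < real n" using reals_Archimedean2 by blast
      then show ?thesis by (intro exI[of _ n]) auto
    qed
    then have U: "(\<Union>n. {- real n<..<real n}) = UNIV" by blast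
    have "(\<lambda>n. LINT t:{- real n<..<real n}|lborel. g t) \<longlonglongrightarrow> (LINT t:(\<Union>n. {- real n<..<real n})|lborel. g t)"
    proof (rule set_integral_cont_up)
      show "set_integrable lborel (\<Union>n. {- real n<..<real n}) g"
        unfolding U using g by (simp add: set_integrable_def)
    qed (auto simp: incseq_def)
    then show ?thesis using zero U by (simp add: LIMSEQ_const_iff)
  qed
  then have tot: "(LINT t|lborel. g t) = 0" by (simp add: set_lebesgue_integral_def)
  have si: "set_integrable lborel A g" if "A \<in> sets borel" for A
    unfolding set_integrable_def using that g by (intro integrable_mult_indicator) auto
  have Int_stable: "Int_stable (range (\<lambda>(a, b). {a<..<b::real}))"
    by (auto simp: Int_stable_def image_iff)
  have sig: "sets borel = sigma_sets UNIV (range (\<lambda>(a, b). {a<..<b::real}))"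
    proof -
    have bx: "(box :: real \<Rightarrow> _) = greaterThanLessThan" by (intro ext) simp
    show ?thesis by (subst borel_eq_box) (simp add: bx)
  qed
  have sub: "range (\<lambda>(a, b). {a<..<b::real}) \<subseteq> Pow UNIV" by simp
  have all: "(LINT t:A|lborel. g t) = 0" if "A \<in> sets borel" for A
    using Int_stable sub that[unfolded sig]
  proof (induction rule: sigma_sets_induct_disjoint)
    case (compl A)
    then have [measurable]: "A \<in> sets borel" by (simp add: sig)
    have "(LINT t:UNIV - A|lborel. g t) = (LINT t|lborel. g t - indicator A t *\<^sub>R g t)"
      unfolding set_lebesgue_integral_def by (intro Bochner_Integration.integral_cong) (auto simp: indicator_def)
    also have "\<dots> = 0" using compl g si[of A] tot
      by (subst Bochner_Integration.integral_diff) (auto simp: set_integrable_def set_lebesgue_integral_def)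
    finally show ?case .
  next
    case (union A)
    then have [measurable]: "A i \<in> sets borel" for i by (auto simp: sig)
    have "(LINT t:(\<Union>i. A i)|lborel. g t) = (\<Sum>i. LINT t:A i|lborel. g t)"
      using union(1) by (intro lebesgue_integral_countable_add si) (auto simp: disjoint_family_on_def)
    then show ?case using union by simp
  qed (use zero in \<open>auto simp: set_lebesgue_integral_def\<close>)
  \<comment> \<open>Uniqueness of real densities, compared with the density 0, is applied to real
    and imaginary part separately.\<close>
  have "AE t in lborel. Re (g t) = 0"
  proof (rule density_unique_real)
    show "(LINT t:A|lborel. Re (g t)) = (LINT t:A|lborel. 0)" if "A \<in> sets lborel" for A
      using all[of A] integral_Re[OF si[of A, unfolded set_integrable_def]] that
      by (simp add: set_lebesgue_integral_def)
  qed (use g in auto)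
  moreover have "AE t in lborel. Im (g t) = 0"
  proof (rule density_unique_real)
    show "(LINT t:A|lborel. Im (g t)) = (LINT t:A|lborel. 0)" if "A \<in> sets lborel" for A
      using all[of A] integral_Im[OF si[of A, unfolded set_integrable_def]] that
      by (simp add: set_lebesgue_integral_def)
  qed (use g in auto)
  ultimately show ?thesis by eventually_elim (simp add: complex_eq_iff)
qed

lemma cbump_le_1: "l > 0 \<Longrightarrow> norm (cbump a c l 1 0 t) \<le> 1"
  by (auto simp: cbump_def bump_def poly_bump_quad)

text \<open>The one parameter \<open>d n\<close> both pulls the support strictly inside {a<..<c} and
  flattens the exponential. Thus even for a = 0 or c = T the approximants are supported in the open
  interval.\<close>

lemma cbump_tendsto_indicator:
  assumes d: "d \<longlonglongrightarrow> 0" and dpos: "\<And>n::nat. d n > 0"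
  shows "(\<lambda>n. cbump (a + d n) (c - d n) (d n) 1 0 t) \<longlonglongrightarrow> indicator {a<..<c} t"
proof (cases "t \<in> {a<..<c}")
  case True
  have "(\<lambda>n. of_real (exp (- d n / ((t - (a + d n)) * ((c - d n) - t)))) :: complex) \<longlonglongrightarrow> of_real (exp (- 0 / ((t - (a + 0)) * ((c - 0) - t))))"
    using True by (intro tendsto_intros d) auto
  moreover have "eventually (\<lambda>n. d n < t - a) sequentially" "eventually (\<lambda>n. d n < c - t) sequentially"
    using True order_tendstoD(2)[OF d] by auto
  then have "eventually (\<lambda>n. of_real (exp (- d n / ((t - (a + d n)) * ((c - d n) - t))))
       = cbump (a + d n) (c - d n) (d n) 1 0 t) sequentially"
    by eventually_elim (auto simp: cbump_def bump_def poly_bump_quad)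
  ultimately have "(\<lambda>n. cbump (a + d n) (c - d n) (d n) 1 0 t) \<longlonglongrightarrow> of_real (exp (- 0 / ((t - (a + 0)) * ((c - 0) - t))))"
    by (rule Lim_transform_eventually)
  then show ?thesis using True by simp
next
  case False
  then have "cbump (a + d n) (c - d n) (d n) 1 0 t = 0" for n
    using dpos[of n] by (auto simp: cbump_def bump_def)
  then show ?thesis using False by simp
qed

lemma test_zero_imp_AE_zero:
  fixes f :: "real \<Rightarrow> complex"
  assumes f: "set_integrable lborel {0..T} f"
    and zero: "\<And>a c l. 0 < a \<Longrightarrow> a < c \<Longrightarrow> c < T \<Longrightarrow> l > 0 \<Longrightarrow>
       (LINT t:{0..T}|lborel. f t * cbump a c l 1 0 t) = 0"
  shows "AE t in lborel. t \<in> {0..T} \<longrightarrow> f t = 0"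
proof -
  define g where "g t = indicator {0..T} t *\<^sub>R f t" for t
  have g: "integrable lborel g" using f by (simp add: g_def[abs_def] set_integrable_def)
  then have [measurable]: "g \<in> borel_measurable borel" by auto
  define d :: "nat \<Rightarrow> real" where "d n = inverse (of_nat (Suc n))" for n
  have d0: "d n > 0" for n by (simp add: d_def)
  have dlim: "d \<longlonglongrightarrow> 0" unfolding d_def by (rule LIMSEQ_inverse_real_of_nat)
  have main: "(LINT t|lborel. g t * indicator {a<..<c} t) = 0" if ac: "0 \<le> a" "a < c" "c \<le> T" for a c
  proof -
    have ev: "eventually (\<lambda>n. d n < (c - a) / 2) sequentially"
      using order_tendstoD(2)[OF dlim, of "(c - a) / 2"] ac by auto
    have meas: "(\<lambda>t. cbump a' c' l 1 0 t) \<in> borel_measurable borel" for a' c' l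
      unfolding cbump_def bump_def poly_bump_quad poly_1 power_0 by measurable
    have "(\<lambda>n. LINT t|lborel. g t * cbump (a + d n) (c - d n) (d n) 1 0 t) \<longlonglongrightarrow> (LINT t|lborel. g t * indicator {a<..<c} t)"
    proof (rule integral_dominated_convergence[where w = "\<lambda>t. norm (g t)"])
      show "AE t in lborel. norm (g t * cbump (a + d n) (c - d n) (d n) 1 0 t) \<le> norm (g t)" for n
        using cbump_le_1[OF d0] by (auto simp: norm_mult mult_left_le)
      show "(\<lambda>t. g t * cbump (a + d n) (c - d n) (d n) 1 0 t) \<in> borel_measurable lborel" for n
        using meas by measurable
    qed (use g in \<open>auto intro!: tendsto_mult cbump_tendsto_indicator dlim d0\<close>)
    moreover have "eventually (\<lambda>n. (LINT t|lborel. g t * cbump (a + d n) (c - d n) (d n) 1 0 t) = 0) sequentially"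
      using ev
    proof eventually_elim
      case (elim n)
      show ?case
        using zero[of "a + d n" "c - d n" "d n"] ac d0[of n] elim
        by (simp add: g_def set_lebesgue_integral_def field_simps)
    qed
    ultimately show ?thesis
      by (rule LIMSEQ_unique[OF _ tendsto_eventually])
  qed
  have "AE t in lborel. g t = 0"
  proof (rule integral_Ioo_zero_imp_AE_zero[OF g])
    fix a b :: real
    define a' where "a' = max a 0"
    define b' where "b' = min b T"
    have "(LINT t:{a<..<b}|lborel. g t) = (LINT t|lborel. g t * indicator {a'<..<b'} t)"
      unfolding set_lebesgue_integral_def
    proof (rule integral_cong_AE)
      show "AE t in lborel. indicator {a<..<b} t *\<^sub>R g t = g t * indicator {a'<..<b'} t"
        \<comment> \<open>As g vanishes outside {0..T}, clipping the interval to [0,T] can change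
          the integrand only at the points 0 and T.\<close>
        using AE_lborel_singleton[of 0] AE_lborel_singleton[of T]
        by eventually_elim (auto simp: g_def indicator_def a'_def b'_def)
    qed auto
    also have "\<dots> = 0"
    proof (cases "a' < b'")
      case True
      then show ?thesis by (intro main) (auto simp: a'_def b'_def)
    qed simp
    finally show "(LINT t:{a<..<b}|lborel. g t) = 0" .
  qed
  then show ?thesis by eventually_elim (auto simp: g_def)
qed

lemma norm_inv_ft_le: "norm (inv_ft F t) \<le> (LINT \<tau>|lborel. norm (F \<tau>)) / (2 * pi)"
  unfolding inv_ft_def norm_divide by (auto intro!: divide_right_mono norm_time_ft_le)

lemma inv_ft_measurable:
  assumes "F \<in> borel_measurable borel"
  shows "inv_ft F \<in> borel_measurable borel"
  unfolding inv_ft_def[abs_def] using time_ft_measurable[OF assms] by measurable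

text \<open>The multiplication formula: the kernel \<open>cis (t * \<tau>)\<close> is symmetric, so
  Fubini moves the transform from the test function to the symbol.\<close>

lemma inv_ft_swap:
  assumes F: "integrable lborel F" and \<phi>: "integrable lborel \<phi>"
  shows "(LINT \<tau>|lborel. F \<tau> * inv_ft \<phi> \<tau>) = (LINT t|lborel. inv_ft F t * \<phi> t)"
proof -
  have [measurable]: "F \<in> borel_measurable borel" "\<phi> \<in> borel_measurable borel" using assms by auto
  let ?g = "\<lambda>\<tau> t. F \<tau> * \<phi> t * cis (t * \<tau>)"
  have int: "integrable (lborel \<Otimes>\<^sub>M lborel) (case_prod ?g)"
  proof (rule lborel_pair.Fubini_integrable)
    show "integrable lborel (\<lambda>\<tau>. LINT t|lborel. norm (case (\<tau>, t) of (\<tau>, t) \<Rightarrow> ?g \<tau> t))"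
      using F by (simp add: norm_mult integrable_norm)
    show "AE \<tau> in lborel. integrable lborel (\<lambda>t. case (\<tau>, t) of (\<tau>, t) \<Rightarrow> ?g \<tau> t)"
      using \<phi> by (auto intro!: integrable_mult_cis)
  qed simp
  have "(LINT \<tau>|lborel. F \<tau> * inv_ft \<phi> \<tau>) = (LINT \<tau>|lborel. LINT t|lborel. ?g \<tau> t) / of_real (2 * pi)"
    unfolding inv_ft_cis by (simp add: mult.assoc)
  also have "(LINT \<tau>|lborel. LINT t|lborel. ?g \<tau> t) = (LINT t|lborel. LINT \<tau>|lborel. ?g \<tau> t)"
    using lborel_pair.Fubini_integral[OF int] by simp
  also have "\<dots> = (LINT t|lborel. (LINT \<tau>|lborel. F \<tau> * cis (\<tau> * t)) * \<phi> t)"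
  proof (rule Bochner_Integration.integral_cong[OF refl])
    fix t
    show "(LINT \<tau>|lborel. ?g \<tau> t) = (LINT \<tau>|lborel. F \<tau> * cis (\<tau> * t)) * \<phi> t"
      by (subst integral_mult_left_zero[symmetric]) (simp add: mult_ac)
  qed
  finally show ?thesis unfolding inv_ft_cis by simp
qed

text \<open>Write a bump as \<open>time_ft\<close> of its \<open>inv_ft\<close>, evaluate the
  functional there by \<open>has_ft\<close>, and move \<open>inv_ft\<close> over to F. Then c and
  \<open>inv_ft F\<close> have the same integrals against all bumps in (0,T).\<close>

lemma has_ft_imp_AE_inv_ft:
  assumes ft: "has_ft f F" and F: "integrable lborel F"
    and c: "set_integrable lborel {0..T} c"
    and test: "\<And>\<phi>. test_function T \<phi> \<Longrightarrow> f \<phi> = (LINT t:{0..T}|lborel. c t * \<phi> t)"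
  shows "AE t in lborel. t \<in> {0..T} \<longrightarrow> c t = inv_ft F t"
proof -
  have [measurable]: "F \<in> borel_measurable borel" using F by auto
  have Um[measurable]: "inv_ft F \<in> borel_measurable borel" by (rule inv_ft_measurable) simp
  have U: "set_integrable lborel {0..T} (inv_ft F)"
    unfolding set_integrable_def
    by (rule integrableI_bounded_set_indicator[where B = "(LINT \<tau>|lborel. norm (F \<tau>)) / (2 * pi)"])
      (auto simp: norm_inv_ft_le emeasure_lborel_Icc_eq)
  have "AE t in lborel. t \<in> {0..T} \<longrightarrow> c t - inv_ft F t = 0"
  proof (rule test_zero_imp_AE_zero)
    show "set_integrable lborel {0..T} (\<lambda>t. c t - inv_ft F t)" by (intro set_integral_diff c U)
    fix a d l :: real assume *: "0 < a" "a < d" "d < T" "l > 0"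
    let ?\<phi> = "cbump a d l 1 0"
    have [measurable]: "?\<phi> \<in> borel_measurable borel" by (rule cbump_measurable[OF *(4,2)])
    have le1: "norm (?\<phi> t) \<le> 1" for t using cbump_le_1[OF *(4)] .
    have si: "set_integrable lborel {0..T} (\<lambda>t. h t * ?\<phi> t)" if h: "set_integrable lborel {0..T} h" for h :: "real \<Rightarrow> complex"
    proof -
      have m: "(\<lambda>t. indicator {0..T} t *\<^sub>R h t) \<in> borel_measurable lborel"
        using h unfolding set_integrable_def by auto
      have "integrable lborel (\<lambda>t. (indicator {0..T} t *\<^sub>R h t) * ?\<phi> t)"
      proof (rule Bochner_Integration.integrable_bound[OF h[unfolded set_integrable_def]])
        show "(\<lambda>t. (indicator {0..T} t *\<^sub>R h t) * ?\<phi> t) \<in> borel_measurable lborel"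
          using m by (intro borel_measurable_times) auto
        show "AE t in lborel. norm ((indicator {0..T} t *\<^sub>R h t) * ?\<phi> t) \<le> norm (indicator {0..T} t *\<^sub>R h t)"
        proof (rule AE_I2)
          fix t
          show "norm ((indicator {0..T} t *\<^sub>R h t) * ?\<phi> t) \<le> norm (indicator {0..T} t *\<^sub>R h t)"
            unfolding norm_mult using mult_left_mono[OF le1[of t] norm_ge_zero[of "indicator {0..T} t *\<^sub>R h t"]]
            by (simp only: mult_1_right)
        qed
      qed
      then show ?thesis by (simp add: set_integrable_def)
    qed
    have "(LINT t:{0..T}|lborel. c t * ?\<phi> t) = f ?\<phi>"
      using test[OF test_function_cbump] * by simp
    also have "\<dots> = f (time_ft (inv_ft ?\<phi>))" using time_ft_inv_ft_cbump[OF *(4,2)] by simp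
    also have "\<dots> = (LINT \<tau>|lborel. F \<tau> * inv_ft ?\<phi> \<tau>)"
      using ft inv_ft_cbump_schwartz[OF *(4,2)] by (simp add: has_ft_def)
    also have "\<dots> = (LINT t|lborel. inv_ft F t * ?\<phi> t)"
      by (rule inv_ft_swap[OF F cbump_integrable[OF *(4,2)]])
    also have "\<dots> = (LINT t:{0..T}|lborel. inv_ft F t * ?\<phi> t)"
      unfolding set_lebesgue_integral_def
      using * by (intro Bochner_Integration.integral_cong) (auto simp: indicator_def cbump_def bump_def)
    finally show "(LINT t:{0..T}|lborel. (c t - inv_ft F t) * ?\<phi> t) = 0"
      using si[OF c] si[OF U] by (simp add: left_diff_distrib set_integral_diff)
  qed
  then show ?thesis by simp
qed

section \<open>Fourier series of a product\<close>

definition trig_poly :: "(real \<Rightarrow> complex) \<Rightarrow> bool" where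
  "trig_poly p \<longleftrightarrow> (\<exists>S c. finite S \<and> (\<forall>x. p x = (\<Sum>k\<in>S. c k * cis (of_int k * x))))"

lemma trig_poly_cis: "trig_poly (\<lambda>x. z * cis (of_int k * x))"
  unfolding trig_poly_def by (rule exI[of _ "{k}"], rule exI[of _ "\<lambda>_. z"]) simp

lemma trig_poly_const: "trig_poly (\<lambda>x. z)"
  using trig_poly_cis[of z 0] by simp

lemma trig_poly_add:
  assumes "trig_poly p" "trig_poly q"
  shows "trig_poly (\<lambda>x. p x + q x)"
proof -
  obtain S c where p: "finite S" "\<And>x. p x = (\<Sum>k\<in>S. c k * cis (of_int k * x))"
    using assms unfolding trig_poly_def by blast
  obtain S' c' where q: "finite S'" "\<And>x. q x = (\<Sum>k\<in>S'. c' k * cis (of_int k * x))"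
    using assms unfolding trig_poly_def by blast
  have "p x + q x = (\<Sum>k\<in>S \<union> S'. ((if k \<in> S then c k else 0) + (if k \<in> S' then c' k else 0)) * cis (of_int k * x))" for x
  proof -
    have "p x = (\<Sum>k\<in>S \<union> S'. (if k \<in> S then c k else 0) * cis (of_int k * x))"
      unfolding p(2) using p(1) q(1) by (intro sum.mono_neutral_cong_left) auto
    moreover have "q x = (\<Sum>k\<in>S \<union> S'. (if k \<in> S' then c' k else 0) * cis (of_int k * x))"
      unfolding q(2) using p(1) q(1) by (intro sum.mono_neutral_cong_left) auto
    ultimately show ?thesis by (simp add: sum.distrib distrib_right)
  qed
  then show ?thesis unfolding trig_poly_def using p(1) q(1)
    by (intro exI[of _ "S \<union> S'"] exI[of _ "\<lambda>k. (if k \<in> S then c k else 0) + (if k \<in> S' then c' k else 0)"]) auto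
qed

lemma trig_poly_sum:
  "finite A \<Longrightarrow> (\<And>i. i \<in> A \<Longrightarrow> trig_poly (p i)) \<Longrightarrow> trig_poly (\<lambda>x. \<Sum>i\<in>A. p i x)"
  by (induction A rule: finite_induct) (auto intro: trig_poly_const trig_poly_add)

lemma trig_poly_mult:
  assumes "trig_poly p" "trig_poly q"
  shows "trig_poly (\<lambda>x. p x * q x)"
proof -
  obtain S c where p: "finite S" "\<And>x. p x = (\<Sum>k\<in>S. c k * cis (of_int k * x))"
    using assms unfolding trig_poly_def by blast
  obtain S' c' where q: "finite S'" "\<And>x. q x = (\<Sum>k\<in>S'. c' k * cis (of_int k * x))"
    using assms unfolding trig_poly_def by blast
  have "p x * q x = (\<Sum>j\<in>S. \<Sum>k\<in>S'. (c j * c' k) * cis (of_int (j + k) * x))" for x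
    unfolding p(2) q(2) sum_product
    by (intro sum.cong refl) (simp add: distrib_right distrib_left mult_ac flip: cis_mult)
  then show ?thesis
    by (simp only:) (intro trig_poly_sum trig_poly_cis p(1) q(1))
qed

text \<open>A real-linear functional evaluated at \<open>cis x\<close> is a combination of cos x and
  sin x, hence of \<open>cis x\<close> and \<open>cis (- x)\<close>. Sums and products preserve the
  class.\<close>

lemma trig_poly_real_polynomial:
  assumes "real_polynomial_function r"
  shows "trig_poly (\<lambda>x. of_real (r (cis x)))"
  using assms
proof (induction r rule: real_polynomial_function.induct)
  case (linear f)
  interpret bounded_linear f by fact
  have "of_real (f (cis x)) = ((of_real (f 1) / 2 + of_real (f \<i>) / (2 * \<i>)) * cis (of_int 1 * x)
      + (of_real (f 1) / 2 - of_real (f \<i>) / (2 * \<i>)) * cis (of_int (-1) * x))" for x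
  proof -
    have "cis x = cos x *\<^sub>R 1 + sin x *\<^sub>R \<i>" by (simp add: complex_eq_iff)
    then have "f (cis x) = cos x * f 1 + sin x * f \<i>"
      by (metis add scaleR real_scaleR_def)
    then show ?thesis by (simp add: complex_eq_iff field_simps)
  qed
  then show ?case by (simp only:) (intro trig_poly_add trig_poly_cis)
qed (simp_all add: trig_poly_const trig_poly_add trig_poly_mult)

lemma trig_poly_polynomial:
  assumes "polynomial_function (q :: complex \<Rightarrow> complex)"
  shows "trig_poly (\<lambda>x. q (cis x))"
proof -
  have "real_polynomial_function (Re \<circ> q)" "real_polynomial_function (Im \<circ> q)"
    using assms bounded_linear_Re bounded_linear_Im by (auto simp: polynomial_function_def)
  then have "trig_poly (\<lambda>x. of_real ((Re \<circ> q) (cis x)) + \<i> * of_real ((Im \<circ> q) (cis x)))"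
    by (intro trig_poly_add trig_poly_mult trig_poly_real_polynomial trig_poly_const)
  then show ?thesis by (simp add: complex_eq[symmetric])
qed

lemma trig_poly_continuous: "trig_poly p \<Longrightarrow> continuous_on A p"
  unfolding trig_poly_def
  by (elim exE conjE) (subst continuous_on_cong[OF refl], auto intro!: continuous_intros)

text \<open>A continuous function on the line need not take equal values at - pi and pi. The damping
  factor vanishes at both points, so the product descends to a continuous function on the unit
  circle, where Stone-Weierstrass applies.\<close>

lemma uniform_trig_approx:
  fixes h :: "real \<Rightarrow> complex"
  assumes h: "continuous_on UNIV h" and M: "\<And>x. norm (h x) \<le> M" and e: "e > 0" and n: "n \<ge> 0"
  shows "\<exists>p. trig_poly p \<and> (\<forall>x. - pi < x \<and> x \<le> pi \<longrightarrow> norm (of_real (min 1 (n * (1 + cos x))) * h x - p x) < e)"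
proof -
  \<comment> \<open>On the circle Re z plays cos x and Arg z plays x. Arg jumps there only at -1,
    exactly where the damping factor is 0.\<close>
  define H where "H z = of_real (min 1 (n * (1 + Re z))) * h (Arg z)" for z
  have "continuous_on (sphere 0 1) H"
    unfolding continuous_on_eq_continuous_within
  proof
    fix z :: complex assume z: "z \<in> sphere 0 1"
    show "continuous (at z within sphere 0 1) H"
    proof (cases "z \<in> \<real>\<^sub>\<le>\<^sub>0")
      case False
      have "continuous (at (Arg z)) h"
        using h by (simp add: continuous_on_eq_continuous_at)
      then have "continuous (at z) (\<lambda>z. h (Arg z))"
        using continuous_at_compose[OF continuous_at_Arg[OF False], of h] by (simp add: o_def)
      then have "continuous (at z) H"
        unfolding H_def by (intro continuous_intros linear_continuous_at[OF bounded_linear_Re])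
      then show ?thesis by (rule continuous_at_imp_continuous_at_within)
    next
      case True
      have "z = -1"
      proof -
        have "Im z = 0" "Re z \<le> 0" using True by (auto simp: complex_nonpos_Reals_iff)
        moreover have "(Re z)\<^sup>2 = 1" using z calculation by (simp add: norm_complex_def)
        ultimately show ?thesis by (auto simp: complex_eq_iff power2_eq_1_iff)
      qed
      moreover have "(H \<longlongrightarrow> 0) (at (-1) within sphere 0 1)"
      proof (rule Lim_null_comparison)
        show "\<forall>\<^sub>F z in at (-1) within sphere 0 1. norm (H z) \<le> n * (1 + Re z) * M"
          unfolding eventually_at_filter
        proof (rule always_eventually, intro allI impI)
          fix z :: complex assume "z \<in> sphere 0 1"
          then have "Re z \<ge> -1" using abs_Re_le_cmod[of z] by simp
          then have *: "0 \<le> n * (1 + Re z)" using n by simp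
          have "norm (H z) \<le> (n * (1 + Re z)) * M"
            unfolding H_def norm_mult norm_of_real using * M[of "Arg z"]
            by (intro mult_mono) auto
          then show "norm (H z) \<le> n * (1 + Re z) * M" .
        qed
        have "((\<lambda>z. n * (1 + Re z) * M) \<longlongrightarrow> n * (1 + Re (-1)) * M) (at (-1) within sphere 0 1)"
          by (intro tendsto_intros)
        then show "((\<lambda>z. n * (1 + Re z) * M) \<longlongrightarrow> 0) (at (-1) within sphere 0 1)" by simp
      qed
      moreover have "H (-1) = 0" using n by (simp add: H_def)
      ultimately show ?thesis by (simp add: continuous_within)
    qed
  qed
  from Stone_Weierstrass_polynomial_function[OF compact_sphere this e]
  obtain q where q: "polynomial_function q" "\<And>z. z \<in> sphere 0 1 \<Longrightarrow> norm (H z - q z) < e"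
    by blast
  have "norm (of_real (min 1 (n * (1 + cos x))) * h x - q (cis x)) < e" if "- pi < x" "x \<le> pi" for x
    using q(2)[of "cis x"] that by (simp add: H_def Arg_cis)
  then show ?thesis using trig_poly_polynomial[OF q(1)] by blast
qed

text \<open>Besides convergence almost everywhere, a common bound is required so that dominated
  convergence can be used later. Hence continuous approximants are clipped to norm M, and the
  uniform error, at most 1, turns the bound into M + 1.\<close>

lemma bounded_measurable_trig_approx:
  fixes g :: "real \<Rightarrow> complex"
  assumes g: "g \<in> borel_measurable borel" and M: "\<And>x. norm (g x) \<le> M"
  obtains p where "\<And>n. trig_poly (p n)" "\<And>n x. - pi < x \<Longrightarrow> x \<le> pi \<Longrightarrow> norm (p n x) \<le> M + 1"
    "AE x in lborel. - pi < x \<and> x < pi \<longrightarrow> (\<lambda>n. p n x) \<longlonglongrightarrow> g x"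
proof -
  have M0: "M \<ge> 0" using order_trans[OF norm_ge_zero M] .
  have "g measurable_on UNIV"
    using g by (intro lebesgue_measurable_imp_measurable_on) (auto simp: measurable_completion)
  then obtain N h where N: "negligible N" and h: "\<And>n. continuous_on UNIV (h n)"
    and lim: "\<And>x. x \<notin> N \<Longrightarrow> (\<lambda>n. h n x) \<longlonglongrightarrow> g x"
    unfolding measurable_on_def by auto
  \<comment> \<open>Radial retraction onto the ball of radius M. It fixes the values of g, so
    clipping preserves the limit; for M = 0 it is the zero map.\<close>
  define cl where "cl z = (M / max M (norm z)) *\<^sub>R z" for z :: complex
  have cl_le: "norm (cl z) \<le> M" for z
    using M0 by (cases "z = 0") (auto simp: cl_def max_def field_simps)
  define h' where "h' n x = cl (h n x)" for n x
  have clc: "continuous_on UNIV cl" if "M > 0"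
    unfolding cl_def using that by (intro continuous_intros) auto
  have clg: "cl (g x) = g x" for x
  proof (cases "M = 0")
    case True then show ?thesis using M[of x] by (simp add: cl_def)
  next
    case False then show ?thesis using M[of x] by (simp add: cl_def max_def)
  qed
  have clcont: "continuous_on UNIV cl"
  proof (cases "M = 0")
    case True
    then have "cl = (\<lambda>_. 0)" by (auto simp: cl_def)
    then show ?thesis by simp
  qed (use clc M0 in auto)
  have h'c: "continuous_on UNIV (h' n)" for n
    unfolding h'_def by (rule continuous_on_compose2[OF clcont h]) auto
  have h'lim: "(\<lambda>n. h' n x) \<longlonglongrightarrow> g x" if "x \<notin> N" for x
  proof -
    have "(\<lambda>n. cl (h n x)) \<longlonglongrightarrow> cl (g x)"
      using lim[OF that] clcont by (auto intro: continuous_on_tendsto_compose)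
    then show ?thesis by (simp add: h'_def clg)
  qed
  have "\<forall>n. \<exists>p. trig_poly p \<and> (\<forall>x. - pi < x \<and> x \<le> pi \<longrightarrow> norm (of_real (min 1 (real n * (1 + cos x))) * h' n x - p x) < inverse (real (Suc n)))"
    by (intro allI, rule uniform_trig_approx[OF h'c, of _ M]) (auto simp: h'_def cl_le)
  from choice[OF this] obtain p where p: "\<And>n. trig_poly (p n)"
    "\<And>n x. - pi < x \<Longrightarrow> x \<le> pi \<Longrightarrow> norm (of_real (min 1 (real n * (1 + cos x))) * h' n x - p n x) < inverse (real (Suc n))"
    by blast
  show ?thesis
  proof (rule that)
    show "trig_poly (p n)" for n by (rule p)
    show "norm (p n x) \<le> M + 1" if x: "- pi < x" "x \<le> pi" for n x
    proof -
      let ?m = "min 1 (real n * (1 + cos x))"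
      have "0 \<le> 1 + cos x" using cos_ge_minus_one[of x] by linarith
      then have "0 \<le> real n * (1 + cos x)" by (intro mult_nonneg_nonneg) auto
      then have m: "0 \<le> ?m" "?m \<le> 1" by simp_all
      have hM: "norm (h' n x) \<le> M" unfolding h'_def by (rule cl_le)
      have "norm (of_real ?m * h' n x) \<le> 1 * M"
        unfolding norm_mult norm_of_real abs_of_nonneg[OF m(1)] by (rule mult_mono[OF m(2) hM]) simp_all
      moreover have "norm (p n x) \<le> norm (of_real ?m * h' n x) + norm (of_real ?m * h' n x - p n x)"
        using norm_triangle_sub[of "p n x" "of_real ?m * h' n x"] by (simp add: norm_minus_commute)
      moreover have "inverse (real (Suc n)) \<le> 1" by (simp add: inverse_le_1_iff)
      ultimately show ?thesis using p(2)[OF x, of n] by linarith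
    qed
    have "AE x in lborel. x \<notin> N"
      using AE_not_in[of N lebesgue] N by (simp add: negligible_iff_null_sets AE_completion_iff)
    then show "AE x in lborel. - pi < x \<and> x < pi \<longrightarrow> (\<lambda>n. p n x) \<longlonglongrightarrow> g x"
    proof eventually_elim
      case (elim x)
      show ?case
      proof
        assume x: "- pi < x \<and> x < pi"
        have "cos x > -1"
          using x cos_monotone_0_pi[of "\<bar>x\<bar>" pi] by (simp add: abs_less_iff)
        \<comment> \<open>At a fixed interior point the damping factor is eventually equal to
          1.\<close>
        have "eventually (\<lambda>n. real n \<ge> 1 / (1 + cos x)) sequentially"
          using filterlim_real_sequentially by (simp add: filterlim_at_top)
        then have "eventually (\<lambda>n. real n * (1 + cos x) \<ge> 1) sequentially"
          by eventually_elim (use \<open>cos x > -1\<close> in \<open>simp add: field_simps\<close>)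
        then have "eventually (\<lambda>n. h' n x = of_real (min 1 (real n * (1 + cos x))) * h' n x) sequentially"
          by eventually_elim simp
        then have 1: "(\<lambda>n. of_real (min 1 (real n * (1 + cos x))) * h' n x) \<longlonglongrightarrow> g x"
          using h'lim[OF elim] by (rule Lim_transform_eventually[rotated])
        have 2: "(\<lambda>n. of_real (min 1 (real n * (1 + cos x))) * h' n x - p n x) \<longlonglongrightarrow> 0"
          by (rule Lim_null_comparison[OF _ LIMSEQ_inverse_real_of_nat])
            (use p(2)[of x] x in \<open>auto intro!: always_eventually less_imp_le\<close>)
        show "(\<lambda>n. p n x) \<longlonglongrightarrow> g x" using tendsto_diff[OF 1 2] by simp
      qed
    qed
  qed
qed

section \<open>The circle as a finite measure space; square integrability from coefficients\<close>

definition circ :: "real measure" where "circ = restrict_space lborel {- pi..pi}"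

lemma space_circ [simp]: "space circ = {- pi..pi}"
  by (simp add: circ_def space_restrict_space)

lemma measurable_circ: "f \<in> borel_measurable borel \<Longrightarrow> f \<in> borel_measurable circ"
  unfolding circ_def by (rule measurable_restrict_space1) simp

lemma finite_measure_circ: "finite_measure circ"
  by (rule finite_measureI) (simp add: circ_def emeasure_restrict_space space_restrict_space emeasure_lborel_Icc_eq)

interpretation circ: finite_measure circ by (rule finite_measure_circ)

lemma AE_circ: "(AE x in lborel. - pi < x \<and> x < pi \<longrightarrow> P x) \<Longrightarrow> AE x in circ. P x"
proof -
  assume a: "AE x in lborel. - pi < x \<and> x < pi \<longrightarrow> P x"
  have "AE x in lborel. x \<in> {- pi..pi} \<longrightarrow> P x"
    using a AE_lborel_singleton[of pi] AE_lborel_singleton[of "- pi"]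
    by eventually_elim auto
  then show ?thesis unfolding circ_def by (subst AE_restrict_space_iff) auto
qed

lemma fcoeff_circ: "fcoeff f k = (LINT x|circ. f x * cis (- (of_int k * x)))"
  unfolding fcoeff_def circ_def set_lebesgue_integral_def
  by (subst integral_restrict_space) (auto simp: cis_conv_exp mult_ac)

lemma integrable_circ_iff: "integrable circ f \<longleftrightarrow> set_integrable lborel {- pi..pi} f"
  for f :: "real \<Rightarrow> 'a::{banach, second_countable_topology}"
  unfolding circ_def set_integrable_def by (subst integrable_restrict_space) auto

lemma integral_cis_circ: "(LINT x|circ. cis (of_int m * x)) = (if m = 0 then of_real (2 * pi) else 0)"
proof -
  have eq: "(LINT x|circ. cis (of_int m * x)) = (LINT x|lborel. indicator {- pi..pi} x *\<^sub>R cis (of_int m * x))"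
    unfolding circ_def by (subst integral_restrict_space) auto
  show ?thesis
  proof (cases "m = 0")
    case True
    have "(LINT x|lborel. indicator {- pi..pi} x *\<^sub>R (1::complex)) = of_real (2 * pi)"
      by (simp add: scaleR_conv_of_real)
    then show ?thesis using True eq by simp
  next
    case False
    have "(LINT x|lborel. indicator {- pi..pi} x *\<^sub>R cis (of_int m * x)) = cis (of_int m * pi) / (\<i> * of_int m) - cis (of_int m * (- pi)) / (\<i> * of_int m)"
    proof (rule integral_FTC_Icc)
      fix x :: real
      have "((\<lambda>x. exp ((\<i> * of_int m) * of_real x) / (\<i> * of_int m)) has_vector_derivative (\<i> * of_int m) * exp ((\<i> * of_int m) * of_real x) / (\<i> * of_int m)) (at x within {- pi..pi})"
        by (rule has_vector_derivative_real_field) (auto intro!: derivative_eq_intros)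
      then show "((\<lambda>x. cis (of_int m * x) / (\<i> * of_int m)) has_vector_derivative cis (of_int m * x)) (at x within {- pi..pi})"
        using False by (simp add: cis_conv_exp mult_ac)
    qed (auto intro!: continuous_intros)
    also have "\<dots> = 0"
    proof -
      have "sin (of_int m * pi) = 0" using sin_integer_2pi sin_zero_iff_int2 by blast
      then show ?thesis by (simp add: complex_eq_iff cis.ctr flip: diff_divide_distrib)
    qed
    finally show ?thesis using False eq by simp
  qed
qed

lemma integrable_circ_continuous: "continuous_on UNIV g \<Longrightarrow> integrable circ g"
  for g :: "real \<Rightarrow> complex"
  unfolding integrable_circ_iff
  by (intro borel_integrable_atLeastAtMost') (auto intro: continuous_on_subset)

lemma integral_norm_sq_trig_sum:
  assumes "finite S"
  shows "(LINT x|circ. (norm (\<Sum>k\<in>S. c k * cis (of_int k * x)))\<^sup>2) = 2 * pi * (\<Sum>k\<in>S. (norm (c k))\<^sup>2)"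
proof -
  have "of_real ((norm (\<Sum>k\<in>S. c k * cis (of_int k * x)))\<^sup>2) = (\<Sum>j\<in>S. \<Sum>k\<in>S. c j * cnj (c k) * cis (of_int (j - k) * x))" for x
  proof -
    have "of_real ((norm (\<Sum>k\<in>S. c k * cis (of_int k * x)))\<^sup>2) = (\<Sum>k\<in>S. c k * cis (of_int k * x)) * cnj (\<Sum>k\<in>S. c k * cis (of_int k * x))"
      by (rule complex_norm_square)
    also have "\<dots> = (\<Sum>j\<in>S. \<Sum>k\<in>S. c j * cnj (c k) * (cis (of_int j * x) * cis (- (of_int k * x))))"
      by (simp add: sum_product cis_cnj mult_ac)
    finally show ?thesis by (simp add: cis_mult left_diff_distrib)
  qed
  then have "of_real (LINT x|circ. (norm (\<Sum>k\<in>S. c k * cis (of_int k * x)))\<^sup>2) = (LINT x|circ. (\<Sum>j\<in>S. \<Sum>k\<in>S. c j * cnj (c k) * cis (of_int (j - k) * x)))"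
    by (simp flip: integral_complex_of_real)
  also have "\<dots> = (\<Sum>j\<in>S. \<Sum>k\<in>S. c j * cnj (c k) * (LINT x|circ. cis (of_int (j - k) * x)))"
    by (subst Bochner_Integration.integral_sum, intro Bochner_Integration.integrable_sum integrable_mult_right integrable_circ_continuous continuous_intros)
      (intro sum.cong refl, subst Bochner_Integration.integral_sum, auto intro!: integrable_circ_continuous continuous_intros)
  also have "\<dots> = (\<Sum>j\<in>S. \<Sum>k\<in>S. if k = j then c j * cnj (c j) * of_real (2 * pi) else 0)"
    unfolding integral_cis_circ by (intro sum.cong refl) auto
  also have "\<dots> = (\<Sum>j\<in>S. of_real (2 * pi * (norm (c j))\<^sup>2))"
    using assms by (intro sum.cong refl) (simp add: complex_norm_square[symmetric])
  also have "\<dots> = of_real (2 * pi * (\<Sum>k\<in>S. (norm (c k))\<^sup>2))"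
    by (simp add: sum_distrib_left)
  finally show ?thesis using of_real_eq_iff by blast
qed

lemma sum_le_integral_count_space:
  assumes "integrable (count_space UNIV) f" "finite S" "\<And>k. f k \<ge> (0::real)"
  shows "(\<Sum>k\<in>S. f k) \<le> (LINT k|count_space UNIV. f k)"
proof -
  have "(\<Sum>k\<in>S. f k) = (LINT k|count_space UNIV. indicator S k * f k)"
    using assms by (simp add: lebesgue_integral_count_space_finite_support indicator_def if_distrib sum.If_cases cong: if_cong)
      (rule sum.mono_neutral_right, auto)
  also have "\<dots> \<le> (LINT k|count_space UNIV. f k)"
    using assms integrable_mult_indicator[of S "count_space UNIV" f]
    by (intro integral_mono) (auto simp: indicator_def)
  finally show ?thesis .
qed

text \<open>The pairing sees finitely many coefficients of f, with reflected index because no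
  conjugate is taken. After Cauchy-Schwarz, orthogonality turns the numbers c back into an L2 norm
  of the trigonometric sum, a form that survives limits.\<close>

lemma trig_sum_duality:
  assumes f: "integrable circ f" and S: "finite S"
    and a: "integrable (count_space UNIV) (\<lambda>k. (norm (fcoeff f k))\<^sup>2)"
  shows "(norm (LINT x|circ. f x * (\<Sum>k\<in>S. c k * cis (of_int k * x))))\<^sup>2
     \<le> (LINT k|count_space UNIV. (norm (fcoeff f k))\<^sup>2) / (2 * pi) * (LINT x|circ. (norm (\<Sum>k\<in>S. c k * cis (of_int k * x)))\<^sup>2)"
proof -
  have "(LINT x|circ. f x * (\<Sum>k\<in>S. c k * cis (of_int k * x))) = (LINT x|circ. (\<Sum>k\<in>S. c k * (f x * cis (- (of_int (- k) * x)))))"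
    by (simp add: sum_distrib_left mult_ac)
  also have "\<dots> = (\<Sum>k\<in>S. c k * fcoeff f (- k))"
    unfolding fcoeff_circ
    by (subst Bochner_Integration.integral_sum) (auto intro!: integrable_mult_cis f measurable_circ)
  finally have eq: "(LINT x|circ. f x * (\<Sum>k\<in>S. c k * cis (of_int k * x))) = (\<Sum>k\<in>S. c k * fcoeff f (- k))" .
  have "norm (\<Sum>k\<in>S. c k * fcoeff f (- k)) \<le> (\<Sum>k\<in>S. norm (c k) * norm (fcoeff f (- k)))"
    by (rule order_trans[OF norm_sum]) (simp add: norm_mult)
  then have "(norm (\<Sum>k\<in>S. c k * fcoeff f (- k)))\<^sup>2 \<le> (\<Sum>k\<in>S. norm (c k) * norm (fcoeff f (- k)))\<^sup>2"
    by (rule power_mono) simp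
  also have "\<dots> \<le> (\<Sum>k\<in>S. (norm (c k))\<^sup>2) * (\<Sum>k\<in>S. (norm (fcoeff f (- k)))\<^sup>2)"
    by (rule Cauchy_Schwarz_ineq_sum)
  also have "(\<Sum>k\<in>S. (norm (fcoeff f (- k)))\<^sup>2) = (\<Sum>k\<in>uminus ` S. (norm (fcoeff f k))\<^sup>2)"
    by (simp add: sum.reindex)
  also have "\<dots> \<le> (LINT k|count_space UNIV. (norm (fcoeff f k))\<^sup>2)"
    by (rule sum_le_integral_count_space[OF a]) (use S in auto)
  finally have "(norm (\<Sum>k\<in>S. c k * fcoeff f (- k)))\<^sup>2 \<le> (\<Sum>k\<in>S. (norm (c k))\<^sup>2) * (LINT k|count_space UNIV. (norm (fcoeff f k))\<^sup>2)"
    by (simp add: mult_left_mono sum_nonneg)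
  then show ?thesis unfolding eq integral_norm_sq_trig_sum[OF S] by (simp add: mult_ac)
qed

text \<open>Both sides pass to the limit along boundedly convergent trigonometric
  polynomials.\<close>

lemma bounded_duality:
  assumes f: "integrable circ f"
    and a: "integrable (count_space UNIV) (\<lambda>k. (norm (fcoeff f k))\<^sup>2)"
    and g: "g \<in> borel_measurable borel" and M: "\<And>x. norm (g x) \<le> M"
  shows "(norm (LINT x|circ. f x * g x))\<^sup>2
     \<le> (LINT k|count_space UNIV. (norm (fcoeff f k))\<^sup>2) / (2 * pi) * (LINT x|circ. (norm (g x))\<^sup>2)"
proof -
  obtain p where p: "\<And>n. trig_poly (p n)" "\<And>n x. - pi < x \<Longrightarrow> x \<le> pi \<Longrightarrow> norm (p n x) \<le> M + 1"
    "AE x in lborel. - pi < x \<and> x < pi \<longrightarrow> (\<lambda>n. p n x) \<longlonglongrightarrow> g x"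
    using bounded_measurable_trig_approx[OF g M] by blast
  have pm: "p n \<in> borel_measurable circ" for n
    by (intro measurable_circ borel_measurable_continuous_onI trig_poly_continuous p)
  have gm: "g \<in> borel_measurable circ" by (rule measurable_circ[OF g])
  have pb: "AE x in circ. norm (p n x) \<le> M + 1" for n
    by (rule AE_circ) (auto intro!: AE_I2 p)
  have pl: "AE x in circ. (\<lambda>n. p n x) \<longlonglongrightarrow> g x" by (rule AE_circ) (rule p)
  have fm: "f \<in> borel_measurable circ" using f by auto
  have M0: "0 \<le> M" using order_trans[OF norm_ge_zero M] .
  have "(\<lambda>n. LINT x|circ. f x * p n x) \<longlonglongrightarrow> (LINT x|circ. f x * g x)"
  proof (rule integral_dominated_convergence[where w = "\<lambda>x. norm (f x) * (M + 1)"])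
    show "AE x in circ. (\<lambda>n. f x * p n x) \<longlonglongrightarrow> f x * g x"
      using pl by eventually_elim (intro tendsto_intros)
    show "AE x in circ. norm (f x * p n x) \<le> norm (f x) * (M + 1)" for n
      using pb[of n] by eventually_elim (simp add: norm_mult mult_left_mono)
  qed (use f fm pm gm in auto)
  then have l1: "(\<lambda>n. (norm (LINT x|circ. f x * p n x))\<^sup>2) \<longlonglongrightarrow> (norm (LINT x|circ. f x * g x))\<^sup>2"
    by (intro tendsto_intros)
  have "(\<lambda>n. LINT x|circ. (norm (p n x))\<^sup>2) \<longlonglongrightarrow> (LINT x|circ. (norm (g x))\<^sup>2)"
  proof (rule integral_dominated_convergence[where w = "\<lambda>x. (M + 1)\<^sup>2"])
    show "AE x in circ. (\<lambda>n. (norm (p n x))\<^sup>2) \<longlonglongrightarrow> (norm (g x))\<^sup>2"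
      using pl by eventually_elim (intro tendsto_intros)
    show "AE x in circ. norm ((norm (p n x))\<^sup>2) \<le> (M + 1)\<^sup>2" for n
      using pb[of n] by eventually_elim (simp add: power_mono)
  qed (use pm gm in \<open>auto intro!: circ.integrable_const borel_measurable_power borel_measurable_norm\<close>)
  then have l2: "(\<lambda>n. (LINT k|count_space UNIV. (norm (fcoeff f k))\<^sup>2) / (2 * pi) * (LINT x|circ. (norm (p n x))\<^sup>2))
      \<longlonglongrightarrow> (LINT k|count_space UNIV. (norm (fcoeff f k))\<^sup>2) / (2 * pi) * (LINT x|circ. (norm (g x))\<^sup>2)"
    by (intro tendsto_intros)
  have "(norm (LINT x|circ. f x * p n x))\<^sup>2 \<le> (LINT k|count_space UNIV. (norm (fcoeff f k))\<^sup>2) / (2 * pi) * (LINT x|circ. (norm (p n x))\<^sup>2)" for n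
  proof -
    obtain S c where S: "finite S" "\<And>x. p n x = (\<Sum>k\<in>S. c k * cis (of_int k * x))"
      using p(1)[of n] unfolding trig_poly_def by blast
    show ?thesis unfolding S(2) by (rule trig_sum_duality[OF f S(1) a])
  qed
  then show ?thesis by (intro LIMSEQ_le[OF l1 l2]) auto
qed

lemma le_of_square_le_mult: "x\<^sup>2 \<le> a * x \<Longrightarrow> 0 \<le> x \<Longrightarrow> 0 \<le> a \<Longrightarrow> x \<le> (a::real)"
  by (cases "x = 0") (auto simp: power2_eq_square)

text \<open>Duality is tested on the truncated conjugate of f itself. The truncated square integral
  I then satisfies I^2 \<le> A * I and is finite by truncation, so I \<le> A; Fatou's lemma removes
  the truncation.\<close>

lemma square_integrable_circ:
  assumes f: "integrable circ f" and fm: "f \<in> borel_measurable borel"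
    and a: "integrable (count_space UNIV) (\<lambda>k. (norm (fcoeff f k))\<^sup>2)"
  shows "integrable circ (\<lambda>x. (norm (f x))\<^sup>2)"
    and "(LINT x|circ. (norm (f x))\<^sup>2) \<le> (LINT k|count_space UNIV. (norm (fcoeff f k))\<^sup>2) / (2 * pi)"
proof -
  let ?A = "(LINT k|count_space UNIV. (norm (fcoeff f k))\<^sup>2) / (2 * pi)"
  have fm' [measurable]: "f \<in> borel_measurable circ" by (rule measurable_circ[OF fm])
  have A: "?A \<ge> 0" by (auto intro!: divide_nonneg_pos)
  define X where "X n x = (if norm (f x) \<le> real n then (norm (f x))\<^sup>2 else 0)" for n x
  have Xm [measurable]: "X n \<in> borel_measurable circ" for n unfolding X_def by measurable
  have Xb: "norm (X n x) \<le> (real n)\<^sup>2" for n x by (auto simp: X_def power_mono)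
  have Xi: "integrable circ (X n)" for n
    by (rule circ.integrable_const_bound[where B = "(real n)\<^sup>2"]) (use Xb in auto)
  have Xle: "(LINT x|circ. X n x) \<le> ?A" for n
  proof -
    define g where "g x = (if norm (f x) \<le> real n then cnj (f x) else 0)" for x
    have [measurable]: "cnj \<in> borel_measurable borel"
      by (intro borel_measurable_continuous_onI continuous_intros)
    have [measurable]: "f \<in> borel_measurable borel" by (rule fm)
    have gm: "g \<in> borel_measurable borel" unfolding g_def by measurable
    have "norm (g x) \<le> real n" for x by (simp add: g_def)
    from bounded_duality[OF f a gm this]
    have "(norm (LINT x|circ. f x * g x))\<^sup>2 \<le> ?A * (LINT x|circ. (norm (g x))\<^sup>2)" .
    also have "(\<lambda>x. (norm (g x))\<^sup>2) = X n" by (auto simp: g_def X_def)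
    also have "(\<lambda>x. f x * g x) = (\<lambda>x. of_real (X n x))"
      by (auto simp: g_def X_def complex_norm_square simp del: of_real_power)
    finally have "(LINT x|circ. X n x)\<^sup>2 \<le> ?A * (LINT x|circ. X n x)" by simp
    moreover have "(LINT x|circ. X n x) \<ge> 0" by (rule integral_nonneg_AE) (auto simp: X_def)
    ultimately show ?thesis using A by (rule le_of_square_le_mult)
  qed
  have "integrable circ (\<lambda>x. (norm (f x))\<^sup>2) \<and> (LINT x|circ. (norm (f x))\<^sup>2) \<le> ?A"
  proof -
    have nn: "(\<integral>\<^sup>+x. ennreal ((norm (f x))\<^sup>2) \<partial>circ) \<le> ennreal ?A"
    proof -
      have "(\<integral>\<^sup>+x. ennreal ((norm (f x))\<^sup>2) \<partial>circ) = (\<integral>\<^sup>+x. liminf (\<lambda>n. ennreal (X n x)) \<partial>circ)"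
      proof (rule nn_integral_cong)
        fix x
        have "eventually (\<lambda>n. norm (f x) \<le> real n) sequentially"
          using filterlim_real_sequentially by (simp add: filterlim_at_top)
        then have "eventually (\<lambda>n. ennreal (X n x) = ennreal ((norm (f x))\<^sup>2)) sequentially"
          by eventually_elim (simp add: X_def)
        then have "(\<lambda>n. ennreal (X n x)) \<longlonglongrightarrow> ennreal ((norm (f x))\<^sup>2)" by (rule tendsto_eventually)
        then show "ennreal ((norm (f x))\<^sup>2) = liminf (\<lambda>n. ennreal (X n x))"
          by (simp add: lim_imp_Liminf)
      qed
      also have "\<dots> \<le> liminf (\<lambda>n. \<integral>\<^sup>+x. ennreal (X n x) \<partial>circ)"
        by (rule nn_integral_liminf) measurable
      also have "\<dots> \<le> liminf (\<lambda>n. ennreal ?A)"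
      proof (rule Liminf_mono, rule always_eventually, rule allI)
        fix n
        have "(\<integral>\<^sup>+x. ennreal (X n x) \<partial>circ) = ennreal (LINT x|circ. X n x)"
          by (rule nn_integral_eq_integral[OF Xi]) (auto simp: X_def)
        then show "(\<integral>\<^sup>+x. ennreal (X n x) \<partial>circ) \<le> ennreal ?A" using Xle[of n] by (simp add: ennreal_leI)
      qed
      finally show ?thesis by (simp only: Liminf_const[OF sequentially_bot])
    qed
    have i: "integrable circ (\<lambda>x. (norm (f x))\<^sup>2)"
      by (rule integrableI_bounded) (use nn in \<open>auto simp: less_top[symmetric] top_unique\<close>)
    moreover have "ennreal (LINT x|circ. (norm (f x))\<^sup>2) \<le> ennreal ?A"
      using nn nn_integral_eq_integral[OF i] by simp
    ultimately show ?thesis using A by (simp add: ennreal_le_iff)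
  qed
  then show "integrable circ (\<lambda>x. (norm (f x))\<^sup>2)"
    and "(LINT x|circ. (norm (f x))\<^sup>2) \<le> ?A" by auto
qed

lemma integral_Cauchy_Schwarz:
  fixes u v :: "'a \<Rightarrow> real"
  assumes [measurable]: "u \<in> borel_measurable M" "v \<in> borel_measurable M"
    and u: "integrable M (\<lambda>x. (u x)\<^sup>2)" and v: "integrable M (\<lambda>x. (v x)\<^sup>2)"
    and pos: "\<And>x. u x \<ge> 0" "\<And>x. v x \<ge> 0"
  shows "integrable M (\<lambda>x. u x * v x)"
    and "(LINT x|M. u x * v x)\<^sup>2 \<le> (LINT x|M. (u x)\<^sup>2) * (LINT x|M. (v x)\<^sup>2)"
proof -
  have "u x * v x \<le> (u x)\<^sup>2 + (v x)\<^sup>2" for x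
    using sum_squares_bound[of "u x" "v x"] pos[of x] mult_nonneg_nonneg[OF pos, of x x] by linarith
  then show i: "integrable M (\<lambda>x. u x * v x)"
    by (intro Bochner_Integration.integrable_bound[OF Bochner_Integration.integrable_add[OF u v]])
      (auto simp: pos)
  have "(\<integral>\<^sup>+x. ennreal (u x) * ennreal (v x) \<partial>M)\<^sup>2 \<le> (\<integral>\<^sup>+x. (ennreal (u x))\<^sup>2 \<partial>M) * (\<integral>\<^sup>+x. (ennreal (v x))\<^sup>2 \<partial>M)"
    by (rule Cauchy_Schwarz_nn_integral) measurable
  also have "(\<integral>\<^sup>+x. ennreal (u x) * ennreal (v x) \<partial>M) = ennreal (LINT x|M. u x * v x)"
    using i pos by (simp add: nn_integral_eq_integral flip: ennreal_mult)
  also have "(\<integral>\<^sup>+x. (ennreal (u x))\<^sup>2 \<partial>M) = ennreal (LINT x|M. (u x)\<^sup>2)"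
    using u pos by (simp add: nn_integral_eq_integral ennreal_power)
  also have "(\<integral>\<^sup>+x. (ennreal (v x))\<^sup>2 \<partial>M) = ennreal (LINT x|M. (v x)\<^sup>2)"
    using v pos by (simp add: nn_integral_eq_integral ennreal_power)
  finally show "(LINT x|M. u x * v x)\<^sup>2 \<le> (LINT x|M. (u x)\<^sup>2) * (LINT x|M. (v x)\<^sup>2)"
    by (simp add: ennreal_power ennreal_le_iff integral_nonneg_AE pos flip: ennreal_mult)
qed

text \<open>The remainder f - S N has the tail of the coefficients of f as its coefficients, so the
  preceding bound applied to it makes its L2 norm tend to zero. Paired with g, which is square
  integrable by the same result, it disappears, and the pairing of S N with g is the finite
  convolution sum.\<close>

lemma fcoeff_product:
  assumes f: "integrable circ f" "f \<in> borel_measurable borel"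
    and a: "integrable (count_space UNIV) (\<lambda>k. (norm (fcoeff f k))\<^sup>2)"
    and g: "integrable circ g" "g \<in> borel_measurable borel"
    and b: "integrable (count_space UNIV) (\<lambda>k. (norm (fcoeff g k))\<^sup>2)"
  shows "(\<lambda>N. \<Sum>j\<in>{- int N..int N}. fcoeff f j * fcoeff g (k - j)) \<longlonglongrightarrow> of_real (2 * pi) * fcoeff (\<lambda>x. f x * g x) k"
proof -
  have fm [measurable]: "f \<in> borel_measurable circ" "g \<in> borel_measurable circ"
    using f g by (auto intro: measurable_circ)
  define S where "S N x = (\<Sum>j\<in>{- int N..int N}. fcoeff f j / of_real (2 * pi) * cis (of_int j * x))" for N x
  have Sc: "continuous_on UNIV (S N)" for N unfolding S_def by (intro continuous_intros)
  have Sb [measurable]: "S N \<in> borel_measurable borel" for N by (intro borel_measurable_continuous_onI Sc)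
  have Sm [measurable]: "S N \<in> borel_measurable circ" for N by (rule measurable_circ) measurable
  have Si: "integrable circ (S N)" for N by (rule integrable_circ_continuous[OF Sc])
  define r where "r N x = f x - S N x" for N x
  have ri: "integrable circ (r N)" for N unfolding r_def by (intro Bochner_Integration.integrable_diff f Si)
  have rb: "r N \<in> borel_measurable borel" for N unfolding r_def using f(2) Sb by (rule borel_measurable_diff)
  have rm [measurable]: "r N \<in> borel_measurable circ" for N by (rule measurable_circ[OF rb])
  have Scoef: "fcoeff (S N) i = (if i \<in> {- int N..int N} then fcoeff f i else 0)" for N i
  proof -
    have "fcoeff (S N) i = (LINT x|circ. (\<Sum>j\<in>{- int N..int N}. fcoeff f j / of_real (2 * pi) * cis (of_int (j - i) * x)))"
      unfolding fcoeff_circ[of "S N"] S_def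
      by (simp add: sum_distrib_right mult.assoc cis_mult left_diff_distrib)
    also have "\<dots> = (\<Sum>j\<in>{- int N..int N}. fcoeff f j / of_real (2 * pi) * (LINT x|circ. cis (of_int (j - i) * x)))"
      by (subst Bochner_Integration.integral_sum)
        (auto intro!: integrable_mult_right integrable_circ_continuous continuous_intros)
    also have "\<dots> = (\<Sum>j\<in>{- int N..int N}. if j = i then fcoeff f i else 0)"
      unfolding integral_cis_circ by (intro sum.cong refl) auto
    finally show ?thesis by simp
  qed
  have rcoef: "fcoeff (r N) i = (if i \<in> {- int N..int N} then 0 else fcoeff f i)" for N i
  proof -
    have "fcoeff (r N) i = fcoeff f i - fcoeff (S N) i"
      unfolding fcoeff_circ r_def left_diff_distrib
      by (intro Bochner_Integration.integral_diff integrable_mult_cis f Si) (auto intro: measurable_circ)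
    then show ?thesis by (simp add: Scoef)
  qed
  define R where "R N = (LINT k|count_space UNIV. (norm (fcoeff (r N) k))\<^sup>2)" for N
  have Ri: "integrable (count_space UNIV) (\<lambda>k. (norm (fcoeff (r N) k))\<^sup>2)" for N
    by (rule Bochner_Integration.integrable_bound[OF a]) (auto simp: rcoef)
  have "R \<longlonglongrightarrow> (LINT k|count_space (UNIV :: int set). 0)"
    unfolding R_def
  proof (rule integral_dominated_convergence[OF _ _ a])
    show "AE k in count_space UNIV. (\<lambda>N. (norm (fcoeff (r N) k))\<^sup>2) \<longlonglongrightarrow> 0"
    proof (intro AE_I2 tendsto_eventually)
      fix k
      have "eventually (\<lambda>N. nat \<bar>k\<bar> \<le> N) sequentially" by (rule eventually_ge_at_top)
      then show "eventually (\<lambda>N. (norm (fcoeff (r N) k))\<^sup>2 = 0) sequentially"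
        by eventually_elim (auto simp: rcoef)
    qed
  qed (auto simp: rcoef)
  then have R0: "R \<longlonglongrightarrow> 0" by simp
  have sq: "integrable circ (\<lambda>x. (norm (g x))\<^sup>2)" by (rule square_integrable_circ[OF g b])
  have bound: "norm (LINT x|circ. r N x * g x * cis (- (of_int k * x))) \<le> sqrt (R N / (2 * pi) * (LINT x|circ. (norm (g x))\<^sup>2))" for N
  proof -
    note sr = square_integrable_circ[OF ri rb Ri, of N]
    note cs = integral_Cauchy_Schwarz[where M = circ and u = "\<lambda>x. norm (r N x)" and v = "\<lambda>x. norm (g x)", OF _ _ sr(1) sq]
    have "norm (LINT x|circ. r N x * g x * cis (- (of_int k * x))) \<le> (LINT x|circ. norm (r N x) * norm (g x))"
      by (rule order_trans[OF integral_norm_bound]) (simp add: norm_mult)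
    also have "\<dots> \<le> sqrt ((LINT x|circ. (norm (r N x))\<^sup>2) * (LINT x|circ. (norm (g x))\<^sup>2))"
      by (intro real_le_rsqrt cs(2)) auto
    also have "\<dots> \<le> sqrt (R N / (2 * pi) * (LINT x|circ. (norm (g x))\<^sup>2))"
      using sr(2) by (intro real_sqrt_le_mono mult_right_mono) (auto simp: R_def)
    finally show ?thesis .
  qed
  have "(\<lambda>N. LINT x|circ. r N x * g x * cis (- (of_int k * x))) \<longlonglongrightarrow> 0"
  proof (rule Lim_null_comparison[OF always_eventually[OF allI[OF bound]]])
    have "(\<lambda>N. sqrt (R N / (2 * pi) * (LINT x|circ. (norm (g x))\<^sup>2))) \<longlonglongrightarrow> sqrt (0 / (2 * pi) * (LINT x|circ. (norm (g x))\<^sup>2))"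
      by (intro tendsto_intros R0) simp
    then show "(\<lambda>N. sqrt (R N / (2 * pi) * (LINT x|circ. (norm (g x))\<^sup>2))) \<longlonglongrightarrow> 0" by simp
  qed
  moreover have "(LINT x|circ. r N x * g x * cis (- (of_int k * x))) =
     fcoeff (\<lambda>x. f x * g x) k - (\<Sum>j\<in>{- int N..int N}. fcoeff f j * fcoeff g (k - j)) / of_real (2 * pi)" for N
  proof -
    have fg: "integrable circ (\<lambda>x. f x * g x * cis (- (of_int k * x)))"
    proof (rule integrable_mult_cis)
      have "integrable circ (\<lambda>x. norm (f x) * norm (g x))"
        by (rule integral_Cauchy_Schwarz(1)) (use square_integrable_circ(1)[OF f a] sq in auto)
      then show "integrable circ (\<lambda>x. f x * g x)"
        by (rule Bochner_Integration.integrable_bound) (auto simp: norm_mult)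
    qed (auto intro: measurable_circ)
    have Sg: "S N x * g x * cis (- (of_int k * x)) = (\<Sum>j\<in>{- int N..int N}. fcoeff f j / of_real (2 * pi) * (g x * cis (- (of_int (k - j) * x))))" for x
      unfolding S_def sum_distrib_right
    proof (intro sum.cong refl)
      fix j
      have "cis (- (of_int (k - j) * x)) = cis (of_int j * x) * cis (- (of_int k * x))"
        by (simp add: cis_mult algebra_simps)
      then show "fcoeff f j / of_real (2 * pi) * cis (of_int j * x) * g x * cis (- (of_int k * x)) =
          fcoeff f j / of_real (2 * pi) * (g x * cis (- (of_int (k - j) * x)))"
        by (simp add: mult_ac)
    qed
    have gi: "integrable circ (\<lambda>x. g x * cis (- (of_int j * x)))" for j
      by (intro integrable_mult_cis g) (auto intro: measurable_circ)
    have "(LINT x|circ. S N x * g x * cis (- (of_int k * x))) = (\<Sum>j\<in>{- int N..int N}. fcoeff f j / of_real (2 * pi) * fcoeff g (k - j))"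
      unfolding Sg fcoeff_circ[of g]
      by (subst Bochner_Integration.integral_sum) (auto intro!: gi integrable_mult_right simp del: of_int_diff)
    moreover have "(LINT x|circ. r N x * g x * cis (- (of_int k * x))) = (LINT x|circ. f x * g x * cis (- (of_int k * x))) - (LINT x|circ. S N x * g x * cis (- (of_int k * x)))"
      unfolding r_def left_diff_distrib
      by (rule Bochner_Integration.integral_diff[OF fg]) (auto simp: Sg intro!: gi Bochner_Integration.integrable_sum integrable_mult_right simp del: of_int_diff)
    ultimately show ?thesis by (simp add: fcoeff_circ[of "\<lambda>x. f x * g x"] sum_divide_distrib)
  qed
  ultimately have "(\<lambda>N. fcoeff (\<lambda>x. f x * g x) k - (\<Sum>j\<in>{- int N..int N}. fcoeff f j * fcoeff g (k - j)) / of_real (2 * pi)) \<longlonglongrightarrow> 0"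
    by simp
  from tendsto_mult_left[OF this, of "of_real (2 * pi)"]
  have "(\<lambda>N. of_real (2 * pi) * fcoeff (\<lambda>x. f x * g x) k - (\<Sum>j\<in>{- int N..int N}. fcoeff f j * fcoeff g (k - j))) \<longlonglongrightarrow> 0"
    by (simp add: right_diff_distrib)
  from tendsto_diff[OF tendsto_const[of "of_real (2 * pi) * fcoeff (\<lambda>x. f x * g x) k"] this]
  show ?thesis by simp
qed

section \<open>Resonance and the pointwise kernel bound\<close>

lemma bracket_ge_1: "1 \<le> bracket y" by (simp add: bracket_def)
lemma bracket_ge_abs: "\<bar>y\<bar> \<le> bracket y"
  unfolding bracket_def by (rule real_le_rsqrt) simp
lemma bracket_pos: "0 < bracket y" using bracket_ge_1[of y] by linarith
lemma bracket_neq_0 [simp]: "bracket y \<noteq> 0" using bracket_pos[of y] by simp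
lemma bracket_le:
  assumes "\<bar>y\<bar> \<ge> 1"
  shows "bracket y \<le> 2 * \<bar>y\<bar>"
proof -
  have "1 \<le> \<bar>y\<bar> ^ 2" using assms by (rule one_le_power)
  then show ?thesis unfolding bracket_def by (intro real_le_lsqrt) (auto simp: power_mult_distrib)
qed

lemma one_of_three_ge: "c \<le> d / 3 \<Longrightarrow> d \<le> s1 + s2 + s3 \<Longrightarrow> c \<le> s1 \<or> c \<le> s2 \<or> c \<le> (s3::real)"
  by argo

text \<open>If b \<le> a, then a^\<alpha> \<le> (a + b)^\<alpha>, and b \<le> (a + b)/2 with
  \<alpha> \<ge> 1 gives b^\<alpha> \<le> (a + b)^\<alpha> / 2. Half of b (a + b)^\<alpha>
  survives.\<close>

lemma resonance_pos:
  fixes a b \<alpha> :: real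
  assumes "0 < a" "0 < b" "\<alpha> \<ge> 1"
  shows "1/2 * min a b * (a + b) powr \<alpha> \<le> (a + b) * (a + b) powr \<alpha> - a * a powr \<alpha> - b * b powr \<alpha>"
proof -
  have *: "1/2 * b * (a + b) powr \<alpha> \<le> (a + b) * (a + b) powr \<alpha> - a * a powr \<alpha> - b * b powr \<alpha>"
    if "0 < a" "0 < b" "b \<le> a" for a b
  proof -
    have "b powr \<alpha> \<le> ((a + b) / 2) powr \<alpha>" using that assms by (intro powr_mono2) auto
    also have "\<dots> = (a + b) powr \<alpha> / 2 powr \<alpha>" using that by (simp add: powr_divide)
    also have "\<dots> \<le> (a + b) powr \<alpha> / 2"
      using powr_mono[of 1 \<alpha> 2] assms by (intro divide_left_mono) auto
    finally have "b * b powr \<alpha> \<le> b * ((a + b) powr \<alpha> / 2)" using that by (intro mult_left_mono) auto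
    moreover have "a * a powr \<alpha> \<le> a * (a + b) powr \<alpha>"
      using that assms by (intro mult_left_mono powr_mono2) auto
    ultimately show ?thesis by (simp add: distrib_right)
  qed
  show ?thesis
  proof (cases "b \<le> a")
    case True then show ?thesis using *[of a b] assms by simp
  next
    case False then show ?thesis using *[of b a] assms by (simp add: add.commute min_def)
  qed
qed

text \<open>The dispersion relation is odd. In each sign pattern the largest modulus is the sum of
  the other two, and up to sign the resonance is the positive expression already bounded.\<close>

lemma resonance:
  fixes k1 k2 :: int
  assumes "\<alpha> \<ge> 1" "k1 \<noteq> 0" "k2 \<noteq> 0" "k1 + k2 \<noteq> 0"
  defines "x \<equiv> \<bar>of_int (k1 + k2)\<bar> :: real" and "x1 \<equiv> \<bar>of_int k1\<bar> :: real" and "x2 \<equiv> \<bar>of_int k2\<bar> :: real"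
  shows "1/2 * min x (min x1 x2) * max x (max x1 x2) powr \<alpha> \<le> \<bar>disp \<alpha> (k1 + k2) - disp \<alpha> k1 - disp \<alpha> k2\<bar>"
proof -
  have disp_pos: "disp \<alpha> k = \<bar>of_int k\<bar> * \<bar>of_int k\<bar> powr \<alpha>" if "k > 0" for k
    using that by (simp add: disp_def)
  have disp_neg: "disp \<alpha> k = - (\<bar>of_int k\<bar> * \<bar>of_int k\<bar> powr \<alpha>)" if "k < 0" for k
    using that by (simp add: disp_def)
  have pos: "x > 0" "x1 > 0" "x2 > 0" using assms by (auto simp: x_def x1_def x2_def)
  consider "k1 > 0 \<and> k2 > 0" | "k1 < 0 \<and> k2 < 0" | "k1 > 0 \<and> k2 < 0 \<and> k1 + k2 > 0" | "k1 > 0 \<and> k2 < 0 \<and> k1 + k2 < 0"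
    | "k1 < 0 \<and> k2 > 0 \<and> k1 + k2 > 0" | "k1 < 0 \<and> k2 > 0 \<and> k1 + k2 < 0"
    using assms(2-4) by linarith
  then show ?thesis
  proof cases
    case 1
    then have eq: "x1 + x2 = x" by (simp add: x_def x1_def x2_def)
    have d: "disp \<alpha> (k1 + k2) = x * x powr \<alpha>" "disp \<alpha> k1 = x1 * x1 powr \<alpha>" "disp \<alpha> k2 = x2 * x2 powr \<alpha>"
      using 1 by (simp_all add: disp_neg disp_pos x_def x1_def x2_def)
    have mm: "min x (min x1 x2) = min x1 x2" "max x (max x1 x2) = x"
      using pos eq by auto
    show ?thesis unfolding mm d using resonance_pos[OF pos(2,3) assms(1), unfolded eq] by linarith
  next
    case 2
    then have eq: "x1 + x2 = x" by (simp add: x_def x1_def x2_def)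
    have d: "disp \<alpha> (k1 + k2) = - (x * x powr \<alpha>)" "disp \<alpha> k1 = - (x1 * x1 powr \<alpha>)" "disp \<alpha> k2 = - (x2 * x2 powr \<alpha>)"
      using 2 by (simp_all add: disp_neg disp_pos x_def x1_def x2_def)
    have mm: "min x (min x1 x2) = min x1 x2" "max x (max x1 x2) = x"
      using pos eq by auto
    show ?thesis unfolding mm d using resonance_pos[OF pos(2,3) assms(1), unfolded eq] by linarith
  next
    case 3
    then have eq: "x + x2 = x1" by (simp add: x_def x1_def x2_def)
    have d: "disp \<alpha> (k1 + k2) = x * x powr \<alpha>" "disp \<alpha> k1 = x1 * x1 powr \<alpha>" "disp \<alpha> k2 = - (x2 * x2 powr \<alpha>)"
      using 3 by (simp_all add: disp_neg disp_pos x_def x1_def x2_def)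
    have mm: "min x (min x1 x2) = min x x2" "max x (max x1 x2) = x1"
      using pos eq by auto
    show ?thesis unfolding mm d using resonance_pos[OF pos(1,3) assms(1), unfolded eq] by linarith
  next
    case 4
    then have eq: "x + x1 = x2" by (simp add: x_def x1_def x2_def)
    have d: "disp \<alpha> (k1 + k2) = - (x * x powr \<alpha>)" "disp \<alpha> k1 = x1 * x1 powr \<alpha>" "disp \<alpha> k2 = - (x2 * x2 powr \<alpha>)"
      using 4 by (simp_all add: disp_neg disp_pos x_def x1_def x2_def)
    have mm: "min x (min x1 x2) = min x x1" "max x (max x1 x2) = x2"
      using pos eq by auto
    show ?thesis unfolding mm d using resonance_pos[OF pos(1,2) assms(1), unfolded eq] by linarith
  next
    case 5
    then have eq: "x + x1 = x2" by (simp add: x_def x1_def x2_def)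
    have d: "disp \<alpha> (k1 + k2) = x * x powr \<alpha>" "disp \<alpha> k1 = - (x1 * x1 powr \<alpha>)" "disp \<alpha> k2 = x2 * x2 powr \<alpha>"
      using 5 by (simp_all add: disp_neg disp_pos x_def x1_def x2_def)
    have mm: "min x (min x1 x2) = min x x1" "max x (max x1 x2) = x2"
      using pos eq by auto
    show ?thesis unfolding mm d using resonance_pos[OF pos(1,2) assms(1), unfolded eq] by linarith
  next
    case 6
    then have eq: "x + x2 = x1" by (simp add: x_def x1_def x2_def)
    have d: "disp \<alpha> (k1 + k2) = - (x * x powr \<alpha>)" "disp \<alpha> k1 = - (x1 * x1 powr \<alpha>)" "disp \<alpha> k2 = x2 * x2 powr \<alpha>"
      using 6 by (simp_all add: disp_neg disp_pos x_def x1_def x2_def)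
    have mm: "min x (min x1 x2) = min x x2" "max x (max x1 x2) = x1"
      using pos eq by auto
    show ?thesis unfolding mm d using resonance_pos[OF pos(1,3) assms(1), unfolded eq] by linarith
  qed
qed

text \<open>Here \<theta> is twice the excess of \<open>b\<close> over 1/2, and \<delta> is the
  power of the largest frequency X that is left over. \<open>slack\<close> is the exponent count
  when the output has the large modulation: X^(1 - \<alpha>/2 + \<theta>(1 + \<alpha>)) from the
  output weight times X^(- \<beta>/2) from an input of high frequency.\<close>

locale exponents =
  fixes \<alpha> \<beta> \<theta> \<delta> :: real
  assumes \<alpha>: "\<alpha> > 1" and \<beta>: "0 < \<beta>" "\<beta> \<le> 1" and \<theta>: "0 < \<theta>" "\<theta> \<le> 1/2" and \<delta>: "0 < \<delta>"
    and slack: "1 - (\<alpha> + \<beta>) / 2 + \<theta> * (1 + \<alpha>) \<le> - \<delta>"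
begin

abbreviation K :: "int \<Rightarrow> real" where "K k \<equiv> bracket (of_int k) powr \<beta>"
abbreviation b :: real where "b \<equiv> 1/2 + \<theta> / 2"
abbreviation W :: "int \<Rightarrow> real \<Rightarrow> real" where "W \<equiv> Z_weight \<alpha> \<beta> b"
abbreviation q :: "int \<Rightarrow> real" where "q k \<equiv> \<bar>of_int k\<bar> powr (- 1/2 - \<delta>)"

lemma W_eq: "W k \<tau> = bracket (of_int k) powr (\<beta> / 2) * bracket ((\<tau> - disp \<alpha> k) / K k) powr b"
  using \<theta> by (simp add: Z_weight_def)

lemma W_pos: "W k \<tau> > 0"
  by (simp add: W_eq)

lemma K_pos: "K k > 0" using bracket_pos[of "of_int k"] by simp

lemma K_le: "k \<noteq> 0 \<Longrightarrow> K k \<le> 2 * \<bar>of_int k\<bar> powr \<beta>"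
proof -
  assume "k \<noteq> 0"
  then have k: "\<bar>of_int k :: real\<bar> \<ge> 1" by linarith
  have "K k \<le> (2 * \<bar>of_int k\<bar>) powr \<beta>"
    using bracket_le[OF k] bracket_pos[of "of_int k"] \<beta> by (intro powr_mono2) auto
  also have "\<dots> = 2 powr \<beta> * \<bar>of_int k\<bar> powr \<beta>" by (simp add: powr_mult)
  also have "\<dots> \<le> 2 * \<bar>of_int k\<bar> powr \<beta>"
    using powr_mono[of \<beta> 1 2] \<beta> by (intro mult_right_mono) auto
  finally show ?thesis .
qed

lemma W_ge: 
  assumes "k \<noteq> 0"
  shows "\<bar>of_int k\<bar> powr (\<beta> / 2) \<le> W k \<tau>"
proof -
  have "\<bar>of_int k\<bar> powr (\<beta> / 2) * 1 \<le> W k \<tau>"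
    unfolding W_eq using \<beta> \<theta> bracket_ge_abs[of "of_int k"] bracket_ge_1
    by (intro mult_mono powr_mono2 ge_one_powr_ge_zero) auto
  then show ?thesis by simp
qed

text \<open>If the input \<open>k\<^sub>1\<close> carries the large modulation, its weight alone absorbs half a power of the resonance.\<close>

lemma W_ge_modulation:
  assumes k: "k \<noteq> 0" and m: "1 \<le> m" and X: "\<bar>of_int k\<bar> \<le> X"
    and \<sigma>: "m * X powr \<alpha> / 6 \<le> \<bar>\<tau> - disp \<alpha> k\<bar>"
  shows "m powr (1/2) * X powr (\<alpha> / 2) / 36 \<le> W k \<tau>"
proof -
  \<comment> \<open>The resonance bound with its constant 1/2 is shared among three modulations,
    whence the 1/6.\<close>
  define h where "h = m * X powr \<alpha> / 6"
  have X1: "1 \<le> X" using k X by linarith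
  have h0: "h > 0" using m X1 by (simp add: h_def)
  have "K k \<le> 2 * X powr \<alpha>"
  proof -
    have "\<bar>of_int k\<bar> powr \<beta> \<le> X powr \<beta>" using X \<beta> by (intro powr_mono2) auto
    also have "\<dots> \<le> X powr \<alpha>" using X1 \<alpha> \<beta> by (intro powr_mono) auto
    finally show ?thesis using K_le[OF k] by linarith
  qed
  \<comment> \<open>In the power b = 1/2 + \<theta>/2 of h / K, the half power supplies the gain;
    the surplus \<theta>/2 is merely bounded below by 1/12. With sqrt (1/6) \<ge> 1/3 this makes the
    36.\<close>
  also have "\<dots> \<le> 12 * h"
    using m mult_right_mono[of 1 m "X powr \<alpha>"] by (simp add: h_def)
  finally have Kh: "1/12 \<le> h / K k" using K_pos[of k] by (simp add: field_simps)
  have "(1/12::real) powr 1 \<le> (1/12) powr (\<theta> / 2)" using \<theta> by (intro powr_mono') auto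
  also have "\<dots> \<le> (h / K k) powr (\<theta> / 2)" using Kh \<theta> by (intro powr_mono2) auto
  finally have r: "1/12 \<le> (h / K k) powr (\<theta> / 2)" by simp
  have "h powr (1/2) = (1/6) powr (1/2) * (m powr (1/2) * X powr (\<alpha> / 2))"
  proof -
    have "h = (1/6) * (m * X powr \<alpha>)" by (simp add: h_def)
    then show ?thesis using m X1 by (simp only: powr_mult powr_powr) (simp add: mult.commute)
  qed
  moreover have "(1/3::real) \<le> sqrt (1/6)" by (rule real_le_rsqrt) (simp add: power2_eq_square)
  then have "(1/3::real) \<le> (1/6) powr (1/2)" by (simp add: powr_half_sqrt)
  ultimately have h2: "1/3 * (m powr (1/2) * X powr (\<alpha> / 2)) \<le> h powr (1/2)"
    by (simp only:) (intro mult_right_mono, auto)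
  have "m powr (1/2) * X powr (\<alpha> / 2) / 36 = 1/3 * (m powr (1/2) * X powr (\<alpha> / 2)) * (1/12)" by simp
  also have "\<dots> \<le> h powr (1/2) * (h / K k) powr (\<theta> / 2)"
    using h2 r by (intro mult_mono) auto
  also have "\<dots> = K k powr (1/2) * (h / K k) powr b"
  proof -
    have "h powr (1/2) = K k powr (1/2) * (h / K k) powr (1/2)"
      using h0 K_pos[of k] by (simp flip: powr_mult)
    then show ?thesis by (simp add: powr_add)
  qed
  also have "K k powr (1/2) = bracket (of_int k) powr (\<beta> / 2)"
    by (simp add: powr_powr)
  also have "(h / K k) powr b \<le> bracket ((\<tau> - disp \<alpha> k) / K k) powr b"
  proof (rule powr_mono2)
    have "h / K k \<le> \<bar>\<tau> - disp \<alpha> k\<bar> / K k"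
      using \<sigma> K_pos[of k] by (intro divide_right_mono) (auto simp: h_def)
    then have "h / K k \<le> \<bar>(\<tau> - disp \<alpha> k) / K k\<bar>"
      by (simp add: abs_divide)
    then show "h / K k \<le> bracket ((\<tau> - disp \<alpha> k) / K k)" using bracket_ge_abs order_trans by blast
  qed (use \<theta> h0 K_pos[of k] in auto)
  finally show ?thesis by (simp add: W_eq mult_left_mono)
qed

text \<open>The exponent \<theta> - 1/2 is nonpositive, so a large modulation makes the bracket
  factor small. The power K^(1/2 - \<theta>) released by the rescaling offsets the - \<beta>/2 in
  the frequency power, leaving |k|^(1 - \<beta>\<theta>/2), at most X. The loss m^\<theta> is
  charged to X^\<theta>.\<close>

lemma output_weight_le:
  assumes k: "k \<noteq> 0" and m: "1 \<le> m" and mX: "m \<le> X" and X: "\<bar>of_int k\<bar> \<le> X"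
    and \<sigma>: "m * X powr \<alpha> / 6 \<le> \<bar>\<tau> - disp \<alpha> k\<bar>"
  shows "\<bar>of_int k\<bar> powr (1 - \<beta> / 2 + \<beta> * \<theta> / 2) * bracket ((\<tau> - disp \<alpha> k) / K k) powr (\<theta> - 1/2)
     \<le> 12 * m powr (- 1/2) * X powr (1 - \<alpha> / 2 + \<theta> * (1 + \<alpha>))"
proof -
  define x where "x = \<bar>of_int k :: real\<bar>"
  have x1: "1 \<le> x" using k by (simp add: x_def)
  have X1: "1 \<le> X" using m mX by simp
  define h where "h = m * X powr \<alpha> / 6"
  have h0: "h > 0" using m X1 by (simp add: h_def)
  have "bracket ((\<tau> - disp \<alpha> k) / K k) powr (\<theta> - 1/2) \<le> (h / K k) powr (\<theta> - 1/2)"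
  proof (rule powr_mono2')
    have "h / K k \<le> \<bar>\<tau> - disp \<alpha> k\<bar> / K k"
      using \<sigma> K_pos[of k] by (intro divide_right_mono) (auto simp: h_def)
    then have "h / K k \<le> \<bar>(\<tau> - disp \<alpha> k) / K k\<bar>"
      by (simp add: abs_divide)
    then show "h / K k \<le> bracket ((\<tau> - disp \<alpha> k) / K k)" using bracket_ge_abs order_trans by blast
  qed (use \<theta> h0 K_pos[of k] in auto)
  also have "(h / K k) powr (\<theta> - 1/2) = (K k / h) powr (1/2 - \<theta>)"
  proof -
    have "(h / K k) powr (- e) = (K k / h) powr e" for e
      using h0 K_pos[of k] by (simp add: powr_minus powr_divide)
    from this[of "1/2 - \<theta>"] show ?thesis by simp
  qed
  also have "\<dots> \<le> (12 * (x powr \<beta> * (m powr - 1 * X powr (- \<alpha>)))) powr (1/2 - \<theta>)"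
  proof (rule powr_mono2)
    show "K k / h \<le> 12 * (x powr \<beta> * (m powr - 1 * X powr (- \<alpha>)))"
      using K_le[OF k] m X1 by (simp add: h_def x_def powr_minus field_simps)
  qed (use \<theta> h0 K_pos[of k] in auto)
  also have "\<dots> = 12 powr (1/2 - \<theta>) * (x powr (\<beta> * (1/2 - \<theta>)) * (m powr (\<theta> - 1/2) * X powr (- \<alpha> * (1/2 - \<theta>))))"
  proof -
    have "- 1 * (1/2 - \<theta>) = \<theta> - 1/2" by simp
    then show ?thesis by (simp only: powr_mult powr_powr)
  qed
  also have "\<dots> \<le> 12 * (x powr (\<beta> * (1/2 - \<theta>)) * ((m powr (- 1/2) * X powr \<theta>) * X powr (- \<alpha> * (1/2 - \<theta>))))"
  proof -
    have "m powr (\<theta> - 1/2) = m powr (- 1/2) * m powr \<theta>" by (simp flip: powr_add)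
    also have "\<dots> \<le> m powr (- 1/2) * X powr \<theta>"
      using m mX \<theta> by (intro mult_left_mono powr_mono2) auto
    finally have 1: "m powr (\<theta> - 1/2) \<le> m powr (- 1/2) * X powr \<theta>" .
    have "12 powr (1/2 - \<theta>) \<le> 12 powr (1::real)" using \<theta> by (intro powr_mono) auto
    then have "12 powr (1/2 - \<theta>) \<le> (12::real)" by simp
    then show ?thesis using 1 by (intro mult_mono) auto
  qed
  finally have "x powr (1 - \<beta> / 2 + \<beta> * \<theta> / 2) * bracket ((\<tau> - disp \<alpha> k) / K k) powr (\<theta> - 1/2)
     \<le> x powr (1 - \<beta> / 2 + \<beta> * \<theta> / 2) * (12 * (x powr (\<beta> * (1/2 - \<theta>)) * ((m powr (- 1/2) * X powr \<theta>) * X powr (- \<alpha> * (1/2 - \<theta>)))))"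
    by (intro mult_left_mono) auto
  also have "\<dots> = 12 * m powr (- 1/2) * ((x powr (1 - \<beta> / 2 + \<beta> * \<theta> / 2) * x powr (\<beta> * (1/2 - \<theta>))) * (X powr \<theta> * X powr (- \<alpha> * (1/2 - \<theta>))))"
    by (simp add: mult_ac)
  also have "\<dots> = 12 * m powr (- 1/2) * (x powr (1 - \<beta> * \<theta> / 2) * X powr (- \<alpha> / 2 + \<theta> * (1 + \<alpha>)))"
    unfolding powr_add[symmetric] by (simp add: algebra_simps)
  also have "\<dots> \<le> 12 * m powr (- 1/2) * (X powr 1 * X powr (- \<alpha> / 2 + \<theta> * (1 + \<alpha>)))"
  proof -
    have "x powr (1 - \<beta> * \<theta> / 2) \<le> x powr 1" using x1 \<beta> \<theta> by (intro powr_mono) auto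
    also have "\<dots> \<le> X powr 1" using X x1 by (intro powr_mono2) (auto simp: x_def)
    finally show ?thesis by (intro mult_left_mono mult_right_mono) auto
  qed
  also have "\<dots> = 12 * m powr (- 1/2) * X powr (1 - \<alpha> / 2 + \<theta> * (1 + \<alpha>))"
    unfolding powr_add[symmetric] by (simp add: algebra_simps)
  finally show ?thesis by (simp add: x_def)
qed

text \<open>Each case consumes only one input weight. The other is kept as 1 / \<open>W\<close> for
  the later integration in \<tau>; as it may belong to either input, the right side carries a sum.
  Likewise \<open>q\<close> appears at all three frequencies because any of them can be the
  smallest.\<close>

lemma kernel_bound:
  assumes k: "k1 \<noteq> 0" "k2 \<noteq> 0" "k1 + k2 \<noteq> 0"
  shows "\<bar>of_int (k1 + k2)\<bar> powr (1 - \<beta> / 2 + \<beta> * \<theta> / 2)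
      * bracket ((\<tau>1 + \<tau>2 - disp \<alpha> (k1 + k2)) / K (k1 + k2)) powr (\<theta> - 1/2)
      * (1 / W k1 \<tau>1) * (1 / W k2 \<tau>2)
    \<le> 36 * (q (k1 + k2) + q k1 + q k2) * (1 / W k1 \<tau>1 + 1 / W k2 \<tau>2)"
proof -
  define x where "x = \<bar>of_int (k1 + k2) :: real\<bar>"
  define x1 where "x1 = \<bar>of_int k1 :: real\<bar>"
  define x2 where "x2 = \<bar>of_int k2 :: real\<bar>"
  define m where "m = min x (min x1 x2)"
  define X where "X = max x (max x1 x2)"
  define w where "w = bracket ((\<tau>1 + \<tau>2 - disp \<alpha> (k1 + k2)) / K (k1 + k2)) powr (\<theta> - 1/2)"
  have xs: "1 \<le> x" "1 \<le> x1" "1 \<le> x2" using k by (auto simp: x_def x1_def x2_def)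
  have m1: "1 \<le> m" and mX: "m \<le> X" and X1: "1 \<le> X" using xs by (auto simp: m_def X_def)
  have xX: "x \<le> X" "x1 \<le> X" "x2 \<le> X" by (auto simp: X_def)
  have "x \<le> x1 + x2"
    using abs_triangle_ineq[of "of_int k1 :: real" "of_int k2"] by (simp add: x_def x1_def x2_def)
  then have X2: "X \<le> 2 * max x1 x2"
    using xs by (simp add: X_def max_def)
  have W: "W k1 \<tau>1 > 0" "W k2 \<tau>2 > 0" by (rule W_pos)+
  have w01: "0 \<le> w" "w \<le> 1" unfolding w_def using \<theta> bracket_ge_1 bracket_pos
    by (auto intro!: powr_le1 simp: powr_minus_divide[of _ "1/2 - \<theta>", simplified] ge_one_powr_ge_zero)
  \<comment> \<open>The leftover X^(- \<delta>) is traded for m^(- \<delta>), which makes the result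
    a square summable function of the smallest frequency.\<close>
  have gain: "m powr (- 1/2) * X powr e \<le> q (k1 + k2) + q k1 + q k2" if "e \<le> - \<delta>" for e
  proof -
    have "X powr e \<le> X powr (- \<delta>)" using that X1 by (intro powr_mono) auto
    also have "\<dots> \<le> m powr (- \<delta>)" using mX m1 \<delta> by (intro powr_mono2') auto
    finally have "m powr (- 1/2) * X powr e \<le> m powr (- 1/2) * m powr (- \<delta>)" by (intro mult_left_mono) auto
    also have "\<dots> = m powr (- 1/2 - \<delta>)" by (simp flip: powr_add)
    also have "\<dots> \<le> q (k1 + k2) + q k1 + q k2"
      unfolding m_def by (auto simp: min_def x_def x1_def x2_def add_nonneg_nonneg)
    finally show ?thesis .
  qed
  let ?Q = "q (k1 + k2) + q k1 + q k2"
  have Q0: "?Q \<ge> 0" by simp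
  \<comment> \<open>An input of frequency comparable to X gives X^(- \<beta>/2) through the
    frequency part of its weight alone; by \<open>X2\<close> at least one input qualifies.\<close>
  have W_large: "1 / W l \<tau> \<le> 2 * X powr (- \<beta> / 2)" if "l \<noteq> 0" "X \<le> 2 * \<bar>of_int l\<bar>" for l \<tau>
  proof -
    have "X powr (\<beta> / 2) \<le> (2 * \<bar>of_int l\<bar>) powr (\<beta> / 2)" using that X1 \<beta> by (intro powr_mono2) auto
    also have "\<dots> = 2 powr (\<beta> / 2) * \<bar>of_int l\<bar> powr (\<beta> / 2)" by (simp add: powr_mult)
    also have "\<dots> \<le> 2 * \<bar>of_int l\<bar> powr (\<beta> / 2)"
      using powr_mono[of "\<beta> / 2" 1 2] \<beta> by (intro mult_right_mono) auto
    also have "\<dots> \<le> 2 * W l \<tau>" using W_ge[OF that(1)] by simp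
    finally have "X powr (\<beta> / 2) / (X powr (\<beta> / 2) * W l \<tau>) \<le> 2 * W l \<tau> / (X powr (\<beta> / 2) * W l \<tau>)"
      using W_pos[of l \<tau>] by (intro divide_right_mono) auto
    then show ?thesis using X1 W_pos[of l \<tau>] by (simp add: powr_minus divide_simps)
  qed
  have out: "x powr (1 - \<beta> / 2 + \<beta> * \<theta> / 2) * w * (1 / W l \<tau>) \<le> 36 * ?Q"
    if \<sigma>: "m * X powr \<alpha> / 6 \<le> \<bar>\<tau>1 + \<tau>2 - disp \<alpha> (k1 + k2)\<bar>" and l: "l \<noteq> 0" "X \<le> 2 * \<bar>of_int l\<bar>" for l \<tau>
  proof -
    have "x powr (1 - \<beta> / 2 + \<beta> * \<theta> / 2) * w * (1 / W l \<tau>)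
      \<le> (12 * m powr (- 1/2) * X powr (1 - \<alpha> / 2 + \<theta> * (1 + \<alpha>))) * (2 * X powr (- \<beta> / 2))"
    proof (rule mult_mono)
      show "x powr (1 - \<beta> / 2 + \<beta> * \<theta> / 2) * w \<le> 12 * m powr (- 1/2) * X powr (1 - \<alpha> / 2 + \<theta> * (1 + \<alpha>))"
        using output_weight_le[OF k(3) m1 mX _ \<sigma>] xX by (simp add: x_def w_def)
    qed (use W_large[OF l] W_pos[of l \<tau>] in auto)
    also have "\<dots> = 24 * (m powr (- 1/2) * (X powr (1 - \<alpha> / 2 + \<theta> * (1 + \<alpha>)) * X powr (- \<beta> / 2)))"
      by simp
    also have "\<dots> = 24 * (m powr (- 1/2) * X powr (1 - (\<alpha> + \<beta>) / 2 + \<theta> * (1 + \<alpha>)))"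
    proof -
      have "1 - \<alpha> / 2 + \<theta> * (1 + \<alpha>) + - \<beta> / 2 = 1 - (\<alpha> + \<beta>) / 2 + \<theta> * (1 + \<alpha>)" by (simp add: field_simps)
      then show ?thesis unfolding powr_add[symmetric] by (simp only:)
    qed
    also have "\<dots> \<le> 24 * ?Q" by (intro mult_left_mono gain slack) auto
    also have "\<dots> \<le> 36 * ?Q" using Q0 by simp
    finally show ?thesis .
  qed
  \<comment> \<open>With the large modulation on an input, the output bracket factor is only bounded
    by 1. The exponent loss \<beta>\<theta>/2 is below \<theta>(1 + \<alpha>), so
    \<open>slack\<close> covers this case too.\<close>
  have inp: "x powr (1 - \<beta> / 2 + \<beta> * \<theta> / 2) * w * (1 / W l \<tau>) \<le> 36 * ?Q"
    if \<sigma>: "m * X powr \<alpha> / 6 \<le> \<bar>\<tau> - disp \<alpha> l\<bar>" and l: "l \<noteq> 0" "\<bar>of_int l\<bar> \<le> X" for l \<tau>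
  proof -
    have Wl: "m powr (1/2) * X powr (\<alpha> / 2) / 36 \<le> W l \<tau>"
      by (rule W_ge_modulation[OF l(1) m1 l(2) \<sigma>])
    have pos: "0 < m powr (1/2) * X powr (\<alpha> / 2) / 36" using m1 X1 by simp
    have "1 / W l \<tau> \<le> 1 / (m powr (1/2) * X powr (\<alpha> / 2) / 36)"
      using Wl pos by (intro divide_left_mono) auto
    also have "\<dots> = 36 * (m powr (- 1/2) * X powr (- \<alpha> / 2))"
      using m1 X1 by (simp add: powr_minus divide_simps)
    finally have Wi: "1 / W l \<tau> \<le> 36 * (m powr (- 1/2) * X powr (- \<alpha> / 2))" .
    have xw: "x powr (1 - \<beta> / 2 + \<beta> * \<theta> / 2) * w \<le> X powr (1 - \<beta> / 2 + \<beta> * \<theta> / 2) * 1"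
      using w01 xs xX \<beta> \<theta> by (intro mult_mono powr_mono2) auto
    have "x powr (1 - \<beta> / 2 + \<beta> * \<theta> / 2) * w * (1 / W l \<tau>) \<le> (X powr (1 - \<beta> / 2 + \<beta> * \<theta> / 2) * 1) * (36 * (m powr (- 1/2) * X powr (- \<alpha> / 2)))"
      by (rule mult_mono[OF xw Wi]) (use W_pos[of l \<tau>] in auto)
    also have "\<dots> = 36 * (m powr (- 1/2) * (X powr (1 - \<beta> / 2 + \<beta> * \<theta> / 2) * X powr (- \<alpha> / 2)))"
      by simp
    also have "\<dots> = 36 * (m powr (- 1/2) * X powr (1 - (\<alpha> + \<beta>) / 2 + \<beta> * \<theta> / 2))"
    proof -
      have "1 - \<beta> / 2 + \<beta> * \<theta> / 2 + - \<alpha> / 2 = 1 - (\<alpha> + \<beta>) / 2 + \<beta> * \<theta> / 2" by (simp add: field_simps)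
      then show ?thesis unfolding powr_add[symmetric] by (simp only:)
    qed
    also have "\<dots> \<le> 36 * ?Q"
    proof (intro mult_left_mono gain)
      have "\<beta> * \<theta> \<le> 1 * \<theta>" using \<beta> \<theta> by (intro mult_right_mono) auto
      moreover have "0 \<le> \<theta> * \<alpha>" using \<theta> \<alpha> by simp
      ultimately show "1 - (\<alpha> + \<beta>) / 2 + \<beta> * \<theta> / 2 \<le> - \<delta>"
        using slack \<theta>(1) unfolding distrib_left by linarith
    qed auto
    finally show ?thesis .
  qed
  have "m * X powr \<alpha> / 6 \<le> \<bar>disp \<alpha> (k1 + k2) - disp \<alpha> k1 - disp \<alpha> k2\<bar> / 3"
    using resonance[of \<alpha> k1 k2] \<alpha> k by (simp add: m_def X_def x_def x1_def x2_def)
  moreover have "\<bar>disp \<alpha> (k1 + k2) - disp \<alpha> k1 - disp \<alpha> k2\<bar>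
    \<le> \<bar>\<tau>1 + \<tau>2 - disp \<alpha> (k1 + k2)\<bar> + \<bar>\<tau>1 - disp \<alpha> k1\<bar> + \<bar>\<tau>2 - disp \<alpha> k2\<bar>"
    by linarith
  ultimately have "m * X powr \<alpha> / 6 \<le> \<bar>\<tau>1 + \<tau>2 - disp \<alpha> (k1 + k2)\<bar>
    \<or> m * X powr \<alpha> / 6 \<le> \<bar>\<tau>1 - disp \<alpha> k1\<bar> \<or> m * X powr \<alpha> / 6 \<le> \<bar>\<tau>2 - disp \<alpha> k2\<bar>"
    by (rule one_of_three_ge)
  then consider "m * X powr \<alpha> / 6 \<le> \<bar>\<tau>1 + \<tau>2 - disp \<alpha> (k1 + k2)\<bar>"
    | "m * X powr \<alpha> / 6 \<le> \<bar>\<tau>1 - disp \<alpha> k1\<bar>" | "m * X powr \<alpha> / 6 \<le> \<bar>\<tau>2 - disp \<alpha> k2\<bar>"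
    by blast
  then have "x powr (1 - \<beta> / 2 + \<beta> * \<theta> / 2) * w * (1 / W k1 \<tau>1) \<le> 36 * ?Q
      \<or> x powr (1 - \<beta> / 2 + \<beta> * \<theta> / 2) * w * (1 / W k2 \<tau>2) \<le> 36 * ?Q"
  proof cases
    case 1
    have "X \<le> 2 * \<bar>of_int k1\<bar> \<or> X \<le> 2 * \<bar>of_int k2\<bar>"
      using X2 by (auto simp: x1_def x2_def max_def split: if_splits)
    then show ?thesis using out[OF 1] k by blast
  next
    case 2
    then show ?thesis using inp[OF 2 k(1)] xX by (simp add: x1_def)
  next
    case 3
    then show ?thesis using inp[OF 3 k(2)] xX by (simp add: x2_def)
  qed
  then have "x powr (1 - \<beta> / 2 + \<beta> * \<theta> / 2) * w * (1 / W k1 \<tau>1) * (1 / W k2 \<tau>2) \<le> 36 * ?Q * (1 / W k1 \<tau>1 + 1 / W k2 \<tau>2)"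
  proof
    assume *: "x powr (1 - \<beta> / 2 + \<beta> * \<theta> / 2) * w * (1 / W k1 \<tau>1) \<le> 36 * ?Q"
    have "x powr (1 - \<beta> / 2 + \<beta> * \<theta> / 2) * w * (1 / W k1 \<tau>1) * (1 / W k2 \<tau>2) \<le> 36 * ?Q * (1 / W k2 \<tau>2)"
      using W by (intro mult_right_mono[OF *]) auto
    also have "\<dots> \<le> 36 * ?Q * (1 / W k1 \<tau>1 + 1 / W k2 \<tau>2)"
      using W Q0 by (intro mult_left_mono) auto
    finally show ?thesis .
  next
    assume *: "x powr (1 - \<beta> / 2 + \<beta> * \<theta> / 2) * w * (1 / W k2 \<tau>2) \<le> 36 * ?Q"
    have "x powr (1 - \<beta> / 2 + \<beta> * \<theta> / 2) * w * (1 / W k2 \<tau>2) * (1 / W k1 \<tau>1) \<le> 36 * ?Q * (1 / W k1 \<tau>1)"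
      using W by (intro mult_right_mono[OF *]) auto
    also have "\<dots> \<le> 36 * ?Q * (1 / W k1 \<tau>1 + 1 / W k2 \<tau>2)"
      using W Q0 by (intro mult_left_mono) auto
    finally show ?thesis by (simp only: mult_ac)
  qed
  then show ?thesis by (simp add: x_def w_def)
qed

end

section \<open>Convolution estimates on frequency space\<close>

abbreviation cint :: "int measure" where "cint \<equiv> count_space UNIV"
text \<open>Haar measure on the group real times integers. All modes are kept, although the norms
  omit mode 0, so that z - w stays inside and convolutions can use componentwise
  subtraction.\<close>

definition Q :: "(real \<times> int) measure" where "Q = lborel \<Otimes>\<^sub>M cint"

lemma sigma_finite_cint: "sigma_finite_measure cint"
  by (rule sigma_finite_measure_count_space_countable) simp

interpretation cint: sigma_finite_measure cint by (rule sigma_finite_cint)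
interpretation LC: pair_sigma_finite lborel cint ..
lemma sigma_finite_Q: "sigma_finite_measure Q"
  unfolding Q_def by (rule LC.P.sigma_finite_measure_axioms)
interpretation Q: sigma_finite_measure Q by (rule sigma_finite_Q)
interpretation QQ: pair_sigma_finite Q Q ..

lemma space_Q [simp]: "space Q = UNIV"
  by (simp add: Q_def space_pair_measure)

lemma nn_integral_Q:
  assumes "f \<in> borel_measurable Q"
  shows "(\<integral>\<^sup>+z. f z \<partial>Q) = (\<integral>\<^sup>+k. \<integral>\<^sup>+\<tau>. f (\<tau>, k) \<partial>lborel \<partial>cint)"
  using LC.nn_integral_snd[of f] assms by (simp add: Q_def)

lemma fst_Q [measurable]: "fst \<in> borel_measurable Q"
proof -
  have "fst \<in> Q \<rightarrow>\<^sub>M lborel" unfolding Q_def by measurable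
  then show ?thesis by simp
qed

lemma snd_Q [measurable]: "snd \<in> Q \<rightarrow>\<^sub>M cint"
  unfolding Q_def by measurable

lemma measurable_QI:
  assumes "f \<in> borel_measurable M" "g \<in> M \<rightarrow>\<^sub>M cint"
  shows "(\<lambda>x. (f x, g x)) \<in> M \<rightarrow>\<^sub>M Q"
  unfolding Q_def using assms by (intro measurable_Pair) auto

lemma measurable_int_minus [measurable (raw)]:
  assumes "f \<in> M \<rightarrow>\<^sub>M cint" "g \<in> M \<rightarrow>\<^sub>M cint"
  shows "(\<lambda>x. f x - g x :: int) \<in> M \<rightarrow>\<^sub>M cint"
proof -
  have "(\<lambda>(i, j). i - j :: int) \<in> cint \<Otimes>\<^sub>M cint \<rightarrow>\<^sub>M cint"
    by (subst pair_measure_countable) auto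
  then have "(\<lambda>x. (\<lambda>(i, j). i - j) (f x, g x)) \<in> M \<rightarrow>\<^sub>M cint"
    by (rule measurable_compose[rotated]) (intro measurable_Pair assms)
  then show ?thesis by simp
qed

lemma measurable_Q_minus [measurable (raw)]:
  assumes [measurable]: "f \<in> M \<rightarrow>\<^sub>M Q" "g \<in> M \<rightarrow>\<^sub>M Q"
  shows "(\<lambda>x. f x - g x) \<in> M \<rightarrow>\<^sub>M Q"
proof -
  have "(\<lambda>x. (fst (f x) - fst (g x), snd (f x) - snd (g x))) \<in> M \<rightarrow>\<^sub>M Q"
    by (intro measurable_QI) measurable
  then show ?thesis by (simp add: minus_prod_def)
qed

section \<open>Translation and reflection invariance on the frequency group\<close>

lemma nn_integral_lborel_shift:
  fixes f :: "real \<Rightarrow> ennreal"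
  assumes "f \<in> borel_measurable borel"
  shows "(\<integral>\<^sup>+x. f (x - t) \<partial>lborel) = (\<integral>\<^sup>+x. f x \<partial>lborel)" "(\<integral>\<^sup>+x. f (t - x) \<partial>lborel) = (\<integral>\<^sup>+x. f x \<partial>lborel)"
  using nn_integral_real_affine[OF assms, of 1 "- t"] nn_integral_real_affine[OF assms, of "- 1" t] by simp_all

lemma nn_integral_cint_shift:
  fixes f :: "int \<Rightarrow> ennreal"
  shows "(\<integral>\<^sup>+k. f (k - j) \<partial>cint) = (\<integral>\<^sup>+k. f k \<partial>cint)" "(\<integral>\<^sup>+k. f (j - k) \<partial>cint) = (\<integral>\<^sup>+k. f k \<partial>cint)"
proof -
  have "bij_betw (\<lambda>k. k - j) UNIV UNIV" by (rule bij_betw_byWitness[where f' = "\<lambda>k. k + j"]) auto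
  from nn_integral_bij_count_space[OF this, of f]
  show "(\<integral>\<^sup>+k. f (k - j) \<partial>cint) = (\<integral>\<^sup>+k. f k \<partial>cint)" .
  have "bij_betw (\<lambda>k. j - k) UNIV UNIV" by (rule bij_betw_byWitness[where f' = "\<lambda>k. j - k"]) auto
  from nn_integral_bij_count_space[OF this, of f]
  show "(\<integral>\<^sup>+k. f (j - k) \<partial>cint) = (\<integral>\<^sup>+k. f k \<partial>cint)" .
qed

lemma measurable_Q_slice:
  assumes [measurable]: "f \<in> borel_measurable Q"
  shows "(\<lambda>\<tau>. f (\<tau>, k)) \<in> borel_measurable borel"
proof -
  have "(\<lambda>\<tau>. (\<tau>, k)) \<in> borel \<rightarrow>\<^sub>M Q" by (intro measurable_QI) auto
  from measurable_compose[OF this assms] show ?thesis .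
qed

lemma nn_integral_Q_shift:
  assumes [measurable]: "f \<in> borel_measurable Q"
  shows "(\<integral>\<^sup>+z. f (z - w) \<partial>Q) = (\<integral>\<^sup>+z. f z \<partial>Q)" "(\<integral>\<^sup>+z. f (w - z) \<partial>Q) = (\<integral>\<^sup>+z. f z \<partial>Q)"
proof -
  have s: "(\<lambda>\<tau>. f (\<tau>, k)) \<in> borel_measurable borel" for k by (rule measurable_Q_slice[OF assms])
  have m: "(\<lambda>z. f (z - w)) \<in> borel_measurable Q" "(\<lambda>z. f (w - z)) \<in> borel_measurable Q" by measurable
  have "(\<integral>\<^sup>+z. f (z - w) \<partial>Q) = (\<integral>\<^sup>+k. \<integral>\<^sup>+\<tau>. f (\<tau>, k - snd w) \<partial>lborel \<partial>cint)"
    unfolding nn_integral_Q[OF m(1)] by (simp add: minus_prod_def nn_integral_lborel_shift(1)[OF s])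
  also have "\<dots> = (\<integral>\<^sup>+z. f z \<partial>Q)"
    by (simp add: nn_integral_Q nn_integral_cint_shift(1)[of "\<lambda>k. \<integral>\<^sup>+\<tau>. f (\<tau>, k) \<partial>lborel"])
  finally show "(\<integral>\<^sup>+z. f (z - w) \<partial>Q) = (\<integral>\<^sup>+z. f z \<partial>Q)" .
  have "(\<integral>\<^sup>+z. f (w - z) \<partial>Q) = (\<integral>\<^sup>+k. \<integral>\<^sup>+\<tau>. f (\<tau>, snd w - k) \<partial>lborel \<partial>cint)"
    unfolding nn_integral_Q[OF m(2)] by (simp add: minus_prod_def nn_integral_lborel_shift(2)[OF s])
  also have "\<dots> = (\<integral>\<^sup>+z. f z \<partial>Q)"
    by (simp add: nn_integral_Q nn_integral_cint_shift(2)[of "\<lambda>k. \<integral>\<^sup>+\<tau>. f (\<tau>, k) \<partial>lborel"])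
  finally show "(\<integral>\<^sup>+z. f (w - z) \<partial>Q) = (\<integral>\<^sup>+z. f z \<partial>Q)" .
qed

section \<open>Bilinear bounds by Cauchy-Schwarz\<close>

lemma ennreal_sq_add_le: "(a + b)\<^sup>2 \<le> 2 * a\<^sup>2 + 2 * (b :: ennreal)\<^sup>2"
proof (cases a; cases b)
  fix r s :: real assume "a = ennreal r" "0 \<le> r" "b = ennreal s" "0 \<le> s"
  moreover have "(r + s)\<^sup>2 \<le> 2 * r\<^sup>2 + 2 * s\<^sup>2" using sum_squares_bound[of r s] by (simp add: power2_sum)
  moreover have "2 = ennreal 2" by simp
  ultimately show ?thesis
    by (simp add: ennreal_power ennreal_le_iff flip: ennreal_plus ennreal_mult ennreal_numeral)
qed (auto simp: ennreal_mult_top power2_eq_square ennreal_mult_eq_top_iff)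

text \<open>Cauchy-Schwarz separates \<open>A w * B (z - w)\<close> from the kernel. The kernel
  contributes its square integral in w, uniform in z, and the remaining double integral of squares
  factorises by translation invariance.\<close>

lemma convolution_kernel_estimate:
  assumes [measurable]: "A \<in> borel_measurable Q" "B \<in> borel_measurable Q"
    and \<kappa> [measurable]: "(\<lambda>(z, w). \<kappa> z w) \<in> borel_measurable (Q \<Otimes>\<^sub>M Q)"
    and c: "\<And>z. (\<integral>\<^sup>+w. (\<kappa> z w)\<^sup>2 \<partial>Q) \<le> c"
  shows "(\<integral>\<^sup>+z. (\<integral>\<^sup>+w. A w * B (z - w) * \<kappa> z w \<partial>Q)\<^sup>2 \<partial>Q) \<le> c * ((\<integral>\<^sup>+z. (A z)\<^sup>2 \<partial>Q) * (\<integral>\<^sup>+z. (B z)\<^sup>2 \<partial>Q))"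
proof -
  have km [measurable]: "(\<lambda>w. \<kappa> z w) \<in> borel_measurable Q" for z
    using measurable_compose[OF measurable_Pair1' \<kappa>, of z] by (simp add: Q_def space_pair_measure)
  have "(\<integral>\<^sup>+z. (\<integral>\<^sup>+w. A w * B (z - w) * \<kappa> z w \<partial>Q)\<^sup>2 \<partial>Q) \<le> (\<integral>\<^sup>+z. c * (\<integral>\<^sup>+w. (A w)\<^sup>2 * (B (z - w))\<^sup>2 \<partial>Q) \<partial>Q)"
  proof (rule nn_integral_mono)
    fix z
    have "(\<integral>\<^sup>+w. A w * B (z - w) * \<kappa> z w \<partial>Q)\<^sup>2 \<le> (\<integral>\<^sup>+w. (A w * B (z - w))\<^sup>2 \<partial>Q) * (\<integral>\<^sup>+w. (\<kappa> z w)\<^sup>2 \<partial>Q)"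
      by (rule Cauchy_Schwarz_nn_integral) measurable
    also have "\<dots> \<le> (\<integral>\<^sup>+w. (A w * B (z - w))\<^sup>2 \<partial>Q) * c"
      by (intro mult_left_mono c) auto
    finally show "(\<integral>\<^sup>+w. A w * B (z - w) * \<kappa> z w \<partial>Q)\<^sup>2 \<le> c * (\<integral>\<^sup>+w. (A w)\<^sup>2 * (B (z - w))\<^sup>2 \<partial>Q)"
      by (simp add: power_mult_distrib mult.commute)
  qed
  also have "\<dots> = c * (\<integral>\<^sup>+z. \<integral>\<^sup>+w. (A w)\<^sup>2 * (B (z - w))\<^sup>2 \<partial>Q \<partial>Q)"
    by (rule nn_integral_cmult) measurable
  also have "(\<integral>\<^sup>+z. \<integral>\<^sup>+w. (A w)\<^sup>2 * (B (z - w))\<^sup>2 \<partial>Q \<partial>Q) = (\<integral>\<^sup>+w. \<integral>\<^sup>+z. (A w)\<^sup>2 * (B (z - w))\<^sup>2 \<partial>Q \<partial>Q)"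
    by (rule QQ.Fubini') measurable
  also have "\<dots> = (\<integral>\<^sup>+w. (A w)\<^sup>2 * (\<integral>\<^sup>+z. (B z)\<^sup>2 \<partial>Q) \<partial>Q)"
  proof (rule nn_integral_cong)
    fix w
    have "(\<integral>\<^sup>+z. (A w)\<^sup>2 * (B (z - w))\<^sup>2 \<partial>Q) = (A w)\<^sup>2 * (\<integral>\<^sup>+z. (B (z - w))\<^sup>2 \<partial>Q)"
      by (rule nn_integral_cmult) measurable
    then show "(\<integral>\<^sup>+z. (A w)\<^sup>2 * (B (z - w))\<^sup>2 \<partial>Q) = (A w)\<^sup>2 * (\<integral>\<^sup>+z. (B z)\<^sup>2 \<partial>Q)"
      using nn_integral_Q_shift(1)[of "\<lambda>z. (B z)\<^sup>2" w] by simp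
  qed
  also have "\<dots> = (\<integral>\<^sup>+z. (A z)\<^sup>2 \<partial>Q) * (\<integral>\<^sup>+z. (B z)\<^sup>2 \<partial>Q)"
    by (rule nn_integral_multc) measurable
  finally show ?thesis .
qed

lemma nn_integral_Q_product_le:
  assumes [measurable]: "\<mu> \<in> borel_measurable Q"
    and N: "\<And>k. (\<integral>\<^sup>+\<tau>. \<mu> (\<tau>, k) \<partial>lborel) \<le> N"
  shows "(\<integral>\<^sup>+w. r (snd w) * \<mu> w \<partial>Q) \<le> (\<integral>\<^sup>+k. r k \<partial>cint) * N"
proof -
  have s: "(\<lambda>\<tau>. \<mu> (\<tau>, k)) \<in> borel_measurable borel" for k by (rule measurable_Q_slice) measurable
  have rm: "(\<lambda>w. r (snd w)) \<in> borel_measurable Q"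
    by (rule measurable_compose[OF snd_Q]) simp
  have "(\<integral>\<^sup>+w. r (snd w) * \<mu> w \<partial>Q) = (\<integral>\<^sup>+k. r k * (\<integral>\<^sup>+\<tau>. \<mu> (\<tau>, k) \<partial>lborel) \<partial>cint)"
    using s rm by (subst nn_integral_Q) (auto simp: nn_integral_cmult)
  also have "\<dots> \<le> (\<integral>\<^sup>+k. r k * N \<partial>cint)" by (intro nn_integral_mono mult_left_mono N) auto
  also have "\<dots> = (\<integral>\<^sup>+k. r k \<partial>cint) * N" by (rule nn_integral_multc) simp
  finally show ?thesis .
qed

text \<open>Here the factor \<open>q\<close> sits on the output frequency, which for high-high-to-low interactions
  cannot be summed over the inputs; the roles in the Cauchy--Schwarz inequality are therefore different
  from those in the kernel estimate above.\<close>

lemma convolution_output_estimate: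
  assumes A [measurable]: "A \<in> borel_measurable Q" and B [measurable]: "B \<in> borel_measurable Q"
    and \<nu> [measurable]: "\<nu> \<in> borel_measurable Q"
    and N: "\<And>k. (\<integral>\<^sup>+\<tau>. (\<nu> (\<tau>, k))\<^sup>2 \<partial>lborel) \<le> N"
  shows "(\<integral>\<^sup>+z. (q (snd z))\<^sup>2 * (\<integral>\<^sup>+w. A w * B (z - w) * \<nu> w \<partial>Q)\<^sup>2 \<partial>Q)
     \<le> (\<integral>\<^sup>+k. (q k)\<^sup>2 \<partial>cint) * N * ((\<integral>\<^sup>+z. (A z)\<^sup>2 \<partial>Q) * (\<integral>\<^sup>+z. (B z)\<^sup>2 \<partial>Q))"
proof -
  let ?a = "\<integral>\<^sup>+z. (A z)\<^sup>2 \<partial>Q" and ?b = "\<integral>\<^sup>+z. (B z)\<^sup>2 \<partial>Q"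
  \<comment> \<open>Here only A is split off. B stays with \<nu>, and the square of \<open>q\<close>
    is summed when the output variable is integrated.\<close>
  define G where "G z = (\<integral>\<^sup>+w. (B (z - w))\<^sup>2 * (\<nu> w)\<^sup>2 \<partial>Q)" for z
  have Gm [measurable]: "G \<in> borel_measurable Q" unfolding G_def by measurable
  have qm [measurable]: "(\<lambda>z. q (snd z)) \<in> borel_measurable Q"
    by (rule measurable_compose[OF snd_Q]) simp
  have "(\<integral>\<^sup>+z. (q (snd z))\<^sup>2 * (\<integral>\<^sup>+w. A w * B (z - w) * \<nu> w \<partial>Q)\<^sup>2 \<partial>Q) \<le> (\<integral>\<^sup>+z. ?a * ((q (snd z))\<^sup>2 * G z) \<partial>Q)"
  proof (rule nn_integral_mono)
    fix z
    have "(\<integral>\<^sup>+w. A w * B (z - w) * \<nu> w \<partial>Q)\<^sup>2 = (\<integral>\<^sup>+w. A w * (B (z - w) * \<nu> w) \<partial>Q)\<^sup>2"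
      by (simp add: mult.assoc)
    also have "\<dots> \<le> ?a * (\<integral>\<^sup>+w. (B (z - w) * \<nu> w)\<^sup>2 \<partial>Q)"
      by (rule Cauchy_Schwarz_nn_integral) measurable
    finally have "(\<integral>\<^sup>+w. A w * B (z - w) * \<nu> w \<partial>Q)\<^sup>2 \<le> ?a * G z"
      by (simp add: G_def power_mult_distrib)
    from mult_left_mono[OF this, of "(q (snd z))\<^sup>2"]
    show "(q (snd z))\<^sup>2 * (\<integral>\<^sup>+w. A w * B (z - w) * \<nu> w \<partial>Q)\<^sup>2 \<le> ?a * ((q (snd z))\<^sup>2 * G z)"
      by (simp add: mult_ac)
  qed
  also have "\<dots> = ?a * (\<integral>\<^sup>+z. (q (snd z))\<^sup>2 * G z \<partial>Q)"
    by (rule nn_integral_cmult) measurable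
  also have "\<dots> \<le> ?a * ((\<integral>\<^sup>+k. (q k)\<^sup>2 \<partial>cint) * (N * ?b))"
  proof (rule mult_left_mono[OF nn_integral_Q_product_le])
    fix k
    have Bs [measurable]: "(\<lambda>\<tau>. (B (\<tau>, j))\<^sup>2) \<in> borel_measurable borel" for j
      using measurable_Q_slice[OF B, of j] by measurable
    have pm [measurable]: "(\<lambda>(\<tau>, w). (\<tau>, k) - w) \<in> lborel \<Otimes>\<^sub>M Q \<rightarrow>\<^sub>M Q"
    proof -
      have "(\<lambda>x. (fst x, k)) \<in> lborel \<Otimes>\<^sub>M Q \<rightarrow>\<^sub>M Q" by (intro measurable_QI) auto
      from measurable_Q_minus[OF this measurable_snd] show ?thesis by (simp add: case_prod_beta)
    qed
    interpret LQ: pair_sigma_finite lborel Q ..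
    \<comment> \<open>At a fixed output mode the \<tau>-integral hits only B. Afterwards \<nu> can
      be integrated in its own time variable and B summed over modes, which bounds the result
      uniformly in k.\<close>
    have "(\<integral>\<^sup>+\<tau>. G (\<tau>, k) \<partial>lborel) = (\<integral>\<^sup>+w. \<integral>\<^sup>+\<tau>. (B ((\<tau>, k) - w))\<^sup>2 * (\<nu> w)\<^sup>2 \<partial>lborel \<partial>Q)"
      unfolding G_def
    proof (rule LQ.Fubini'[symmetric, where f = "\<lambda>\<tau> w. (B ((\<tau>, k) - w))\<^sup>2 * (\<nu> w)\<^sup>2"])
      have "(\<lambda>x. B ((\<lambda>(\<tau>, w). (\<tau>, k) - w) x)) \<in> borel_measurable (lborel \<Otimes>\<^sub>M Q)"
        by (rule measurable_compose[OF pm B])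
      then have [measurable]: "(\<lambda>x. B ((fst x, k) - snd x)) \<in> borel_measurable (lborel \<Otimes>\<^sub>M Q)"
        by (simp add: case_prod_beta)
      show "(\<lambda>(\<tau>, w). (B ((\<tau>, k) - w))\<^sup>2 * (\<nu> w)\<^sup>2) \<in> borel_measurable (lborel \<Otimes>\<^sub>M Q)"
        unfolding case_prod_beta by measurable
    qed
    also have "\<dots> = (\<integral>\<^sup>+w. (\<integral>\<^sup>+\<tau>. (B (\<tau>, k - snd w))\<^sup>2 \<partial>lborel) * (\<nu> w)\<^sup>2 \<partial>Q)"
    proof (rule nn_integral_cong)
      fix w
      have "(\<integral>\<^sup>+\<tau>. (B ((\<tau>, k) - w))\<^sup>2 * (\<nu> w)\<^sup>2 \<partial>lborel) = (\<integral>\<^sup>+\<tau>. (B (\<tau> - fst w, k - snd w))\<^sup>2 * (\<nu> w)\<^sup>2 \<partial>lborel)"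
        by (simp add: minus_prod_def)
      also have "\<dots> = (\<integral>\<^sup>+\<tau>. (B (\<tau>, k - snd w))\<^sup>2 * (\<nu> w)\<^sup>2 \<partial>lborel)"
        by (rule nn_integral_lborel_shift(1)[where f = "\<lambda>\<tau>. (B (\<tau>, k - snd w))\<^sup>2 * (\<nu> w)\<^sup>2"]) measurable
      also have "\<dots> = (\<integral>\<^sup>+\<tau>. (B (\<tau>, k - snd w))\<^sup>2 \<partial>lborel) * (\<nu> w)\<^sup>2"
        by (rule nn_integral_multc) measurable
      finally show "(\<integral>\<^sup>+\<tau>. (B ((\<tau>, k) - w))\<^sup>2 * (\<nu> w)\<^sup>2 \<partial>lborel) = \<dots>" .
    qed
    also have "\<dots> \<le> (\<integral>\<^sup>+j. (\<integral>\<^sup>+\<tau>. (B (\<tau>, k - j))\<^sup>2 \<partial>lborel) \<partial>cint) * N"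
      by (rule nn_integral_Q_product_le[where r = "\<lambda>j. \<integral>\<^sup>+\<tau>. (B (\<tau>, k - j))\<^sup>2 \<partial>lborel"]) (auto intro: N)
    also have "(\<integral>\<^sup>+j. (\<integral>\<^sup>+\<tau>. (B (\<tau>, k - j))\<^sup>2 \<partial>lborel) \<partial>cint) = ?b"
      using nn_integral_cint_shift(2)[of "\<lambda>j. \<integral>\<^sup>+\<tau>. (B (\<tau>, j))\<^sup>2 \<partial>lborel" k]
      by (simp add: nn_integral_Q)
    finally show "(\<integral>\<^sup>+\<tau>. G (\<tau>, k) \<partial>lborel) \<le> N * ?b" by (simp add: mult.commute)
  qed auto
  finally show ?thesis by (simp add: mult_ac)
qed

text \<open>\<open>q\<close> at an input frequency, multiplied by \<nu>, is square integrable in w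
  and enters the kernel \<kappa>; \<open>q\<close> at the output goes into \<open>I2\<close> and
  \<open>I3\<close>. The constant is 2 * 16 from \<open>I1\<close> plus 4 + 4 from the other
  two.\<close>

lemma convolution_estimate:
  fixes q :: "int \<Rightarrow> ennreal"
  assumes A [measurable]: "A \<in> borel_measurable Q" and B [measurable]: "B \<in> borel_measurable Q"
    and \<nu> [measurable]: "\<nu> \<in> borel_measurable Q"
    and N: "\<And>k. (\<integral>\<^sup>+\<tau>. (\<nu> (\<tau>, k))\<^sup>2 \<partial>lborel) \<le> N"
  shows "(\<integral>\<^sup>+z. (\<integral>\<^sup>+w. A w * B (z - w) * ((q (snd z) + q (snd w) + q (snd (z - w))) * (\<nu> w + \<nu> (z - w))) \<partial>Q)\<^sup>2 \<partial>Q)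
     \<le> 40 * ((\<integral>\<^sup>+k. (q k)\<^sup>2 \<partial>cint) * N * ((\<integral>\<^sup>+z. (A z)\<^sup>2 \<partial>Q) * (\<integral>\<^sup>+z. (B z)\<^sup>2 \<partial>Q)))"
proof -
  let ?a = "\<integral>\<^sup>+z. (A z)\<^sup>2 \<partial>Q" and ?b = "\<integral>\<^sup>+z. (B z)\<^sup>2 \<partial>Q" and ?S = "\<integral>\<^sup>+k. (q k)\<^sup>2 \<partial>cint"
  have qm [measurable]: "(\<lambda>z. q (snd z)) \<in> borel_measurable Q"
    by (rule measurable_compose[OF snd_Q]) simp
  define \<kappa> where "\<kappa> z w = (q (snd w) + q (snd (z - w))) * (\<nu> w + \<nu> (z - w))" for z w
  define I1 where "I1 z = (\<integral>\<^sup>+w. A w * B (z - w) * \<kappa> z w \<partial>Q)" for z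
  define I2 where "I2 z = q (snd z) * (\<integral>\<^sup>+w. A w * B (z - w) * \<nu> w \<partial>Q)" for z
  define I3 where "I3 z = q (snd z) * (\<integral>\<^sup>+w. A w * B (z - w) * \<nu> (z - w) \<partial>Q)" for z
  have qdm [measurable]: "(\<lambda>(z, w). q (snd (z - w))) \<in> borel_measurable (Q \<Otimes>\<^sub>M Q)"
  proof -
    have "(\<lambda>x. fst x - snd x) \<in> Q \<Otimes>\<^sub>M Q \<rightarrow>\<^sub>M Q" by measurable
    from measurable_compose[OF this qm] show ?thesis by (simp add: case_prod_beta)
  qed
  have qdm' [measurable]: "(\<lambda>w. q (snd (z - w))) \<in> borel_measurable Q" for z
  proof -
    have "(\<lambda>w. z - w) \<in> Q \<rightarrow>\<^sub>M Q" by (intro measurable_Q_minus) (auto simp: Q_def space_pair_measure)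
    from measurable_compose[OF this qm] show ?thesis .
  qed
  have m1 [measurable]: "(\<lambda>(z, w). \<kappa> z w) \<in> borel_measurable (Q \<Otimes>\<^sub>M Q)"
    using qdm unfolding \<kappa>_def case_prod_beta by measurable
  have m1' [measurable]: "\<kappa> z \<in> borel_measurable Q" for z
    unfolding \<kappa>_def by measurable
  have [measurable]: "I1 \<in> borel_measurable Q" "I2 \<in> borel_measurable Q" "I3 \<in> borel_measurable Q"
    unfolding I1_def I2_def I3_def by measurable
  have split: "(\<integral>\<^sup>+w. A w * B (z - w) * ((q (snd z) + q (snd w) + q (snd (z - w))) * (\<nu> w + \<nu> (z - w))) \<partial>Q) = I1 z + (I2 z + I3 z)" for z
  proof -
    have "(\<integral>\<^sup>+w. A w * B (z - w) * ((q (snd z) + q (snd w) + q (snd (z - w))) * (\<nu> w + \<nu> (z - w))) \<partial>Q)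
      = (\<integral>\<^sup>+w. A w * B (z - w) * \<kappa> z w + (q (snd z) * (A w * B (z - w) * \<nu> w) + q (snd z) * (A w * B (z - w) * \<nu> (z - w))) \<partial>Q)"
      by (intro nn_integral_cong) (simp add: \<kappa>_def algebra_simps)
    also have "\<dots> = I1 z + (I2 z + I3 z)"
      unfolding I1_def I2_def I3_def by (subst nn_integral_add, measurable, subst nn_integral_add, measurable, simp add: nn_integral_cmult)
    finally show ?thesis .
  qed
  have b1: "(\<integral>\<^sup>+z. (I1 z)\<^sup>2 \<partial>Q) \<le> 16 * (?S * N) * (?a * ?b)"
    unfolding I1_def
  proof (rule convolution_kernel_estimate[OF A B m1])
    fix z
    have \<nu>2 [measurable]: "(\<lambda>w. (\<nu> w)\<^sup>2) \<in> borel_measurable Q" by measurable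
    have p1: "(\<integral>\<^sup>+w. (q (snd w))\<^sup>2 * (\<nu> w)\<^sup>2 \<partial>Q) \<le> ?S * N"
      by (rule nn_integral_Q_product_le[where r = "\<lambda>k. (q k)\<^sup>2"]) (auto intro: N)
    have Nz: "(\<integral>\<^sup>+\<tau>. (\<nu> (z - (\<tau>, k)))\<^sup>2 \<partial>lborel) \<le> N" for k
      using nn_integral_lborel_shift(2)[OF measurable_Q_slice[OF \<nu>2, of "snd z - k"], of "fst z"] N[of "snd z - k"]
      by (simp add: minus_prod_def)
    have p2: "(\<integral>\<^sup>+w. (q (snd w))\<^sup>2 * (\<nu> (z - w))\<^sup>2 \<partial>Q) \<le> ?S * N"
      by (rule nn_integral_Q_product_le[where r = "\<lambda>k. (q k)\<^sup>2" and \<mu> = "\<lambda>w. (\<nu> (z - w))\<^sup>2"]) (use Nz in auto)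
    have S': "(\<integral>\<^sup>+k. (q (snd z - k))\<^sup>2 \<partial>cint) = ?S"
      using nn_integral_cint_shift(2)[of "\<lambda>k. (q k)\<^sup>2" "snd z"] .
    have p3: "(\<integral>\<^sup>+w. (q (snd z - snd w))\<^sup>2 * (\<nu> w)\<^sup>2 \<partial>Q) \<le> ?S * N"
      unfolding S'[symmetric] by (rule nn_integral_Q_product_le[where r = "\<lambda>k. (q (snd z - k))\<^sup>2"]) (auto intro: N)
    have p4: "(\<integral>\<^sup>+w. (q (snd z - snd w))\<^sup>2 * (\<nu> (z - w))\<^sup>2 \<partial>Q) \<le> ?S * N"
      unfolding S'[symmetric]
      by (rule nn_integral_Q_product_le[where r = "\<lambda>k. (q (snd z - k))\<^sup>2" and \<mu> = "\<lambda>w. (\<nu> (z - w))\<^sup>2"]) (use Nz in auto)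
    have "(\<integral>\<^sup>+w. (\<kappa> z w)\<^sup>2 \<partial>Q) \<le> (\<integral>\<^sup>+w. 4 * ((q (snd w))\<^sup>2 * (\<nu> w)\<^sup>2 + ((q (snd w))\<^sup>2 * (\<nu> (z - w))\<^sup>2
       + ((q (snd z - snd w))\<^sup>2 * (\<nu> w)\<^sup>2 + (q (snd z - snd w))\<^sup>2 * (\<nu> (z - w))\<^sup>2))) \<partial>Q)"
    proof (rule nn_integral_mono)
      fix w
      have "(\<kappa> z w)\<^sup>2 = (q (snd w) + q (snd z - snd w))\<^sup>2 * (\<nu> w + \<nu> (z - w))\<^sup>2"
        by (simp add: \<kappa>_def power_mult_distrib)
      also have "\<dots> \<le> (2 * (q (snd w))\<^sup>2 + 2 * (q (snd z - snd w))\<^sup>2) * (2 * (\<nu> w)\<^sup>2 + 2 * (\<nu> (z - w))\<^sup>2)"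
        by (intro mult_mono ennreal_sq_add_le) auto
      also have "\<dots> = 4 * ((q (snd w))\<^sup>2 * (\<nu> w)\<^sup>2 + ((q (snd w))\<^sup>2 * (\<nu> (z - w))\<^sup>2
       + ((q (snd z - snd w))\<^sup>2 * (\<nu> w)\<^sup>2 + (q (snd z - snd w))\<^sup>2 * (\<nu> (z - w))\<^sup>2)))"
        by (simp add: algebra_simps)
      finally show "(\<kappa> z w)\<^sup>2 \<le> \<dots>" .
    qed
    also have "\<dots> = 4 * ((\<integral>\<^sup>+w. (q (snd w))\<^sup>2 * (\<nu> w)\<^sup>2 \<partial>Q) + ((\<integral>\<^sup>+w. (q (snd w))\<^sup>2 * (\<nu> (z - w))\<^sup>2 \<partial>Q)
       + ((\<integral>\<^sup>+w. (q (snd z - snd w))\<^sup>2 * (\<nu> w)\<^sup>2 \<partial>Q) + (\<integral>\<^sup>+w. (q (snd z - snd w))\<^sup>2 * (\<nu> (z - w))\<^sup>2 \<partial>Q))))"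
    proof -
      have [measurable]: "(\<lambda>w. q (snd z - snd w)) \<in> borel_measurable Q" using qdm'[of z] by simp
      show ?thesis
        by (subst nn_integral_cmult, measurable, subst nn_integral_add, measurable, subst nn_integral_add, measurable, subst nn_integral_add, measurable)
    qed
    also have "\<dots> \<le> 4 * (?S * N + (?S * N + (?S * N + ?S * N)))"
      by (intro mult_left_mono add_mono p1 p2 p3 p4) auto
    also have "\<dots> = (4 * (1 + (1 + (1 + 1)))) * (?S * N)"
      by (simp only: distrib_right mult_1_left mult.assoc)
    also have "4 * (1 + (1 + (1 + 1))) = (16 :: ennreal)" by simp
    finally show "(\<integral>\<^sup>+w. (\<kappa> z w)\<^sup>2 \<partial>Q) \<le> 16 * (?S * N)" .
  qed
  have b2: "(\<integral>\<^sup>+z. (I2 z)\<^sup>2 \<partial>Q) \<le> ?S * N * (?a * ?b)"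
    unfolding I2_def power_mult_distrib by (rule convolution_output_estimate[OF A B \<nu> N])
  have b3: "(\<integral>\<^sup>+z. (I3 z)\<^sup>2 \<partial>Q) \<le> ?S * N * (?a * ?b)"
  proof -
    \<comment> \<open>The reflection w -> z - w exchanges A and B and puts \<nu> on the integration
      variable, which reduces \<open>I3\<close> to the case of \<open>I2\<close>.\<close>
    have "(\<integral>\<^sup>+w. A w * B (z - w) * \<nu> (z - w) \<partial>Q) = (\<integral>\<^sup>+w. B w * A (z - w) * \<nu> w \<partial>Q)" for z
      using nn_integral_Q_shift(2)[of "\<lambda>w. B w * A (z - w) * \<nu> w" z] by (simp add: mult_ac)
    then have "(\<integral>\<^sup>+z. (I3 z)\<^sup>2 \<partial>Q) \<le> ?S * N * (?b * ?a)"
      unfolding I3_def power_mult_distrib by (simp only:) (rule convolution_output_estimate[OF B A \<nu> N])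
    then show ?thesis by (simp only: mult.commute)
  qed
  have "(\<integral>\<^sup>+z. (I1 z + (I2 z + I3 z))\<^sup>2 \<partial>Q) \<le> (\<integral>\<^sup>+z. 2 * (I1 z)\<^sup>2 + (4 * (I2 z)\<^sup>2 + 4 * (I3 z)\<^sup>2) \<partial>Q)"
  proof (rule nn_integral_mono)
    fix z
    have "(I1 z + (I2 z + I3 z))\<^sup>2 \<le> 2 * (I1 z)\<^sup>2 + 2 * (I2 z + I3 z)\<^sup>2" by (rule ennreal_sq_add_le)
    also have "\<dots> \<le> 2 * (I1 z)\<^sup>2 + 2 * (2 * (I2 z)\<^sup>2 + 2 * (I3 z)\<^sup>2)"
      by (intro add_mono mult_left_mono ennreal_sq_add_le) auto
    also have "\<dots> = 2 * (I1 z)\<^sup>2 + (4 * (I2 z)\<^sup>2 + 4 * (I3 z)\<^sup>2)" by (simp add: algebra_simps)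
    finally show "(I1 z + (I2 z + I3 z))\<^sup>2 \<le> \<dots>" .
  qed
  also have "\<dots> = 2 * (\<integral>\<^sup>+z. (I1 z)\<^sup>2 \<partial>Q) + (4 * (\<integral>\<^sup>+z. (I2 z)\<^sup>2 \<partial>Q) + 4 * (\<integral>\<^sup>+z. (I3 z)\<^sup>2 \<partial>Q))"
    by (subst nn_integral_add, measurable, subst nn_integral_add, measurable, simp add: nn_integral_cmult)
  also have "\<dots> \<le> 2 * (16 * (?S * N) * (?a * ?b)) + (4 * (?S * N * (?a * ?b)) + 4 * (?S * N * (?a * ?b)))"
    by (intro add_mono mult_left_mono b1 b2 b3) auto
  also have "\<dots> = (2 * 16 + (4 + 4)) * (?S * N * (?a * ?b))"
    by (simp only: distrib_right mult.assoc)
  also have "2 * 16 + (4 + 4) = (40 :: ennreal)" by simp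
  finally show ?thesis unfolding split .
qed

section \<open>Localisation in time\<close>

lemma nn_integral_even_le:
  fixes f :: "real \<Rightarrow> ennreal"
  assumes [measurable]: "f \<in> borel_measurable borel" and even: "\<And>x. f (- x) = f x"
  shows "(\<integral>\<^sup>+x. f x \<partial>lborel) \<le> 2 * (\<integral>\<^sup>+x. f x * indicator {0..} x \<partial>lborel)"
proof -
  have "(\<integral>\<^sup>+x. f x \<partial>lborel) \<le> (\<integral>\<^sup>+x. f x * indicator {0..} x + f (0 - x) * indicator {0..} (0 - x) \<partial>lborel)"
    by (intro nn_integral_mono) (auto simp: indicator_def even)
  also have "\<dots> = (\<integral>\<^sup>+x. f x * indicator {0..} x \<partial>lborel) + (\<integral>\<^sup>+x. f (0 - x) * indicator {0..} (0 - x) \<partial>lborel)"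
    by (rule nn_integral_add) measurable
  also have "(\<integral>\<^sup>+x. f (0 - x) * indicator {0..} (0 - x) \<partial>lborel) = (\<integral>\<^sup>+x. f x * indicator {0..} x \<partial>lborel)"
    by (rule nn_integral_lborel_shift(2)[where f = "\<lambda>x. f x * indicator {0..} x" and t = 0]) measurable
  finally show ?thesis by (simp add: mult_2)
qed

definition tail_integral :: "real \<Rightarrow> ennreal" where
  "tail_integral s = (\<integral>\<^sup>+x. ennreal ((1 + \<bar>x\<bar>) powr - s) \<partial>lborel)"

lemma tail_integral_finite:
  assumes "s > 1"
  shows "tail_integral s < \<infinity>"
proof -
  have "tail_integral s \<le> 2 * (\<integral>\<^sup>+x. ennreal ((1 + \<bar>x\<bar>) powr - s) * indicator {0..} x \<partial>lborel)"
    unfolding tail_integral_def by (rule nn_integral_even_le) auto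
  also have "(\<integral>\<^sup>+x. ennreal ((1 + \<bar>x\<bar>) powr - s) * indicator {0..} x \<partial>lborel)
      = (\<integral>\<^sup>+x. ennreal ((x + 1) powr - s) * indicator {1..} (x + 1) \<partial>lborel)"
    by (intro nn_integral_cong) (auto simp: indicator_def add.commute)
  also have "\<dots> = (\<integral>\<^sup>+x. ennreal (x powr - s) * indicator {1..} x \<partial>lborel)"
    using nn_integral_lborel_shift(1)[of "\<lambda>x. ennreal (x powr - s) * indicator {1..} x" "-1"] by simp
  also have "\<dots> = ennreal (- (1 powr (- s + 1)) / (- s + 1))"
    by (rule nn_integral_has_integral_lebesgue'[OF _ has_integral_powr_to_inf]) (use assms in auto)
  finally show ?thesis by (rule order.strict_trans1) (simp add: ennreal_mult_less_top)
qed

text \<open>The counterpart of \<open>tail_integral\<close> at the origin: it measures the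
  singularity introduced by \<open>bracket_peetre\<close>.\<close>

definition head_integral :: "real \<Rightarrow> ennreal" where
  "head_integral r = (\<integral>\<^sup>+x. ennreal (\<bar>x\<bar> powr - r) * indicator {-1..1} x \<partial>lborel)"

lemma head_integral_finite:
  assumes "r < 1"
  shows "head_integral r < \<infinity>"
proof -
  have "head_integral r \<le> 2 * (\<integral>\<^sup>+x. (ennreal (\<bar>x\<bar> powr - r) * indicator {-1..1} x) * indicator {0..} x \<partial>lborel)"
    unfolding head_integral_def by (rule nn_integral_even_le) (auto simp: indicator_def)
  also have "(\<integral>\<^sup>+x. (ennreal (\<bar>x\<bar> powr - r) * indicator {-1..1} x) * indicator {0..} x \<partial>lborel)
      = (\<integral>\<^sup>+x. ennreal (x powr - r) * indicator {0..1} x \<partial>lborel)"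
    by (intro nn_integral_cong) (auto simp: indicator_def)
  also have "\<dots> = ennreal (1 powr (- r + 1) / (- r + 1))"
    by (rule nn_integral_has_integral_lebesgue'[OF _ has_integral_powr_from_0]) (use assms in auto)
  finally show ?thesis by (rule order.strict_trans1) (simp add: ennreal_mult_less_top)
qed

section \<open>A Peetre-type inequality and convolution with a kernel at scale 1/T\<close>

lemma bracket_mono: "\<bar>x\<bar> \<le> \<bar>y\<bar> \<Longrightarrow> bracket x \<le> bracket y"
  unfolding bracket_def by (intro real_sqrt_le_mono add_left_mono power_mono) auto

lemma bracket_mult_le:
  assumes "c \<ge> 1"
  shows "bracket (c * x) \<le> c * bracket x"
proof -
  have "1 + \<bar>c * x\<bar>\<^sup>2 \<le> c\<^sup>2 * (1 + \<bar>x\<bar>\<^sup>2)"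
    using assms one_le_power[OF assms, of 2] by (simp add: algebra_simps power_mult_distrib)
  then have "bracket (c * x) \<le> sqrt (c\<^sup>2 * (1 + \<bar>x\<bar>\<^sup>2))"
    unfolding bracket_def by (rule real_sqrt_le_mono)
  also have "\<dots> = c * bracket x" using assms by (simp add: bracket_def real_sqrt_mult)
  finally show ?thesis .
qed

lemma one_plus_abs_le_bracket: "1 + \<bar>x\<bar> \<le> 2 * bracket x"
  using bracket_ge_1[of x] bracket_ge_abs[of x] by linarith

lemma bracket_measurable [measurable]: "bracket \<in> borel_measurable borel"
  unfolding bracket_def by measurable

text \<open>With M = max |y0| 1 one has M \<le> c |y|, where c collects the distance from y to y0
  and, for small y, the factor 1 / |y|. The bracket at M / \<kappa> dominates both 1 / \<kappa> and
  the bracket at y0 / \<kappa>: a power \<theta> of the first gives \<kappa>^\<theta>, the remaining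
  power gives the weight at y0. The lower bound 1 in M is the source of the gain, and its price is a
  singularity at y = 0.\<close>

lemma bracket_peetre:
  fixes \<theta> r \<kappa> y y0 :: real
  assumes "0 \<le> \<theta>" "\<theta> \<le> r" "\<kappa> > 0" "y \<noteq> 0"
  shows "bracket (y / \<kappa>) powr - r
    \<le> \<kappa> powr \<theta> * bracket (y0 / \<kappa>) powr (\<theta> - r) * (1 + \<bar>y0 - y\<bar>) powr r * max 1 (\<bar>y\<bar> powr - r)"
proof -
  define M where "M = max \<bar>y0\<bar> 1"
  define d where "d = \<bar>y0 - y\<bar>"
  define c where "c = (1 + d) * max 1 (1 / \<bar>y\<bar>)"
  have c1: "1 \<le> c" unfolding c_def d_def using mult_mono[of 1 "1 + \<bar>y0 - y\<bar>" 1 "max 1 (1 / \<bar>y\<bar>)"] by simp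
  have y: "\<bar>y\<bar> > 0" using assms by simp
  have "M \<le> max 1 \<bar>y\<bar> + d" by (auto simp: M_def d_def)
  also have "\<dots> \<le> (1 + d) * max 1 \<bar>y\<bar>"
    using mult_left_mono[of 1 "max 1 \<bar>y\<bar>" d] by (simp add: distrib_right d_def)
  also have "max 1 \<bar>y\<bar> = max 1 (1 / \<bar>y\<bar>) * \<bar>y\<bar>"
    using y by (simp add: max_def field_simps)
  finally have "M \<le> c * \<bar>y\<bar>" by (simp add: c_def mult.assoc)
  then have "M / \<kappa> \<le> c * \<bar>y / \<kappa>\<bar>" using assms by (simp add: divide_right_mono)
  then have "bracket (M / \<kappa>) \<le> bracket (c * (y / \<kappa>))"
    using assms c1 by (intro bracket_mono) (simp add: M_def abs_mult)
  also have "\<dots> \<le> c * bracket (y / \<kappa>)" by (rule bracket_mult_le[OF c1])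
  finally have le: "bracket (M / \<kappa>) / c \<le> bracket (y / \<kappa>)" using c1 by (simp add: field_simps)
  have "bracket (y / \<kappa>) powr - r \<le> (bracket (M / \<kappa>) / c) powr - r"
    using le c1 assms bracket_pos[of "M / \<kappa>"] by (intro powr_mono2') auto
  also have "\<dots> = bracket (M / \<kappa>) powr - r * c powr r"
    by (simp add: powr_divide powr_minus field_simps)
  also have "bracket (M / \<kappa>) powr - r = bracket (M / \<kappa>) powr - \<theta> * bracket (M / \<kappa>) powr (\<theta> - r)"
    by (simp flip: powr_add)
  also have "bracket (M / \<kappa>) powr - \<theta> * bracket (M / \<kappa>) powr (\<theta> - r) * c powr r
     \<le> \<kappa> powr \<theta> * bracket (y0 / \<kappa>) powr (\<theta> - r) * c powr r"
  proof (intro mult_right_mono mult_mono)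
    have "1 / \<kappa> \<le> M / \<kappa>" using assms by (intro divide_right_mono) (auto simp: M_def)
    also have "\<dots> \<le> bracket (M / \<kappa>)" using bracket_ge_abs[of "M / \<kappa>"] by linarith
    finally have "bracket (M / \<kappa>) powr - \<theta> \<le> (1 / \<kappa>) powr - \<theta>"
      using assms by (intro powr_mono2') auto
    also have "\<dots> = \<kappa> powr \<theta>" using assms by (simp add: powr_divide powr_minus)
    finally show "bracket (M / \<kappa>) powr - \<theta> \<le> \<kappa> powr \<theta>" .
    have "bracket (y0 / \<kappa>) \<le> bracket (M / \<kappa>)"
      using assms by (intro bracket_mono) (auto simp: M_def abs_divide intro!: divide_right_mono)
    then show "bracket (M / \<kappa>) powr (\<theta> - r) \<le> bracket (y0 / \<kappa>) powr (\<theta> - r)"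
      using assms bracket_pos[of "y0 / \<kappa>"] by (intro powr_mono2') auto
  qed auto
  also have "c powr r = (1 + \<bar>y0 - y\<bar>) powr r * max 1 (\<bar>y\<bar> powr - r)"
  proof -
    have "max 1 (1 / \<bar>y\<bar>) powr r = max 1 (\<bar>y\<bar> powr - r)"
    proof (cases "\<bar>y\<bar> \<le> 1")
      case True
      then have "1 \<le> 1 / \<bar>y\<bar>" using y by simp
      moreover from this have "1 \<le> (1 / \<bar>y\<bar>) powr r" using assms by (intro ge_one_powr_ge_zero) auto
      ultimately show ?thesis using y by (simp add: powr_divide powr_minus max_def inverse_eq_divide)
    next
      case False
      then have "1 / \<bar>y\<bar> \<le> 1" by simp
      moreover have "1 \<le> \<bar>y\<bar> powr r" using False assms by (intro ge_one_powr_ge_zero) auto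
      then have "\<bar>y\<bar> powr - r \<le> 1" by (simp add: powr_minus inverse_le_1_iff)
      ultimately show ?thesis by (simp add: max_def)
    qed
    then show ?thesis by (simp add: c_def d_def powr_mult)
  qed
  finally show ?thesis by (simp add: mult.assoc)
qed

lemma tail_kernel_integral_le:
  assumes T: "T > 0" and s: "s > 0"
  shows "(\<integral>\<^sup>+x. ennreal (T * (1 + T * \<bar>x\<bar>) powr - s) \<partial>lborel) = tail_integral s"
proof -
  have "tail_integral s = ennreal T * (\<integral>\<^sup>+x. ennreal ((1 + \<bar>0 + T * x\<bar>) powr - s) \<partial>lborel)"
    unfolding tail_integral_def using T by (subst nn_integral_real_affine[where c = T and t = 0]) auto
  also have "\<dots> = (\<integral>\<^sup>+x. ennreal T * ennreal ((1 + \<bar>0 + T * x\<bar>) powr - s) \<partial>lborel)"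
    by (rule nn_integral_cmult[symmetric]) measurable
  also have "\<dots> = (\<integral>\<^sup>+x. ennreal (T * (1 + T * \<bar>x\<bar>) powr - s) \<partial>lborel)"
    using T by (intro nn_integral_cong) (simp add: abs_mult flip: ennreal_mult)
  finally show ?thesis ..
qed

text \<open>\<open>bracket_peetre\<close> is used in the variables T \<sigma> and T s with \<kappa>
  = T K, where the kernel has scale 1. Its growth of order r lowers the decay from 2 to 2 - r > 1,
  and its singularity of order r < 1 is integrable.\<close>

lemma weight_convolution_le:
  assumes "T > 0" "K > 0" "0 \<le> \<theta>" "\<theta> \<le> r" "r < 1"
  shows "(\<integral>\<^sup>+\<sigma>. ennreal (T * (1 + T * \<bar>s - \<sigma>\<bar>) powr - 2 * bracket (\<sigma> / K) powr - r) \<partial>lborel)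
    \<le> (tail_integral (2 - r) + head_integral r) * ennreal ((T * K) powr \<theta> * bracket (s / K) powr (\<theta> - r))"
proof -
  let ?c = "(T * K) powr \<theta> * bracket (s / K) powr (\<theta> - r)"
  have eq: "(T * \<sigma>) / (T * K) = \<sigma> / K" for \<sigma> using assms by simp
  have "(\<integral>\<^sup>+\<sigma>. ennreal (T * (1 + T * \<bar>s - \<sigma>\<bar>) powr - 2 * bracket (\<sigma> / K) powr - r) \<partial>lborel)
    \<le> (\<integral>\<^sup>+\<sigma>. ennreal ?c * (ennreal (T * (1 + T * \<bar>s - \<sigma>\<bar>) powr - (2 - r)) + ennreal T * (ennreal (\<bar>T * \<sigma>\<bar> powr - r) * indicator {-1..1} (T * \<sigma>))) \<partial>lborel)"
  proof (rule nn_integral_mono_AE)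
    show "AE \<sigma> in lborel. ennreal (T * (1 + T * \<bar>s - \<sigma>\<bar>) powr - 2 * bracket (\<sigma> / K) powr - r)
      \<le> ennreal ?c * (ennreal (T * (1 + T * \<bar>s - \<sigma>\<bar>) powr - (2 - r)) + ennreal T * (ennreal (\<bar>T * \<sigma>\<bar> powr - r) * indicator {-1..1} (T * \<sigma>)))"
      \<comment> \<open>The point \<sigma> = 0 is dropped: there \<open>bracket_peetre\<close> is
        silent, and 0 powr - r is 0 by convention.\<close>
      using AE_lborel_singleton[of 0]
    proof eventually_elim
      case (elim \<sigma>)
      define D where "D = 1 + T * \<bar>s - \<sigma>\<bar>"
      have D: "1 \<le> D" using assms by (simp add: D_def)
      have Deq: "1 + \<bar>T * s - T * \<sigma>\<bar> = D" using assms by (simp add: D_def abs_mult flip: right_diff_distrib)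
      have "bracket (\<sigma> / K) powr - r \<le> ?c * D powr r * max 1 (\<bar>T * \<sigma>\<bar> powr - r)"
        using bracket_peetre[of \<theta> r "T * K" "T * \<sigma>" "T * s"] assms elim unfolding eq Deq by simp
      also have "\<dots> \<le> ?c * D powr r * (1 + \<bar>T * \<sigma>\<bar> powr - r * indicator {-1..1} (T * \<sigma>))"
      proof (intro mult_left_mono)
        show "max 1 (\<bar>T * \<sigma>\<bar> powr - r) \<le> 1 + \<bar>T * \<sigma>\<bar> powr - r * indicator {- 1..1} (T * \<sigma>)"
        proof (cases "\<bar>T * \<sigma>\<bar> \<le> 1")
          case True
          then show ?thesis by (auto simp: indicator_def abs_le_iff)
        next
          case False
          then have "1 \<le> \<bar>T * \<sigma>\<bar> powr r" using assms by (intro ge_one_powr_ge_zero) auto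
          then have "\<bar>T * \<sigma>\<bar> powr - r \<le> 1" by (simp add: powr_minus inverse_le_1_iff)
          then show ?thesis by (simp add: indicator_def)
        qed
      qed auto
      finally have "T * D powr - 2 * bracket (\<sigma> / K) powr - r \<le> T * D powr - 2 * (?c * D powr r * (1 + \<bar>T * \<sigma>\<bar> powr - r * indicator {-1..1} (T * \<sigma>)))"
        using assms by (intro mult_left_mono) auto
      also have "\<dots> = ?c * (T * (D powr - 2 * D powr r) + T * (D powr - 2 * D powr r) * (\<bar>T * \<sigma>\<bar> powr - r * indicator {-1..1} (T * \<sigma>)))"
        by (simp add: algebra_simps)
      also have "\<dots> = ?c * (T * D powr - (2 - r) + T * D powr - (2 - r) * (\<bar>T * \<sigma>\<bar> powr - r * indicator {-1..1} (T * \<sigma>)))"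
        by (simp flip: powr_add)
      also have "\<dots> \<le> ?c * (T * D powr - (2 - r) + T * 1 * (\<bar>T * \<sigma>\<bar> powr - r * indicator {-1..1} (T * \<sigma>)))"
      proof (intro mult_left_mono add_left_mono mult_right_mono)
        show "D powr - (2 - r) \<le> 1" using D assms powr_mono[of "- (2 - r)" 0 D] by simp
      qed (use assms in auto)
      finally have "T * D powr - 2 * bracket (\<sigma> / K) powr - r \<le> ?c * (T * D powr - (2 - r) + T * (\<bar>T * \<sigma>\<bar> powr - r * indicator {-1..1} (T * \<sigma>)))"
        by simp
      then have "ennreal (T * D powr - 2 * bracket (\<sigma> / K) powr - r) \<le> ennreal (?c * (T * D powr - (2 - r) + T * (\<bar>T * \<sigma>\<bar> powr - r * indicator {-1..1} (T * \<sigma>))))"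
        by (rule ennreal_leI)
      also have "\<dots> = ennreal ?c * (ennreal (T * D powr - (2 - r)) + ennreal T * (ennreal (\<bar>T * \<sigma>\<bar> powr - r) * indicator {-1..1} (T * \<sigma>)))"
        using assms by (simp add: ennreal_mult' ennreal_mult'' ennreal_indicator flip: ennreal_plus) 
           (simp add: ennreal_mult ennreal_indicator ennreal_plus)
      finally show ?case by (simp add: D_def)
    qed
  qed
  also have "\<dots> = ennreal ?c * ((\<integral>\<^sup>+\<sigma>. ennreal (T * (1 + T * \<bar>s - \<sigma>\<bar>) powr - (2 - r)) \<partial>lborel) + ennreal T * (\<integral>\<^sup>+\<sigma>. ennreal (\<bar>T * \<sigma>\<bar> powr - r) * indicator {-1..1} (T * \<sigma>) \<partial>lborel))"
    by (subst nn_integral_cmult, measurable, subst nn_integral_add, measurable, subst nn_integral_cmult, measurable)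
  also have "(\<integral>\<^sup>+\<sigma>. ennreal (T * (1 + T * \<bar>s - \<sigma>\<bar>) powr - (2 - r)) \<partial>lborel) = tail_integral (2 - r)"
    using tail_kernel_integral_le[OF assms(1), of "2 - r"] assms
      nn_integral_lborel_shift(2)[of "\<lambda>x. ennreal (T * (1 + T * \<bar>x\<bar>) powr - (2 - r))" s] by simp
  also have "ennreal T * (\<integral>\<^sup>+\<sigma>. ennreal (\<bar>T * \<sigma>\<bar> powr - r) * indicator {-1..1} (T * \<sigma>) \<partial>lborel) = head_integral r"
    unfolding head_integral_def using assms
    by (subst nn_integral_real_affine[where c = T and t = 0, of "\<lambda>x. ennreal (\<bar>x\<bar> powr - r) * indicator {-1..1} x"]) auto
  finally show ?thesis by (simp add: mult.commute)
qed

text \<open>Cauchy-Schwarz with the kernel as a finite measure brings the square inside, Fubini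
  exchanges the two frequencies, and the kernel then acts on the weight alone. Raising the weight of
  h by \<theta> buys the factor (T K)^\<theta>.\<close>

lemma time_localisation:
  fixes h :: "real \<Rightarrow> ennreal" and ker :: "real \<Rightarrow> real"
  assumes "T > 0" "K > 0" "0 \<le> \<theta>" "\<theta> \<le> r" "r < 1" "c \<ge> 0"
    and [measurable]: "h \<in> borel_measurable borel" "ker \<in> borel_measurable borel"
    and ker: "\<And>y. 0 \<le> ker y" "\<And>y. ker y \<le> c * (T * (1 + T * \<bar>y\<bar>) powr - 2)"
  shows "(\<integral>\<^sup>+\<tau>. ennreal (bracket ((\<tau> - L) / K) powr - r) * (\<integral>\<^sup>+s. ennreal (ker (\<tau> - s)) * h s \<partial>lborel)\<^sup>2 \<partial>lborel)
    \<le> ennreal (c\<^sup>2 * (T * K) powr \<theta>) * (tail_integral 2 * (tail_integral (2 - r) + head_integral r))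
      * (\<integral>\<^sup>+s. ennreal (bracket ((s - L) / K) powr (\<theta> - r)) * (h s)\<^sup>2 \<partial>lborel)"
proof -
  define \<rho> where "\<rho> y = T * (1 + T * \<bar>y\<bar>) powr - 2" for y
  have \<rho>0: "0 \<le> \<rho> y" for y using assms by (simp add: \<rho>_def)
  have [measurable]: "\<rho> \<in> borel_measurable borel" unfolding \<rho>_def by measurable
  have rho_int: "(\<integral>\<^sup>+s. ennreal (\<rho> (\<tau> - s)) \<partial>lborel) = tail_integral 2" for \<tau>
    using tail_kernel_integral_le[OF assms(1), of 2] nn_integral_lborel_shift(2)[of "\<lambda>x. ennreal (\<rho> x)" \<tau>]
    by (simp add: \<rho>_def)
  let ?C = "tail_integral (2 - r) + head_integral r"
  have "(\<integral>\<^sup>+\<tau>. ennreal (bracket ((\<tau> - L) / K) powr - r) * (\<integral>\<^sup>+s. ennreal (ker (\<tau> - s)) * h s \<partial>lborel)\<^sup>2 \<partial>lborel)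
    \<le> (\<integral>\<^sup>+\<tau>. \<integral>\<^sup>+s. ennreal (c\<^sup>2) * tail_integral 2 * (ennreal (\<rho> (\<tau> - s) * bracket ((\<tau> - L) / K) powr - r) * (h s)\<^sup>2) \<partial>lborel \<partial>lborel)"
  proof (rule nn_integral_mono)
    fix \<tau>
    have "(\<integral>\<^sup>+s. ennreal (ker (\<tau> - s)) * h s \<partial>lborel) \<le> (\<integral>\<^sup>+s. ennreal c * (ennreal (\<rho> (\<tau> - s)) * h s) \<partial>lborel)"
    proof (rule nn_integral_mono)
      fix s
      have "ennreal (ker (\<tau> - s)) \<le> ennreal c * ennreal (\<rho> (\<tau> - s))"
        using ker(2)[of "\<tau> - s"] assms \<rho>0 by (simp only: \<rho>_def ennreal_mult[symmetric]) (rule ennreal_leI)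
      then show "ennreal (ker (\<tau> - s)) * h s \<le> ennreal c * (ennreal (\<rho> (\<tau> - s)) * h s)"
        unfolding mult.assoc[symmetric] by (rule mult_right_mono) simp
    qed
    also have "\<dots> = ennreal c * (\<integral>\<^sup>+s. ennreal (\<rho> (\<tau> - s)) * h s \<partial>lborel)"
      by (rule nn_integral_cmult) measurable
    finally have "(\<integral>\<^sup>+s. ennreal (ker (\<tau> - s)) * h s \<partial>lborel)\<^sup>2 \<le> (ennreal c * (\<integral>\<^sup>+s. ennreal (\<rho> (\<tau> - s)) * h s \<partial>lborel))\<^sup>2"
      by (intro power_mono) auto
    \<comment> \<open>The kernel is split into two square roots: one yields its mass after
      Cauchy-Schwarz, the other stays with h.\<close>
    also have "\<dots> = ennreal (c\<^sup>2) * (\<integral>\<^sup>+s. ennreal (sqrt (\<rho> (\<tau> - s))) * (ennreal (sqrt (\<rho> (\<tau> - s))) * h s) \<partial>lborel)\<^sup>2"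
      using assms \<rho>0 by (simp add: power_mult_distrib ennreal_power mult.assoc[symmetric] flip: ennreal_mult)
    also have "\<dots> \<le> ennreal (c\<^sup>2) * ((\<integral>\<^sup>+s. (ennreal (sqrt (\<rho> (\<tau> - s))))\<^sup>2 \<partial>lborel) * (\<integral>\<^sup>+s. (ennreal (sqrt (\<rho> (\<tau> - s))) * h s)\<^sup>2 \<partial>lborel))"
      by (intro mult_left_mono Cauchy_Schwarz_nn_integral) auto
    also have "\<dots> = ennreal (c\<^sup>2) * (tail_integral 2 * (\<integral>\<^sup>+s. ennreal (\<rho> (\<tau> - s)) * (h s)\<^sup>2 \<partial>lborel))"
      using \<rho>0 by (simp add: ennreal_power power_mult_distrib rho_int)
    finally have "ennreal (bracket ((\<tau> - L) / K) powr - r) * (\<integral>\<^sup>+s. ennreal (ker (\<tau> - s)) * h s \<partial>lborel)\<^sup>2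
       \<le> ennreal (bracket ((\<tau> - L) / K) powr - r) * (ennreal (c\<^sup>2) * (tail_integral 2 * (\<integral>\<^sup>+s. ennreal (\<rho> (\<tau> - s)) * (h s)\<^sup>2 \<partial>lborel)))"
      by (intro mult_left_mono) auto
    also have "\<dots> = ennreal (c\<^sup>2) * tail_integral 2 * (ennreal (bracket ((\<tau> - L) / K) powr - r) * (\<integral>\<^sup>+s. ennreal (\<rho> (\<tau> - s)) * (h s)\<^sup>2 \<partial>lborel))"
      by (simp add: mult_ac)
    also have "\<dots> = ennreal (c\<^sup>2) * tail_integral 2 * (\<integral>\<^sup>+s. ennreal (bracket ((\<tau> - L) / K) powr - r) * (ennreal (\<rho> (\<tau> - s)) * (h s)\<^sup>2) \<partial>lborel)"
      by (subst nn_integral_cmult) auto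
    also have "\<dots> = (\<integral>\<^sup>+s. ennreal (c\<^sup>2) * tail_integral 2 * (ennreal (bracket ((\<tau> - L) / K) powr - r) * (ennreal (\<rho> (\<tau> - s)) * (h s)\<^sup>2)) \<partial>lborel)"
      by (subst nn_integral_cmult) auto
    finally show "ennreal (bracket ((\<tau> - L) / K) powr - r) * (\<integral>\<^sup>+s. ennreal (ker (\<tau> - s)) * h s \<partial>lborel)\<^sup>2
      \<le> (\<integral>\<^sup>+s. ennreal (c\<^sup>2) * tail_integral 2 * (ennreal (\<rho> (\<tau> - s) * bracket ((\<tau> - L) / K) powr - r) * (h s)\<^sup>2) \<partial>lborel)"
      using \<rho>0 by (simp add: ennreal_mult mult_ac)
  qed
  also have "\<dots> = (\<integral>\<^sup>+s. \<integral>\<^sup>+\<tau>. ennreal (c\<^sup>2) * tail_integral 2 * (ennreal (\<rho> (\<tau> - s) * bracket ((\<tau> - L) / K) powr - r) * (h s)\<^sup>2) \<partial>lborel \<partial>lborel)"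
    by (rule lborel_pair.Fubini') measurable
  also have "\<dots> \<le> (\<integral>\<^sup>+s. ennreal (c\<^sup>2) * tail_integral 2 * (?C * ennreal ((T * K) powr \<theta> * bracket ((s - L) / K) powr (\<theta> - r)) * (h s)\<^sup>2) \<partial>lborel)"
  proof (rule nn_integral_mono)
    fix s
    have "(\<integral>\<^sup>+\<tau>. ennreal (c\<^sup>2) * tail_integral 2 * (ennreal (\<rho> (\<tau> - s) * bracket ((\<tau> - L) / K) powr - r) * (h s)\<^sup>2) \<partial>lborel)
       = ennreal (c\<^sup>2) * tail_integral 2 * ((\<integral>\<^sup>+\<tau>. ennreal (\<rho> (\<tau> - s) * bracket ((\<tau> - L) / K) powr - r) \<partial>lborel) * (h s)\<^sup>2)"
      by (subst nn_integral_cmult, measurable, subst nn_integral_multc, measurable)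
    also have "(\<integral>\<^sup>+\<tau>. ennreal (\<rho> (\<tau> - s) * bracket ((\<tau> - L) / K) powr - r) \<partial>lborel) = (\<integral>\<^sup>+\<sigma>. ennreal (T * (1 + T * \<bar>(s - L) - \<sigma>\<bar>) powr - 2 * bracket (\<sigma> / K) powr - r) \<partial>lborel)"
      using nn_integral_lborel_shift(1)[of "\<lambda>\<sigma>. ennreal (T * (1 + T * \<bar>(s - L) - \<sigma>\<bar>) powr - 2 * bracket (\<sigma> / K) powr - r)" L]
      by (simp add: \<rho>_def abs_minus_commute algebra_simps)
    also have "\<dots> \<le> ?C * ennreal ((T * K) powr \<theta> * bracket ((s - L) / K) powr (\<theta> - r))"
      by (rule weight_convolution_le) (use assms in auto)
    finally show "(\<integral>\<^sup>+\<tau>. ennreal (c\<^sup>2) * tail_integral 2 * (ennreal (\<rho> (\<tau> - s) * bracket ((\<tau> - L) / K) powr - r) * (h s)\<^sup>2) \<partial>lborel)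
      \<le> ennreal (c\<^sup>2) * tail_integral 2 * (?C * ennreal ((T * K) powr \<theta> * bracket ((s - L) / K) powr (\<theta> - r)) * (h s)\<^sup>2)"
      by (simp add: mult_left_mono mult_right_mono)
  qed
  also have "\<dots> = (\<integral>\<^sup>+s. (ennreal (c\<^sup>2 * (T * K) powr \<theta>) * (tail_integral 2 * ?C)) * (ennreal (bracket ((s - L) / K) powr (\<theta> - r)) * (h s)\<^sup>2) \<partial>lborel)"
    by (intro nn_integral_cong) (simp add: ennreal_mult mult_ac)
  also have "\<dots> = (ennreal (c\<^sup>2 * (T * K) powr \<theta>) * (tail_integral 2 * ?C)) * (\<integral>\<^sup>+s. ennreal (bracket ((s - L) / K) powr (\<theta> - r)) * (h s)\<^sup>2 \<partial>lborel)"
    by (rule nn_integral_cmult) measurable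
  finally show ?thesis .
qed

context exponents
begin

text \<open>The square of \<open>W\<close> is K times the bracket to the power 1 + \<theta>, and K
  is the Jacobian of the rescaling inside the bracket. The frequency power \<beta>/2 in
  \<open>W\<close> is thus exactly what makes the bound uniform in k. The 4 comes from 1 + |y| \<le>
  2 <y>, raised to a power at most 2.\<close>

lemma integral_inverse_W_sq_le:
  "(\<integral>\<^sup>+\<tau>. (ennreal (1 / W k \<tau>))\<^sup>2 \<partial>lborel) \<le> 4 * tail_integral (1 + \<theta>)"
proof -
  define s where "s = 1 + \<theta>"
  have s: "1 < s" "s \<le> 2" using \<theta> by (auto simp: s_def)
  have K0: "K k > 0" by (rule K_pos)
  have le: "(ennreal (1 / W k \<tau>))\<^sup>2 \<le> 4 * ennreal (1 / K k * (1 + 1 / K k * \<bar>\<tau> - disp \<alpha> k\<bar>) powr - s)" for \<tau>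
  proof -
    define B where "B = bracket ((\<tau> - disp \<alpha> k) / K k)"
    have B: "1 + 1 / K k * \<bar>\<tau> - disp \<alpha> k\<bar> \<le> 2 * B"
      using one_plus_abs_le_bracket[of "(\<tau> - disp \<alpha> k) / K k"] K0 by (simp add: B_def abs_divide)
    have B0: "B > 0" by (simp add: B_def bracket_pos)
    have W2: "(W k \<tau>)\<^sup>2 = K k * B powr s"
    proof -
      have "bracket (of_int k) powr (\<beta> / 2) * bracket (of_int k) powr (\<beta> / 2) = K k" by (simp flip: powr_add)
      moreover have "B powr b * B powr b = B powr s" by (simp add: s_def flip: powr_add)
      moreover have "(W k \<tau>)\<^sup>2 = (bracket (of_int k) powr (\<beta> / 2) * bracket (of_int k) powr (\<beta> / 2)) * (B powr b * B powr b)"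
        unfolding W_eq B_def[symmetric] power2_eq_square by (simp only: mult_ac)
      ultimately show ?thesis by simp
    qed
    have "(1 / W k \<tau>)\<^sup>2 = 1 / K k * B powr - s"
      unfolding power_divide W2 by (simp add: powr_minus inverse_eq_divide)
    also have "\<dots> \<le> 1 / K k * (4 * (1 + 1 / K k * \<bar>\<tau> - disp \<alpha> k\<bar>) powr - s)"
    proof (rule mult_left_mono)
      have "(2 * B) powr - s \<le> (1 + 1 / K k * \<bar>\<tau> - disp \<alpha> k\<bar>) powr - s"
        using B K0 s by (intro powr_mono2') (auto intro!: add_pos_nonneg)
      then have "2 powr s * (2 * B) powr - s \<le> 2 powr s * (1 + 1 / K k * \<bar>\<tau> - disp \<alpha> k\<bar>) powr - s"
        by (rule mult_left_mono) simp
      moreover have "2 powr s * (2 * B) powr - s = B powr - s"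
        unfolding powr_mult mult.assoc[symmetric] powr_add[symmetric] by simp
      ultimately have "B powr - s \<le> 2 powr s * (1 + 1 / K k * \<bar>\<tau> - disp \<alpha> k\<bar>) powr - s" by simp
      also have "\<dots> \<le> 2 powr 2 * (1 + 1 / K k * \<bar>\<tau> - disp \<alpha> k\<bar>) powr - s"
        using s by (intro mult_right_mono powr_mono) auto
      finally show "B powr - s \<le> 4 * (1 + 1 / K k * \<bar>\<tau> - disp \<alpha> k\<bar>) powr - s" by simp
    qed (use K0 in auto)
    finally have "(1 / W k \<tau>)\<^sup>2 \<le> 4 * (1 / K k * (1 + 1 / K k * \<bar>\<tau> - disp \<alpha> k\<bar>) powr - s)" by simp
    then have "ennreal ((1 / W k \<tau>)\<^sup>2) \<le> ennreal (4 * (1 / K k * (1 + 1 / K k * \<bar>\<tau> - disp \<alpha> k\<bar>) powr - s))"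
      by (rule ennreal_leI)
    also have "\<dots> = 4 * ennreal (1 / K k * (1 + 1 / K k * \<bar>\<tau> - disp \<alpha> k\<bar>) powr - s)"
      by (subst ennreal_mult') auto
    finally show ?thesis using W_pos[of k \<tau>] by (simp add: ennreal_power)
  qed
  have "(\<integral>\<^sup>+\<tau>. (ennreal (1 / W k \<tau>))\<^sup>2 \<partial>lborel) \<le> (\<integral>\<^sup>+\<tau>. 4 * ennreal (1 / K k * (1 + 1 / K k * \<bar>\<tau> - disp \<alpha> k\<bar>) powr - s) \<partial>lborel)"
    by (intro nn_integral_mono le)
  also have "\<dots> = 4 * (\<integral>\<^sup>+\<tau>. ennreal (1 / K k * (1 + 1 / K k * \<bar>\<tau> - disp \<alpha> k\<bar>) powr - s) \<partial>lborel)"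
    by (rule nn_integral_cmult) measurable
  also have "(\<integral>\<^sup>+\<tau>. ennreal (1 / K k * (1 + 1 / K k * \<bar>\<tau> - disp \<alpha> k\<bar>) powr - s) \<partial>lborel) = tail_integral s"
    using nn_integral_lborel_shift(1)[of "\<lambda>x. ennreal (1 / K k * (1 + 1 / K k * \<bar>x\<bar>) powr - s)" "disp \<alpha> k"]
      tail_kernel_integral_le[of "1 / K k" s] K0 s by simp
  finally show ?thesis by (simp add: s_def)
qed

lemma sum_q_sq_finite: "(\<integral>\<^sup>+k. (ennreal (q k))\<^sup>2 \<partial>cint) < \<infinity>"
proof -
  define s where "s = - 1 - 2 * \<delta>"
  have q2: "(ennreal (q k))\<^sup>2 = ennreal (\<bar>of_int k\<bar> powr s)" for k
  proof -
    have "(q k)\<^sup>2 = \<bar>of_int k\<bar> powr s" by (simp add: s_def power2_eq_square flip: powr_add)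
    then show ?thesis by (simp add: ennreal_power)
  qed
  have fin: "(\<integral>\<^sup>+n. ennreal (of_nat n powr s) \<partial>count_space (UNIV :: nat set)) < \<infinity>"
  proof -
    have "summable (\<lambda>n. of_nat n powr s :: real)" using \<delta> by (simp add: summable_real_powr_iff s_def)
    then have "(\<Sum>n. ennreal (of_nat n powr s)) = ennreal (\<Sum>n. of_nat n powr s)"
      by (intro suminf_ennreal2) auto
    then show ?thesis by (simp add: nn_integral_count_space_nat)
  qed
  \<comment> \<open>The integers are covered by two copies of the naturals. They overlap at 0, where
    the summand is 0 powr s = 0.\<close>
  have "(\<integral>\<^sup>+k. ennreal (\<bar>of_int k\<bar> powr s) \<partial>cint) \<le> (\<integral>\<^sup>+k. ennreal (\<bar>of_int k\<bar> powr s) * indicator (range int) k + ennreal (\<bar>of_int k\<bar> powr s) * indicator (range (\<lambda>n. - int n)) k \<partial>cint)"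
  proof (rule nn_integral_mono)
    fix k :: int
    have "k \<in> range int \<or> k \<in> range (\<lambda>n. - int n)"
      by (metis rangeI int_cases2)
    then show "ennreal (\<bar>of_int k\<bar> powr s) \<le> ennreal (\<bar>of_int k\<bar> powr s) * indicator (range int) k + ennreal (\<bar>of_int k\<bar> powr s) * indicator (range (\<lambda>n. - int n)) k"
      by (auto simp: indicator_def)
  qed
  also have "\<dots> = (\<integral>\<^sup>+k. ennreal (\<bar>of_int k\<bar> powr s) \<partial>count_space (range int)) + (\<integral>\<^sup>+k. ennreal (\<bar>of_int k\<bar> powr s) \<partial>count_space (range (\<lambda>n. - int n)))"
    by (subst nn_integral_add) (auto simp: nn_integral_count_space_indicator)
  also have "(\<integral>\<^sup>+k. ennreal (\<bar>of_int k\<bar> powr s) \<partial>count_space (range int)) = (\<integral>\<^sup>+n. ennreal (of_nat n powr s) \<partial>count_space (UNIV :: nat set))"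
    using nn_integral_bij_count_space[OF inj_on_imp_bij_betw[of int UNIV], of "\<lambda>k. ennreal (\<bar>of_int k\<bar> powr s)"] by simp
  also have "(\<integral>\<^sup>+k. ennreal (\<bar>of_int k\<bar> powr s) \<partial>count_space (range (\<lambda>n. - int n))) = (\<integral>\<^sup>+n. ennreal (of_nat n powr s) \<partial>count_space (UNIV :: nat set))"
    using nn_integral_bij_count_space[OF inj_on_imp_bij_betw[of "\<lambda>n. - int n" UNIV], of "\<lambda>k. ennreal (\<bar>of_int k\<bar> powr s)"]
    by (simp add: inj_on_def)
  finally show ?thesis unfolding q2 using fin by (simp add: order.strict_trans1)
qed

end

section \<open>The trapezoidal cutoff\<close>

definition trapezoid :: "real \<Rightarrow> complex" where
  "trapezoid t = of_real (max 0 (min 1 (t + 1) - max (- 1) (t - 2)) / 2)"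

lemma trapezoid_eq_1: "0 \<le> t \<Longrightarrow> t \<le> 1 \<Longrightarrow> trapezoid t = 1"
  by (simp add: trapezoid_def min_def max_def)

lemma trapezoid_continuous: "continuous_on UNIV trapezoid"
  unfolding trapezoid_def by (intro continuous_intros) auto

lemma trapezoid_bounds: "norm (trapezoid t) \<le> 1" "t \<notin> {-2..3} \<Longrightarrow> trapezoid t = 0"
  by (auto simp: trapezoid_def min_def max_def)

text \<open>Half a convolution of two interval indicators: the overlap has full length 2 exactly for
  t in [0,1]. As a convolution it has a product of two transforms of order 1 / |y| as its
  transform.\<close>

lemma trapezoid_eq_integral:
  "trapezoid t = (LINT s|lborel. indicator {-1..1} s * indicator {-1..2} (t - s)) / 2"
proof -
  have "(LINT s|lborel. indicator {-1..1} s * indicator {-1..2} (t - s) :: complex) = (LINT s|lborel. indicator {max (- 1) (t - 2)..min 1 (t + 1)} s)"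
    by (intro Bochner_Integration.integral_cong refl) (auto simp: indicator_def)
  also have "\<dots> = of_real (measure lborel {max (- 1) (t - 2)..min 1 (t + 1)})"
  proof -
    have "(LINT s|lborel. indicator A s :: complex) = (LINT s|lborel. complex_of_real (indicator A s))" for A :: "real set"
      by (simp add: of_real_indicator)
    also have "\<dots> A = of_real (measure lborel A)" for A
      unfolding integral_complex_of_real by simp
    finally show ?thesis .
  qed
  also have "measure lborel {max (- 1) (t - 2)..min 1 (t + 1)} = max 0 (min 1 (t + 1) - max (- 1) (t - 2))"
  proof -
    have "measure lborel {l..u} = max 0 (u - l)" for l u :: real
      by (cases "l \<le> u") (simp_all add: max_def)
    then show ?thesis .
  qed
  finally show ?thesis by (simp add: trapezoid_def)
qed

text \<open>For |y| \<le> 1 the length bounds the integral, otherwise the explicit primitive gives 2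
  / |y|. Lengths up to 3 cover both intervals behind the trapezoid.\<close>

lemma norm_ft_interval_le:
  assumes "a \<le> b" "b - a \<le> 3"
  shows "norm (LINT s|lborel. indicator {a..b} s * cis (- (s * y))) \<le> 6 / (1 + \<bar>y\<bar>)"
proof (cases "\<bar>y\<bar> \<le> 1")
  case True
  have "norm (LINT s|lborel. indicator {a..b} s * cis (- (s * y))) \<le> (LINT s|lborel. norm (indicator {a..b} s * cis (- (s * y))))"
    by (rule integral_norm_bound)
  also have "\<dots> = (LINT s|lborel. indicator {a..b} s)"
    by (intro Bochner_Integration.integral_cong) (auto simp: norm_mult indicator_def)
  also have "\<dots> = b - a" using assms by simp
  also have "\<dots> \<le> 6 / (1 + \<bar>y\<bar>)" using assms(2) True by (simp add: pos_le_divide_eq) (use mult_mono[of "b - a" 3 "1 + \<bar>y\<bar>" 2] in simp)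
  finally show ?thesis .
next
  case False
  then have y: "y \<noteq> 0" by auto
  have "(LINT s|lborel. indicator {a..b} s *\<^sub>R cis (- (s * y))) = cis (- (b * y)) / (- \<i> * of_real y) - cis (- (a * y)) / (- \<i> * of_real y)"
  proof (rule integral_FTC_Icc[OF assms(1)])
    fix s :: real
    have "((\<lambda>s. exp ((- \<i> * of_real y) * of_real s) / (- \<i> * of_real y)) has_vector_derivative (- \<i> * of_real y) * exp ((- \<i> * of_real y) * of_real s) / (- \<i> * of_real y)) (at s within {a..b})"
      by (rule has_vector_derivative_real_field) (auto intro!: derivative_eq_intros)
    then show "((\<lambda>s. cis (- (s * y)) / (- \<i> * of_real y)) has_vector_derivative cis (- (s * y))) (at s within {a..b})"
      using y by (simp add: cis_conv_exp mult_ac)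
  qed (auto intro!: continuous_intros)
  then have eq: "(LINT s|lborel. indicator {a..b} s * cis (- (s * y))) = cis (- (b * y)) / (- \<i> * of_real y) - cis (- (a * y)) / (- \<i> * of_real y)"
    by (simp add: scaleR_conv_of_real of_real_indicator)
  have "norm (LINT s|lborel. indicator {a..b} s * cis (- (s * y))) \<le> norm (cis (- (b * y)) / (- \<i> * of_real y)) + norm (cis (- (a * y)) / (- \<i> * of_real y))"
    unfolding eq by (rule norm_triangle_ineq4)
  also have "\<dots> = 2 / \<bar>y\<bar>" by (simp add: norm_divide norm_mult)
  also have "\<dots> \<le> 6 / (1 + \<bar>y\<bar>)" using False by (simp add: field_simps)
  finally show ?thesis .
qed

text \<open>By Fubini the transform factorises; 6 * 6 from the two intervals, halved by the
  normalisation of \<open>trapezoid\<close>, gives 18.\<close>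

lemma norm_ft_trapezoid_le: "norm (time_ft trapezoid y) \<le> 18 * (1 + \<bar>y\<bar>) powr - 2"
proof -
  let ?f = "\<lambda>s::real. indicator {-1..1} s :: complex" and ?g = "\<lambda>s::real. indicator {-1..2} s :: complex"
  let ?h = "\<lambda>s t. ?f s * ?g (t - s) * cis (- (t * y))"
  have sh: "(LINT t|lborel. G (t - s)) = (LINT t|lborel. G t)" for G :: "real \<Rightarrow> complex" and s
    using lborel_integral_real_affine[of 1 G "- s"] by simp
  have gi: "integrable lborel (\<lambda>t. ?g (t - s))" for s
  proof -
    have "integrable lborel (\<lambda>t::real. of_real (indicator {-1..2} t) :: complex)"
      by (rule integrable_of_real) (simp add: integrable_indicator_iff emeasure_lborel_Icc_eq)
    then have "integrable lborel ?g" by (simp only: of_real_indicator)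
    from lborel_integrable_real_affine[OF this, of 1 "- s"] show ?thesis by simp
  qed
  have int: "integrable (lborel \<Otimes>\<^sub>M lborel) (case_prod ?h)"
  proof (rule lborel_pair.Fubini_integrable)
    have "(LINT t|lborel. norm (?h s t)) = indicator {-1..1} s * (LINT t|lborel. norm (?g (t - s)))" for s
      by (simp add: norm_mult) (simp add: indicator_def)
    moreover have "(LINT t|lborel. norm (?g (t - s))) = (LINT t|lborel. norm (?g t))" for s
      using lborel_integral_real_affine[of 1 "\<lambda>t. norm (?g t)" "- s"] by simp
    ultimately show "integrable lborel (\<lambda>s. LINT t|lborel. norm (case (s, t) of (s, t) \<Rightarrow> ?h s t))"
      by (simp add: integrable_indicator_iff emeasure_lborel_Icc_eq)
    have "integrable lborel (\<lambda>t. ?f s * (?g (t - s) * cis (- (t * y))))" for s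
      by (intro integrable_mult_right integrable_mult_cis gi) measurable
    then show "AE s in lborel. integrable lborel (\<lambda>t. case (s, t) of (s, t) \<Rightarrow> ?h s t)"
      by (simp add: mult.assoc)
  qed measurable
  have "2 * time_ft trapezoid y = (LINT t|lborel. LINT s|lborel. ?h s t)"
    unfolding time_ft_cis trapezoid_eq_integral by simp
  also have "\<dots> = (LINT s|lborel. LINT t|lborel. ?h s t)"
    by (rule lborel_pair.Fubini_integral[OF int])
  also have "\<dots> = (LINT s|lborel. (?f s * cis (- (s * y))) * (LINT t|lborel. ?g t * cis (- (t * y))))"
  proof (rule Bochner_Integration.integral_cong[OF refl])
    fix s
    have "(LINT t|lborel. ?h s t) = (LINT t|lborel. (?f s * cis (- (s * y))) * (?g (t - s) * cis (- ((t - s) * y))))"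
      by (intro Bochner_Integration.integral_cong refl) (simp add: cis_mult algebra_simps)
    also have "\<dots> = (?f s * cis (- (s * y))) * (LINT t|lborel. ?g (t - s) * cis (- ((t - s) * y)))" by simp
    also have "(LINT t|lborel. ?g (t - s) * cis (- ((t - s) * y))) = (LINT t|lborel. ?g t * cis (- (t * y)))"
      by (rule sh[of "\<lambda>t. ?g t * cis (- (t * y))"])
    finally show "(LINT t|lborel. ?h s t) = (?f s * cis (- (s * y))) * (LINT t|lborel. ?g t * cis (- (t * y)))" .
  qed
  also have "\<dots> = (LINT s|lborel. ?f s * cis (- (s * y))) * (LINT t|lborel. ?g t * cis (- (t * y)))"
    by simp
  finally have eq: "2 * time_ft trapezoid y = (LINT s|lborel. ?f s * cis (- (s * y))) * (LINT t|lborel. ?g t * cis (- (t * y)))" .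
  have "2 * norm (time_ft trapezoid y) = norm (2 * time_ft trapezoid y)" by (simp add: norm_mult)
  also have "\<dots> = norm (LINT s|lborel. ?f s * cis (- (s * y))) * norm (LINT t|lborel. ?g t * cis (- (t * y)))"
    unfolding eq by (rule norm_mult)
  also have "\<dots> \<le> (6 / (1 + \<bar>y\<bar>)) * (6 / (1 + \<bar>y\<bar>))"
    by (intro mult_mono norm_ft_interval_le) auto
  also have "\<dots> = 36 * (1 + \<bar>y\<bar>) powr - 2"
    by (simp add: powr_minus powr_numeral power2_eq_square divide_simps)
  finally show ?thesis by simp
qed

definition cutoff :: "real \<Rightarrow> real \<Rightarrow> complex" where
  "cutoff T t = trapezoid (t / T)"

lemma ft_cutoff:
  assumes "T > 0"
  shows "time_ft (cutoff T) y = of_real T * time_ft trapezoid (T * y)"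
  unfolding time_ft_cis cutoff_def
  using lborel_integral_real_affine[of T "\<lambda>t. trapezoid (t / T) * cis (- (t * y))" 0] assms
  by (simp add: scaleR_conv_of_real mult_ac)

lemma norm_ft_cutoff_le:
  assumes "T > 0"
  shows "norm (time_ft (cutoff T) y) \<le> 18 * (T * (1 + T * \<bar>y\<bar>) powr - 2)"
  using mult_left_mono[OF norm_ft_trapezoid_le[of "T * y"], of T] assms
  by (simp add: ft_cutoff norm_mult abs_mult)

lemma trapezoid_measurable [measurable]: "trapezoid \<in> borel_measurable borel"
  by (intro borel_measurable_continuous_onI trapezoid_continuous)

lemma trapezoid_integrable: "integrable lborel trapezoid"
proof -
  have "integrable lborel (\<lambda>t::real. indicator {-2..3} t :: real)"
    by (simp add: integrable_indicator_iff emeasure_lborel_Icc_eq)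
  then show ?thesis
    by (rule Bochner_Integration.integrable_bound) (use trapezoid_bounds in \<open>auto simp: indicator_def\<close>)
qed

lemma cutoff_facts:
  assumes T: "T > 0"
  shows "continuous_on UNIV (cutoff T)" "bounded (range (cutoff T))" "integrable lborel (cutoff T)"
    "integrable lborel (time_ft (cutoff T))"
proof -
  show "continuous_on UNIV (cutoff T)"
    unfolding cutoff_def by (rule continuous_on_compose2[OF trapezoid_continuous]) (use T in \<open>auto intro!: continuous_intros\<close>)
  show "bounded (range (cutoff T))"
    unfolding bounded_iff cutoff_def using trapezoid_bounds(1) by blast
  have *: "cutoff T \<in> borel_measurable borel" unfolding cutoff_def by measurable
  show "integrable lborel (cutoff T)"
    unfolding cutoff_def using lborel_integrable_real_affine[OF trapezoid_integrable, of "1 / T" 0] T by simp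
  show "integrable lborel (time_ft (cutoff T))"
  proof (rule integrableI_bounded)
    show "time_ft (cutoff T) \<in> borel_measurable lborel" using time_ft_measurable[OF *] by simp
    have "(\<integral>\<^sup>+y. ennreal (norm (time_ft (cutoff T) y)) \<partial>lborel) \<le> (\<integral>\<^sup>+y. 18 * ennreal (T * (1 + T * \<bar>y\<bar>) powr - 2) \<partial>lborel)"
    proof (rule nn_integral_mono)
      fix y
      have "ennreal (norm (time_ft (cutoff T) y)) \<le> ennreal (18 * (T * (1 + T * \<bar>y\<bar>) powr - 2))"
        by (intro ennreal_leI norm_ft_cutoff_le T)
      then show "ennreal (norm (time_ft (cutoff T) y)) \<le> 18 * ennreal (T * (1 + T * \<bar>y\<bar>) powr - 2)"
        by (subst (asm) ennreal_mult') auto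
    qed
    also have "\<dots> = 18 * tail_integral 2"
      using tail_kernel_integral_le[OF T, of 2] by (subst nn_integral_cmult) auto
    also have "\<dots> < \<infinity>" using tail_integral_finite[of 2] by (simp add: ennreal_mult_less_top)
    finally show "(\<integral>\<^sup>+y. ennreal (norm (time_ft (cutoff T) y)) \<partial>lborel) < \<infinity>" .
  qed
qed

lemma cutoff_eq_1: "T > 0 \<Longrightarrow> 0 \<le> t \<Longrightarrow> t \<le> T \<Longrightarrow> cutoff T t = 1"
  by (simp add: cutoff_def trapezoid_eq_1)

section \<open>The product estimate\<close>

lemma measurable_pair_countI:
  fixes f :: "real \<times> int \<Rightarrow> 'b::topological_space"
  assumes "\<And>k. k \<in> A \<Longrightarrow> (\<lambda>\<tau>. f (\<tau>, k)) \<in> borel_measurable borel"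
  shows "f \<in> borel_measurable (lborel \<Otimes>\<^sub>M count_space A)"
proof -
  have "(\<lambda>(k, \<tau>). f (\<tau>, k)) \<in> borel_measurable (count_space A \<Otimes>\<^sub>M lborel)"
    by (rule measurable_pair_measure_countable1) (use assms in auto)
  then show ?thesis by (subst measurable_pair_swap_iff) simp
qed

lemma measurable_Q_countI:
  fixes f :: "real \<times> int \<Rightarrow> 'b::topological_space"
  assumes "\<And>k. (\<lambda>\<tau>. f (\<tau>, k)) \<in> borel_measurable borel"
  shows "f \<in> borel_measurable Q"
  unfolding Q_def by (rule measurable_pair_countI) (rule assms)

text \<open>A bridge between \<open>has_Z_norm\<close>, whose integral runs over nonzero modes, and
  \<open>Q\<close>, which contains mode 0 for the sake of the group structure.\<close>

lemma nn_integral_punctured: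
  fixes f :: "real \<times> int \<Rightarrow> ennreal"
  assumes m: "\<And>k. (\<lambda>\<tau>. f (\<tau>, k)) \<in> borel_measurable borel" and z: "\<And>\<tau>. f (\<tau>, 0) = 0"
  shows "(\<integral>\<^sup>+z. f z \<partial>(lborel \<Otimes>\<^sub>M count_space (- {0}))) = (\<integral>\<^sup>+z. f z \<partial>Q)"
proof -
  interpret c0: sigma_finite_measure "count_space (- {0 :: int})"
    by (rule sigma_finite_measure_count_space_countable) simp
  interpret P0: pair_sigma_finite lborel "count_space (- {0 :: int})" ..
  have "(\<integral>\<^sup>+z. f z \<partial>(lborel \<Otimes>\<^sub>M count_space (- {0}))) = (\<integral>\<^sup>+k. \<integral>\<^sup>+\<tau>. f (\<tau>, k) \<partial>lborel \<partial>count_space (- {0}))"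
    by (rule P0.nn_integral_snd[symmetric]) (intro measurable_pair_countI m)
  also have "\<dots> = (\<integral>\<^sup>+k. (\<integral>\<^sup>+\<tau>. f (\<tau>, k) \<partial>lborel) * indicator (- {0}) k \<partial>cint)"
    by (subst nn_integral_count_space_indicator) auto
  also have "\<dots> = (\<integral>\<^sup>+k. (\<integral>\<^sup>+\<tau>. f (\<tau>, k) \<partial>lborel) \<partial>cint)"
    using z by (intro nn_integral_cong) (auto simp: indicator_def)
  also have "\<dots> = (\<integral>\<^sup>+z. f z \<partial>Q)"
    by (rule nn_integral_Q[symmetric]) (intro measurable_Q_countI m)
  finally show ?thesis .
qed

lemma Z_weight_measurable [measurable]: "Z_weight \<alpha> \<beta> b k \<in> borel_measurable borel"
  unfolding Z_weight_def by measurable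

lemma Z_weight_nonneg: "0 \<le> Z_weight \<alpha> \<beta> b k \<tau>"
  by (simp add: Z_weight_def)

text \<open>\<open>has_Z_norm\<close> leaves F arbitrary at mode 0. Setting it to zero there gives a
  family measurable in every mode, whose weighted integral over all of \<open>Q\<close> is the
  squared norm.\<close>

lemma has_Z_normD:
  assumes "has_Z_norm \<alpha> \<beta> b w N"
  obtains F where "F 0 = (\<lambda>_. 0)" "\<And>k. F k \<in> borel_measurable borel" "\<And>k. k \<noteq> 0 \<Longrightarrow> has_ft (w k) (F k)"
    "N \<ge> 0" "(\<integral>\<^sup>+z. ennreal ((Z_weight \<alpha> \<beta> b (snd z) (fst z) * norm (F (snd z) (fst z)))\<^sup>2) \<partial>Q) = ennreal (N\<^sup>2)"
proof -
  obtain F where F: "\<And>k. k \<noteq> 0 \<Longrightarrow> has_ft (w k) (F k)"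
    and int: "integrable (lborel \<Otimes>\<^sub>M count_space (- {0})) (\<lambda>(\<tau>, k). (Z_weight \<alpha> \<beta> b k \<tau> * cmod (F k \<tau>))\<^sup>2)"
    and N: "N = sqrt (LINT (\<tau>, k)|(lborel \<Otimes>\<^sub>M count_space (- {0})). (Z_weight \<alpha> \<beta> b k \<tau> * cmod (F k \<tau>))\<^sup>2)"
    using assms unfolding has_Z_norm_def by blast
  define F' where "F' k = (if k = 0 then (\<lambda>_. 0) else F k)" for k
  have m: "F' k \<in> borel_measurable borel" for k
    using F[of k] by (auto simp: F'_def has_ft_def)
  have N0: "N \<ge> 0" using N by (auto intro!: integral_nonneg_AE)
  have "ennreal (N\<^sup>2) = ennreal (LINT (\<tau>, k)|(lborel \<Otimes>\<^sub>M count_space (- {0})). (Z_weight \<alpha> \<beta> b k \<tau> * cmod (F k \<tau>))\<^sup>2)"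
    unfolding N by (subst real_sqrt_pow2) (auto intro!: integral_nonneg_AE)
  also have "\<dots> = (\<integral>\<^sup>+(\<tau>, k). ennreal ((Z_weight \<alpha> \<beta> b k \<tau> * cmod (F k \<tau>))\<^sup>2) \<partial>(lborel \<Otimes>\<^sub>M count_space (- {0})))"
    using nn_integral_eq_integral[OF int] by (simp add: case_prod_unfold)
  also have "\<dots> = (\<integral>\<^sup>+z. ennreal ((Z_weight \<alpha> \<beta> b (snd z) (fst z) * norm (F' (snd z) (fst z)))\<^sup>2) \<partial>(lborel \<Otimes>\<^sub>M count_space (- {0})))"
    by (intro nn_integral_cong) (auto simp: F'_def space_pair_measure)
  also have "\<dots> = (\<integral>\<^sup>+z. ennreal ((Z_weight \<alpha> \<beta> b (snd z) (fst z) * norm (F' (snd z) (fst z)))\<^sup>2) \<partial>Q)"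
    by (rule nn_integral_punctured) (use m in \<open>auto simp: F'_def\<close>)
  finally show ?thesis
    using that[of F'] F m N0 by (auto simp: F'_def)
qed

context exponents
begin

definition wnorm_sq :: "(int \<Rightarrow> real \<Rightarrow> complex) \<Rightarrow> ennreal" where
  "wnorm_sq F = (\<integral>\<^sup>+z. ennreal ((W (snd z) (fst z) * norm (F (snd z) (fst z)))\<^sup>2) \<partial>Q)"

text \<open>This is where b > 1/2 enters: 1 / \<open>W\<close> is square integrable in \<tau>,
  uniformly in k, so Cauchy-Schwarz bounds the L1 norm of each mode by its weighted L2 norm, and the
  latter are square summable.\<close>

lemma L1_bounds:
  assumes F [measurable]: "\<And>k. F k \<in> borel_measurable borel" and fin: "wnorm_sq F < \<infinity>"
  shows "integrable lborel (F k)" "integrable cint (\<lambda>k. (LINT \<tau>|lborel. norm (F k \<tau>))\<^sup>2)"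
proof -
  let ?L = "\<lambda>k. LINT \<tau>|lborel. norm (F k \<tau>)"
  define a where "a k = (\<integral>\<^sup>+\<tau>. ennreal ((W k \<tau> * norm (F k \<tau>))\<^sup>2) \<partial>lborel)" for k
  have wa: "wnorm_sq F = (\<integral>\<^sup>+k. a k \<partial>cint)"
    unfolding wnorm_sq_def a_def by (subst nn_integral_Q) (auto intro!: measurable_Q_countI)
  have tf: "4 * tail_integral (1 + \<theta>) < \<infinity>" using tail_integral_finite[of "1 + \<theta>"] \<theta> by (simp add: ennreal_mult_less_top)
  have le: "(\<integral>\<^sup>+\<tau>. ennreal (norm (F k \<tau>)) \<partial>lborel)\<^sup>2 \<le> 4 * tail_integral (1 + \<theta>) * a k" for k
  proof -
    have "(\<integral>\<^sup>+\<tau>. ennreal (norm (F k \<tau>)) \<partial>lborel) = (\<integral>\<^sup>+\<tau>. ennreal (1 / W k \<tau>) * ennreal (W k \<tau> * norm (F k \<tau>)) \<partial>lborel)"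
      by (intro nn_integral_cong) (use W_pos in \<open>auto simp: less_imp_le less_imp_neq[symmetric] simp flip: ennreal_mult\<close>)
    then have "(\<integral>\<^sup>+\<tau>. ennreal (norm (F k \<tau>)) \<partial>lborel)\<^sup>2 \<le> (\<integral>\<^sup>+\<tau>. (ennreal (1 / W k \<tau>))\<^sup>2 \<partial>lborel) * (\<integral>\<^sup>+\<tau>. (ennreal (W k \<tau> * norm (F k \<tau>)))\<^sup>2 \<partial>lborel)"
      by (simp only:) (rule Cauchy_Schwarz_nn_integral, measurable)
    also have "(\<integral>\<^sup>+\<tau>. (ennreal (W k \<tau> * norm (F k \<tau>)))\<^sup>2 \<partial>lborel) = a k"
      unfolding a_def by (intro nn_integral_cong) (simp add: ennreal_power Z_weight_nonneg)
    finally show ?thesis using mult_right_mono[OF integral_inverse_W_sq_le[of k], of "a k"] by (simp add: order_trans)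
  qed
  have af: "a k < \<infinity>" for k
  proof -
    have "a k \<le> (\<integral>\<^sup>+k. a k \<partial>cint)" by (rule nn_integral_ge_point) simp
    then show ?thesis using fin wa by (simp add: order.strict_trans1)
  qed
  have fink: "(\<integral>\<^sup>+\<tau>. ennreal (norm (F k \<tau>)) \<partial>lborel) < \<infinity>" for k
  proof -
    have "(\<integral>\<^sup>+\<tau>. ennreal (norm (F k \<tau>)) \<partial>lborel)\<^sup>2 < \<infinity>"
      using le[of k] by (rule order.strict_trans1) (use tf af[of k] in \<open>auto simp: ennreal_mult_less_top\<close>)
    then show ?thesis by (auto simp: power2_eq_square less_top[symmetric] ennreal_mult_eq_top_iff)
  qed
  show int: "integrable lborel (F k)" for k
    by (rule integrableI_bounded) (use fink in auto)
  have L1: "(\<integral>\<^sup>+\<tau>. ennreal (norm (F k \<tau>)) \<partial>lborel) = ennreal (?L k)" for k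
    using int[of k] by (intro nn_integral_eq_integral) auto
  have L0: "?L k \<ge> 0" for k by simp
  show "integrable cint (\<lambda>k. (?L k)\<^sup>2)"
  proof (rule integrableI_bounded)
    have "(\<integral>\<^sup>+k. ennreal (norm ((?L k)\<^sup>2)) \<partial>cint) \<le> (\<integral>\<^sup>+k. 4 * tail_integral (1 + \<theta>) * a k \<partial>cint)"
      using le L0 unfolding L1 by (intro nn_integral_mono) (simp add: ennreal_power)
    also have "\<dots> = 4 * tail_integral (1 + \<theta>) * wnorm_sq F" unfolding wa by (rule nn_integral_cmult) simp
    also have "\<dots> < \<infinity>" using tf fin by (simp add: ennreal_mult_less_top)
    finally show "(\<integral>\<^sup>+k. ennreal (norm ((?L k)\<^sup>2)) \<partial>cint) < \<infinity>" .
  qed simp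
qed

end

section \<open>From functions on the slab to their modes\<close>

lemma torus_slices:
  fixes u :: "real \<Rightarrow> real \<Rightarrow> complex"
  assumes u: "set_integrable lborel ({0..T} \<times> {-pi..pi}) (\<lambda>(t, x). u t x)"
  shows "set_integrable lborel {0..T} (\<lambda>t. fcoeff (u t) k)"
    and "AE t in lborel. t \<in> {0..T} \<longrightarrow> integrable circ (u t)"
    and "(\<lambda>(t, x). indicator {0..T} t *\<^sub>R indicator {-pi..pi} x *\<^sub>R u t x) \<in> borel_measurable (borel \<Otimes>\<^sub>M borel)"
proof -
  \<comment> \<open>Extended by zero, the function is Borel on the whole plane; the hypothesis gives
    measurability of u only on the rectangle.\<close>
  define u' where "u' = (\<lambda>(t, x). indicator {0..T} t *\<^sub>R indicator {-pi..pi} x *\<^sub>R u t x)"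
  have eq: "(\<lambda>z. indicator ({0..T} \<times> {-pi..pi}) z *\<^sub>R (case z of (t, x) \<Rightarrow> u t x)) = u'"
    by (auto simp: u'_def indicator_def)
  have "integrable lborel u'" using u unfolding set_integrable_def eq .
  then have int: "integrable (lborel \<Otimes>\<^sub>M lborel) u'" by (simp add: lborel_prod)
  then have "u' \<in> borel_measurable (lborel \<Otimes>\<^sub>M lborel)" by (rule borel_measurable_integrable)
  then show m: "u' \<in> borel_measurable (borel \<Otimes>\<^sub>M borel)"
    by (subst (asm) measurable_cong_sets[OF sets_pair_measure_cong[OF sets_lborel sets_lborel] refl])
  have "integrable (lborel \<Otimes>\<^sub>M lborel) (\<lambda>z. u' z * cis (- (of_int k * snd z)))"
    using int by (rule integrable_mult_cis) measurable
  from lborel_pair.integrable_fst'[OF this]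
  have "integrable lborel (\<lambda>t. LINT x|lborel. u' (t, x) * cis (- (of_int k * x)))" by simp
  moreover have "(LINT x|lborel. u' (t, x) * cis (- (of_int k * x))) = indicator {0..T} t *\<^sub>R fcoeff (u t) k" for t
    unfolding fcoeff_def set_lebesgue_integral_def u'_def
    by (simp add: cis_conv_exp mult_ac flip: integral_scaleR_right)
  ultimately show "set_integrable lborel {0..T} (\<lambda>t. fcoeff (u t) k)" by (simp add: set_integrable_def)
  have "AE t in lborel. integrable lborel (\<lambda>x. u' (t, x))"
    by (rule lborel_pair.AE_integrable_fst'[OF int])
  then show "AE t in lborel. t \<in> {0..T} \<longrightarrow> integrable circ (u t)"
    by eventually_elim (auto simp: u'_def integrable_circ_iff set_integrable_def)
qed

text \<open>Each mode is identified off a null set, and countably many modes share one.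
  \<open>has_Z_norm\<close> provides no symbol for mode 0; there its vanishing on Schwartz functions
  is used, which reaches the test functions because bumps are Schwartz.\<close>

lemma fun_dist_modes:
  assumes u: "set_integrable lborel ({0..T} \<times> {-pi..pi}) (\<lambda>(t, x). u t x)"
    and F: "F 0 = (\<lambda>_. 0)" "\<And>k. k \<noteq> 0 \<Longrightarrow> has_ft (w k) (F k)" "\<And>k. integrable lborel (F k)"
    and w0: "\<And>\<phi>. schwartz \<phi> \<Longrightarrow> w 0 \<phi> = 0"
    and agree: "agree_on T w (fun_dist T u)"
  shows "AE t in lborel. t \<in> {0..T} \<longrightarrow> (\<forall>k. fcoeff (u t) k = inv_ft (F k) t)"
proof -
  have "AE t in lborel. t \<in> {0..T} \<longrightarrow> fcoeff (u t) k = inv_ft (F k) t" for k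
  proof (cases "k = 0")
    case False
    show ?thesis
    proof (rule has_ft_imp_AE_inv_ft[OF F(2)[OF False] F(3) torus_slices(1)[OF u]])
      show "w k \<phi> = (LINT t:{0..T}|lborel. fcoeff (u t) k * \<phi> t)" if "test_function T \<phi>" for \<phi>
        using agree that by (simp add: agree_on_def fun_dist_def)
    qed
  next
    case True
    have "AE t in lborel. t \<in> {0..T} \<longrightarrow> fcoeff (u t) 0 = 0"
    proof (rule test_zero_imp_AE_zero[OF torus_slices(1)[OF u]])
      fix a c l :: real assume *: "0 < a" "a < c" "c < T" "l > 0"
      have "w 0 (cbump a c l 1 0) = fun_dist T u 0 (cbump a c l 1 0)"
        using agree test_function_cbump[OF *] by (simp add: agree_on_def)
      then show "(LINT t:{0..T}|lborel. fcoeff (u t) 0 * cbump a c l 1 0 t) = 0"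
        using w0[OF cbump_schwartz[OF *(4,2)]] by (simp add: fun_dist_def)
    qed
    then show ?thesis using True F(1) by (simp add: inv_ft_cis)
  qed
  then have "AE t in lborel. \<forall>k. t \<in> {0..T} \<longrightarrow> fcoeff (u t) k = inv_ft (F k) t"
    by (subst AE_all_countable) blast
  then show ?thesis by eventually_elim blast
qed

lemma cis_split: "cis (\<tau> * t) = cis ((\<tau> - s) * t) * cis (s * t)"
  by (simp add: cis_mult left_diff_distrib)

text \<open>Each \<open>inv_ft\<close> carries a factor 1 / (2 * pi), so the convolution theorem is
  left with one 2 * pi.\<close>

lemma time_convolution:
  assumes g: "integrable lborel g" and h: "integrable lborel h"
  shows "integrable lborel (\<lambda>\<tau>. LINT s|lborel. g (\<tau> - s) * h s)" (is "integrable lborel ?C")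
    and "inv_ft (\<lambda>\<tau>. LINT s|lborel. g (\<tau> - s) * h s) t = of_real (2 * pi) * inv_ft g t * inv_ft h t"
proof -
  have [measurable]: "g \<in> borel_measurable borel" "h \<in> borel_measurable borel" using g h by auto
  have sh: "integrable lborel (\<lambda>\<tau>. g (\<tau> - s))" for s
    using lborel_integrable_real_affine[OF g, of 1 "- s"] by simp
  have shn: "(LINT \<tau>|lborel. norm (g (\<tau> - s))) = (LINT \<tau>|lborel. norm (g \<tau>))" for s
    using lborel_integral_real_affine[of 1 "\<lambda>t. norm (g t)" "- s"] by simp
  have int: "integrable (lborel \<Otimes>\<^sub>M lborel) (\<lambda>(s, \<tau>). g (\<tau> - s) * h s)"
  proof (rule lborel_pair.Fubini_integrable)
    show "integrable lborel (\<lambda>s. LINT \<tau>|lborel. norm (case (s, \<tau>) of (s, \<tau>) \<Rightarrow> g (\<tau> - s) * h s))"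
      using h by (simp add: norm_mult shn integrable_norm)
    show "AE s in lborel. integrable lborel (\<lambda>\<tau>. case (s, \<tau>) of (s, \<tau>) \<Rightarrow> g (\<tau> - s) * h s)"
      using sh by simp
  qed measurable
  show "integrable lborel ?C"
    using lborel_pair.integrable_snd[OF int] by simp
  have int2: "integrable (lborel \<Otimes>\<^sub>M lborel) (\<lambda>(s, \<tau>). g (\<tau> - s) * h s * cis (\<tau> * t))"
    using integrable_mult_cis[OF int, of "\<lambda>z. snd z * t"] by (simp add: case_prod_unfold)
  have "(LINT \<tau>|lborel. ?C \<tau> * cis (\<tau> * t)) = (LINT \<tau>|lborel. LINT s|lborel. g (\<tau> - s) * h s * cis (\<tau> * t))"
    by simp
  also have "\<dots> = (LINT s|lborel. LINT \<tau>|lborel. g (\<tau> - s) * h s * cis (\<tau> * t))"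
    by (rule lborel_pair.Fubini_integral[OF int2])
  also have "\<dots> = (LINT s|lborel. (LINT \<tau>|lborel. g \<tau> * cis (\<tau> * t)) * (h s * cis (s * t)))"
  proof (rule Bochner_Integration.integral_cong[OF refl])
    fix s
    have "(LINT \<tau>|lborel. g (\<tau> - s) * h s * cis (\<tau> * t)) = (LINT \<tau>|lborel. (g (\<tau> - s) * cis ((\<tau> - s) * t)) * (h s * cis (s * t)))"
      by (intro Bochner_Integration.integral_cong refl) (subst cis_split[of _ t s], simp add: mult_ac)
    also have "\<dots> = (LINT \<tau>|lborel. g (\<tau> - s) * cis ((\<tau> - s) * t)) * (h s * cis (s * t))" by simp
    also have "(LINT \<tau>|lborel. g (\<tau> - s) * cis ((\<tau> - s) * t)) = (LINT \<tau>|lborel. g \<tau> * cis (\<tau> * t))"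
      using lborel_integral_real_affine[of 1 "\<lambda>\<tau>. g \<tau> * cis (\<tau> * t)" "- s"] by simp
    finally show "(LINT \<tau>|lborel. g (\<tau> - s) * h s * cis (\<tau> * t)) = (LINT \<tau>|lborel. g \<tau> * cis (\<tau> * t)) * (h s * cis (s * t))" .
  qed
  also have "\<dots> = (LINT \<tau>|lborel. g \<tau> * cis (\<tau> * t)) * (LINT s|lborel. h s * cis (s * t))" by simp
  finally show "inv_ft ?C t = of_real (2 * pi) * inv_ft g t * inv_ft h t"
    unfolding inv_ft_cis by simp
qed

lemma integrable_cint_shift:
  fixes f :: "int \<Rightarrow> real"
  assumes "integrable cint f"
  shows "integrable cint (\<lambda>j. f (k - j))"
proof (rule integrableI_bounded)
  have "(\<integral>\<^sup>+j. ennreal (norm (f (k - j))) \<partial>cint) = (\<integral>\<^sup>+j. ennreal (norm (f j)) \<partial>cint)"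
    by (rule nn_integral_cint_shift(2))
  then show "(\<integral>\<^sup>+j. ennreal (norm (f (k - j))) \<partial>cint) < \<infinity>"
    using assms by (simp add: integrable_iff_bounded)
qed simp

text \<open>The space-time transform of a product up to the factor (2 * pi)^2, one 2 * pi for time
  and one for the torus.\<close>

definition spacetime_conv :: "(int \<Rightarrow> real \<Rightarrow> complex) \<Rightarrow> (int \<Rightarrow> real \<Rightarrow> complex) \<Rightarrow> int \<Rightarrow> real \<Rightarrow> complex" where
  "spacetime_conv F G k \<tau> = (LINT w|Q. F (snd w) (fst w) * G (k - snd w) (\<tau> - fst w))"

text \<open>The L1 norms a and c of the modes are square summable, so the products a j * c (k - j)
  are summable by Cauchy-Schwarz. This absolute convergence justifies every exchange of
  integrals.\<close>

lemma spacetime_convolution: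
  assumes F: "\<And>k. integrable lborel (F k)" and G: "\<And>k. integrable lborel (G k)"
    and F2: "integrable cint (\<lambda>k. (LINT \<tau>|lborel. norm (F k \<tau>))\<^sup>2)"
    and G2: "integrable cint (\<lambda>k. (LINT \<tau>|lborel. norm (G k \<tau>))\<^sup>2)"
  shows "integrable lborel (spacetime_conv F G k)"
    and "integrable cint (\<lambda>j. inv_ft (F j) t * inv_ft (G (k - j)) t)"
    and "inv_ft (spacetime_conv F G k) t = of_real (2 * pi) * (LINT j|cint. inv_ft (F j) t * inv_ft (G (k - j)) t)"
proof -
  define a where "a j = (LINT \<tau>|lborel. norm (F j \<tau>))" for j
  define c where "c j = (LINT \<tau>|lborel. norm (G j \<tau>))" for j
  have a0: "a j \<ge> 0" and c0: "c j \<ge> 0" for j by (simp_all add: a_def c_def)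
  have [measurable]: "F j \<in> borel_measurable borel" "G j \<in> borel_measurable borel" for j
    using F[of j] G[of j] by auto
  define f where "f w = F (snd w) (fst w)" for w
  define g where "g w = G (snd w) (fst w)" for w
  have fm [measurable]: "f \<in> borel_measurable Q" and gm [measurable]: "g \<in> borel_measurable Q"
    unfolding f_def g_def by (auto intro!: measurable_Q_countI)
  have ac: "integrable cint (\<lambda>j. a j * c (k - j))"
    by (rule integral_Cauchy_Schwarz(1))
      (use F2 integrable_cint_shift[OF G2, of k] a0 c0 in \<open>auto simp: a_def c_def\<close>)
  interpret QL: pair_sigma_finite Q lborel ..
  have mm: "(\<lambda>z. (snd z, k) - fst z) \<in> Q \<Otimes>\<^sub>M lborel \<rightarrow>\<^sub>M Q"
    by (intro measurable_Q_minus measurable_QI) auto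
  have gm2: "(\<lambda>z. g ((snd z, k) - fst z)) \<in> borel_measurable (Q \<Otimes>\<^sub>M lborel)"
    by (rule measurable_compose[OF mm gm])
  have sh: "integrable lborel (\<lambda>\<tau>. G j (\<tau> - s))" for s j
    using lborel_integrable_real_affine[OF G[of j], of 1 "- s"] by simp
  have shn: "(LINT \<tau>|lborel. norm (G j (\<tau> - s))) = c j" for s j
    using lborel_integral_real_affine[of 1 "\<lambda>t. norm (G j t)" "- s"] by (simp add: c_def)
  have int: "integrable (Q \<Otimes>\<^sub>M lborel) (\<lambda>(w, \<tau>). f w * G (k - snd w) (\<tau> - fst w))"
  proof (rule QL.Fubini_integrable)
    show "(\<lambda>(w, \<tau>). f w * G (k - snd w) (\<tau> - fst w)) \<in> borel_measurable (Q \<Otimes>\<^sub>M lborel)"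
      using gm2 by (simp add: g_def case_prod_beta minus_prod_def)
    show "integrable Q (\<lambda>w. LINT \<tau>|lborel. norm (case (w, \<tau>) of (w, \<tau>) \<Rightarrow> f w * G (k - snd w) (\<tau> - fst w)))"
    proof (rule integrableI_bounded)
      have eq: "(LINT \<tau>|lborel. norm (case (w, \<tau>) of (w, \<tau>) \<Rightarrow> f w * G (k - snd w) (\<tau> - fst w))) = norm (f w) * c (k - snd w)" for w
        by (simp add: norm_mult shn)
      have cm [measurable]: "(\<lambda>w. c (k - snd w)) \<in> borel_measurable Q"
        by (rule measurable_compose[OF snd_Q]) simp
      show "(\<lambda>w. LINT \<tau>|lborel. norm (case (w, \<tau>) of (w, \<tau>) \<Rightarrow> f w * G (k - snd w) (\<tau> - fst w))) \<in> borel_measurable Q"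
        unfolding eq by measurable
      have "(\<integral>\<^sup>+w. ennreal (norm (norm (f w) * c (k - snd w))) \<partial>Q) = (\<integral>\<^sup>+j. \<integral>\<^sup>+\<tau>. ennreal (norm (F j \<tau>)) * ennreal (c (k - j)) \<partial>lborel \<partial>cint)"
        using c0 by (subst nn_integral_Q) (auto simp: f_def ennreal_mult abs_mult)
      also have "\<dots> = (\<integral>\<^sup>+j. ennreal (a j * c (k - j)) \<partial>cint)"
      proof (rule nn_integral_cong)
        fix j
        have "(\<integral>\<^sup>+\<tau>. ennreal (norm (F j \<tau>)) \<partial>lborel) = ennreal (a j)"
          unfolding a_def using F[of j] by (intro nn_integral_eq_integral) auto
        then show "(\<integral>\<^sup>+\<tau>. ennreal (norm (F j \<tau>)) * ennreal (c (k - j)) \<partial>lborel) = ennreal (a j * c (k - j))"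
          using a0 c0 by (subst nn_integral_multc) (auto simp: ennreal_mult)
      qed
      also have "\<dots> < \<infinity>" using ac a0 c0 by (simp add: integrable_iff_bounded)
      finally show "(\<integral>\<^sup>+w. ennreal (norm (LINT \<tau>|lborel. norm (case (w, \<tau>) of (w, \<tau>) \<Rightarrow> f w * G (k - snd w) (\<tau> - fst w)))) \<partial>Q) < \<infinity>"
        unfolding eq .
    qed
    show "AE w in Q. integrable lborel (\<lambda>\<tau>. case (w, \<tau>) of (w, \<tau>) \<Rightarrow> f w * G (k - snd w) (\<tau> - fst w))"
      using sh by simp
  qed
  show "integrable lborel (spacetime_conv F G k)"
    using QL.integrable_snd[OF int] by (simp add: spacetime_conv_def[abs_def] f_def)
  have int2: "integrable (Q \<Otimes>\<^sub>M lborel) (\<lambda>(w, \<tau>). f w * G (k - snd w) (\<tau> - fst w) * cis (\<tau> * t))"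
    using integrable_mult_cis[OF int, of "\<lambda>z. snd z * t"] by (simp add: case_prod_unfold)
  define V where "V j = (LINT \<tau>|lborel. G j \<tau> * cis (\<tau> * t))" for j
  have inner: "(LINT \<tau>|lborel. f w * G (k - snd w) (\<tau> - fst w) * cis (\<tau> * t)) = f w * cis (fst w * t) * V (k - snd w)" for w
  proof -
    have "(LINT \<tau>|lborel. f w * G (k - snd w) (\<tau> - fst w) * cis (\<tau> * t)) = (LINT \<tau>|lborel. (f w * cis (fst w * t)) * (G (k - snd w) (\<tau> - fst w) * cis ((\<tau> - fst w) * t)))"
      by (intro Bochner_Integration.integral_cong refl) (subst cis_split[of _ t "fst w"], simp add: mult_ac)
    also have "\<dots> = (f w * cis (fst w * t)) * (LINT \<tau>|lborel. G (k - snd w) (\<tau> - fst w) * cis ((\<tau> - fst w) * t))" by simp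
    also have "(LINT \<tau>|lborel. G (k - snd w) (\<tau> - fst w) * cis ((\<tau> - fst w) * t)) = V (k - snd w)"
      using lborel_integral_real_affine[of 1 "\<lambda>\<tau>. G (k - snd w) \<tau> * cis (\<tau> * t)" "- fst w"] by (simp add: V_def)
    finally show ?thesis .
  qed
  have intw: "integrable Q (\<lambda>w. f w * cis (fst w * t) * V (k - snd w))"
    using QL.integrable_fst[OF int2] by (simp add: inner)
  then have intw': "integrable (lborel \<Otimes>\<^sub>M cint) (\<lambda>(\<tau>, j). F j \<tau> * cis (\<tau> * t) * V (k - j))"
    unfolding Q_def by (simp add: f_def case_prod_unfold)
  have j_int: "(LINT \<tau>|lborel. F j \<tau> * cis (\<tau> * t) * V (k - j)) = of_real ((2 * pi)^2) * (inv_ft (F j) t * inv_ft (G (k - j)) t)" for j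
    by (simp add: inv_ft_cis V_def power2_eq_square)
  have "integrable cint (\<lambda>j. of_real ((2 * pi)^2) * (inv_ft (F j) t * inv_ft (G (k - j)) t))"
    using LC.integrable_snd[OF intw'] unfolding j_int .
  from integrable_mult_right[OF this, of "inverse (of_real ((2 * pi)^2))"]
  show "integrable cint (\<lambda>j. inv_ft (F j) t * inv_ft (G (k - j)) t)"
    by (simp add: mult.assoc[symmetric] del: of_real_power of_real_mult)
  have "(LINT \<tau>|lborel. spacetime_conv F G k \<tau> * cis (\<tau> * t)) = (LINT \<tau>|lborel. LINT w|Q. f w * G (k - snd w) (\<tau> - fst w) * cis (\<tau> * t))"
    by (simp add: spacetime_conv_def f_def)
  also have "\<dots> = (LINT w|Q. LINT \<tau>|lborel. f w * G (k - snd w) (\<tau> - fst w) * cis (\<tau> * t))"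
    by (rule QL.Fubini_integral[OF int2])
  also have "\<dots> = (LINT w|Q. f w * cis (fst w * t) * V (k - snd w))" by (simp add: inner)
  also have "\<dots> = (LINT j|cint. LINT \<tau>|lborel. F j \<tau> * cis (\<tau> * t) * V (k - j))"
    using LC.integral_snd[OF intw'] by (simp add: Q_def f_def case_prod_unfold)
  also have "\<dots> = of_real ((2 * pi)^2) * (LINT j|cint. inv_ft (F j) t * inv_ft (G (k - j)) t)"
    unfolding j_int by (rule integral_mult_right_zero)
  finally show "inv_ft (spacetime_conv F G k) t = of_real (2 * pi) * (LINT j|cint. inv_ft (F j) t * inv_ft (G (k - j)) t)"
    unfolding inv_ft_cis[of "spacetime_conv F G k"] by (simp add: power2_eq_square)
qed

lemma symmetric_sums_tendsto:
  fixes g :: "int \<Rightarrow> complex"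
  assumes g: "integrable cint g"
  shows "(\<lambda>N. \<Sum>j\<in>{- int N..int N}. g j) \<longlonglongrightarrow> (LINT j|cint. g j)"
proof -
  have "(\<lambda>N. LINT j|cint. (if j \<in> {- int N..int N} then g j else 0)) \<longlonglongrightarrow> (LINT j|cint. g j)"
  proof (rule integral_dominated_convergence[where w = "\<lambda>j. norm (g j)"])
    show "AE j in cint. (\<lambda>N. if j \<in> {- int N..int N} then g j else 0) \<longlonglongrightarrow> g j"
    proof (intro AE_I2 tendsto_eventually)
      fix j
      have "eventually (\<lambda>N. nat \<bar>j\<bar> \<le> N) sequentially" by (rule eventually_ge_at_top)
      then show "eventually (\<lambda>N. (if j \<in> {- int N..int N} then g j else 0) = g j) sequentially"
        by eventually_elim auto
    qed
  qed (use g in auto)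
  moreover have "(LINT j|cint. (if j \<in> {- int N..int N} then g j else 0)) = (\<Sum>j\<in>{- int N..int N}. g j)" for N
  proof -
    have fin: "finite {j. (if j \<in> {- int N..int N} then g j else 0) \<noteq> 0}"
      by (rule finite_subset[of _ "{- int N..int N}"]) auto
    show ?thesis
      by (subst lebesgue_integral_count_space_finite_support)
        (use fin in \<open>auto intro!: sum.mono_neutral_cong_left split: if_splits\<close>)
  qed
  ultimately show ?thesis by simp
qed

lemma fcoeff_cong: "(\<And>x. - pi \<le> x \<Longrightarrow> x \<le> pi \<Longrightarrow> f x = g x) \<Longrightarrow> fcoeff f k = fcoeff g k"
  unfolding fcoeff_def set_lebesgue_integral_def
  by (intro Bochner_Integration.integral_cong refl) (auto simp: indicator_def)

text \<open>Square integrability on the torus gives convergence of symmetric partial sums to the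
  coefficient of the product, and \<open>spacetime_convolution\<close> gives absolute convergence of
  the same series. Comparing the limits identifies the two.\<close>

lemma fcoeff_product_eq:
  assumes U: "integrable circ U" "U \<in> borel_measurable borel" "\<And>k. fcoeff U k = inv_ft (F k) t"
    and V: "integrable circ V" "V \<in> borel_measurable borel" "\<And>k. fcoeff V k = inv_ft (G k) t"
    and F: "\<And>k. integrable lborel (F k)" and G: "\<And>k. integrable lborel (G k)"
    and F2: "integrable cint (\<lambda>k. (LINT \<tau>|lborel. norm (F k \<tau>))\<^sup>2)"
    and G2: "integrable cint (\<lambda>k. (LINT \<tau>|lborel. norm (G k \<tau>))\<^sup>2)"
  shows "inv_ft (spacetime_conv F G k) t = of_real ((2 * pi)\<^sup>2) * fcoeff (\<lambda>x. U x * V x) k"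
proof -
  have sq: "integrable cint (\<lambda>k. (norm (inv_ft (F k) t))\<^sup>2)" if F2: "integrable cint (\<lambda>k. (LINT \<tau>|lborel. norm (F k \<tau>))\<^sup>2)" for F
  proof (rule Bochner_Integration.integrable_bound[OF integrable_mult_right[OF F2, of "(1 / (2 * pi))\<^sup>2"]])
    show "AE k in cint. norm ((norm (inv_ft (F k) t))\<^sup>2) \<le> norm ((1 / (2 * pi))\<^sup>2 * (LINT \<tau>|lborel. norm (F k \<tau>))\<^sup>2)"
    proof (rule AE_I2)
      fix k
      have "(norm (inv_ft (F k) t))\<^sup>2 \<le> ((LINT \<tau>|lborel. norm (F k \<tau>)) / (2 * pi))\<^sup>2"
        by (intro power_mono norm_inv_ft_le) auto
      then show "norm ((norm (inv_ft (F k) t))\<^sup>2) \<le> norm ((1 / (2 * pi))\<^sup>2 * (LINT \<tau>|lborel. norm (F k \<tau>))\<^sup>2)"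
        by (simp add: power_divide)
    qed
  qed simp
  have "(\<lambda>N. \<Sum>j\<in>{- int N..int N}. inv_ft (F j) t * inv_ft (G (k - j)) t) \<longlonglongrightarrow> of_real (2 * pi) * fcoeff (\<lambda>x. U x * V x) k"
    using fcoeff_product[OF U(1,2) _ V(1,2), of k] sq[OF F2] sq[OF G2] unfolding U(3) V(3) by blast
  moreover have "(\<lambda>N. \<Sum>j\<in>{- int N..int N}. inv_ft (F j) t * inv_ft (G (k - j)) t) \<longlonglongrightarrow> (LINT j|cint. inv_ft (F j) t * inv_ft (G (k - j)) t)"
    by (rule symmetric_sums_tendsto[OF spacetime_convolution(2)[OF F G F2 G2]])
  ultimately have "(LINT j|cint. inv_ft (F j) t * inv_ft (G (k - j)) t) = of_real (2 * pi) * fcoeff (\<lambda>x. U x * V x) k"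
    by (rule LIMSEQ_unique[rotated])
  then show ?thesis
    unfolding spacetime_convolution(3)[OF F G F2 G2] by (simp add: power2_eq_square)
qed

text \<open>If f is not integrable, its Bochner integral is 0 by convention and the bound is
  trivial. The convolution can therefore be estimated at every single \<tau>.\<close>

lemma ennreal_norm_integral_le:
  fixes f :: "'a \<Rightarrow> complex"
  shows "ennreal (norm (LINT x|M. f x)) \<le> (\<integral>\<^sup>+x. ennreal (norm (f x)) \<partial>M)"
proof (cases "integrable M f")
  case True
  then show ?thesis by (rule integral_norm_bound_ennreal)
qed (simp add: not_integrable_integral_eq)

section \<open>The bilinear estimate and the gain from the cutoff\<close>

context exponents
begin

text \<open>1296 = 36^2 is the squared constant of \<open>kernel_bound\<close>, 40 belongs to
  \<open>convolution_estimate\<close>, and the last factor bounds the squared L2 norm of 1 /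
  \<open>W\<close> at each mode.\<close>

definition bilinear_const :: ennreal where
  "bilinear_const = 1296 * (40 * ((\<integral>\<^sup>+k. (ennreal (q k))\<^sup>2 \<partial>cint) * (4 * tail_integral (1 + \<theta>))))"

lemma bilinear_const_finite: "bilinear_const < \<infinity>"
  using sum_q_sq_finite tail_integral_finite[of "1 + \<theta>"] \<theta>
  by (simp add: bilinear_const_def ennreal_mult_less_top)

text \<open>The weight of \<open>Z\<^sup>b\<^sup>-\<^sup>1\<close> combined with the derivative, except that the exponent \<open>b - 1\<close> of the modulation is
  raised by \<open>\<theta>/2\<close>. The time cutoff makes up for the difference.\<close>

definition out_weight :: "int \<Rightarrow> real \<Rightarrow> real" where
  "out_weight k \<tau> = \<bar>of_int k\<bar> powr (1 - \<beta> / 2 + \<beta> * \<theta> / 2) * bracket ((\<tau> - disp \<alpha> k) / K k) powr (\<theta> - 1/2)"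

text \<open>Writing each input as its weighted version times 1 / \<open>W\<close> exposes the kernel
  that \<open>kernel_bound\<close> controls pointwise. What remains is
  \<open>convolution_estimate\<close> with \<nu> = 1 / \<open>W\<close>.\<close>

lemma bilinear_estimate:
  assumes F [measurable]: "\<And>k. F k \<in> borel_measurable borel" and G [measurable]: "\<And>k. G k \<in> borel_measurable borel"
    and F0: "F 0 = (\<lambda>_. 0)" and G0: "G 0 = (\<lambda>_. 0)"
  shows "(\<integral>\<^sup>+z. (ennreal (out_weight (snd z) (fst z) * norm (spacetime_conv F G (snd z) (fst z))))\<^sup>2 \<partial>Q)
    \<le> bilinear_const * (wnorm_sq F * wnorm_sq G)"
proof -
  define A where "A w = ennreal (W (snd w) (fst w) * norm (F (snd w) (fst w)))" for w :: "real \<times> int"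
  define B where "B w = ennreal (W (snd w) (fst w) * norm (G (snd w) (fst w)))" for w :: "real \<times> int"
  define \<nu> where "\<nu> w = ennreal (1 / W (snd w) (fst w))" for w :: "real \<times> int"
  define e where "e k = ennreal (q k)" for k
  have Am [measurable]: "A \<in> borel_measurable Q" and Bm [measurable]: "B \<in> borel_measurable Q" and \<nu>m [measurable]: "\<nu> \<in> borel_measurable Q"
    unfolding A_def B_def \<nu>_def by (auto intro!: measurable_Q_countI)
  have wA: "(\<integral>\<^sup>+z. (A z)\<^sup>2 \<partial>Q) = wnorm_sq F" and wB: "(\<integral>\<^sup>+z. (B z)\<^sup>2 \<partial>Q) = wnorm_sq G"
    unfolding wnorm_sq_def A_def B_def by (auto intro!: nn_integral_cong simp: ennreal_power Z_weight_nonneg)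
  define I where "I z = (\<integral>\<^sup>+w. A w * B (z - w) * ((e (snd z) + e (snd w) + e (snd (z - w))) * (\<nu> w + \<nu> (z - w))) \<partial>Q)" for z :: "real \<times> int"
  have em: "(\<lambda>z. e (snd z)) \<in> borel_measurable Q"
    by (rule measurable_compose[OF snd_Q]) simp
  have sub_m: "(\<lambda>z :: (real \<times> int) \<times> (real \<times> int). fst z - snd z) \<in> Q \<Otimes>\<^sub>M Q \<rightarrow>\<^sub>M Q" by measurable
  have [measurable]: "(\<lambda>z :: (real \<times> int) \<times> (real \<times> int). e (snd (fst z - snd z))) \<in> borel_measurable (Q \<Otimes>\<^sub>M Q)"
    using measurable_compose[OF sub_m em] .
  have [measurable]: "(\<lambda>w :: real \<times> int. e (snd (z - w))) \<in> borel_measurable Q" for z :: "real \<times> int"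
    using measurable_compose[OF _ em, of "\<lambda>w :: real \<times> int. z - w" Q] by measurable
  note em [measurable]
  have Im [measurable]: "I \<in> borel_measurable Q"
    unfolding I_def by measurable
  have point: "ennreal (out_weight (snd z) (fst z) * norm (spacetime_conv F G (snd z) (fst z))) \<le> 36 * I z" for z :: "real \<times> int"
  proof -
    let ?M = "out_weight (snd z) (fst z)"
    have M0: "?M \<ge> 0" by (simp add: out_weight_def)
    have "ennreal (?M * norm (spacetime_conv F G (snd z) (fst z))) = ennreal ?M * ennreal (norm (LINT w|Q. F (snd w) (fst w) * G (snd (z - w)) (fst (z - w))))"
      using M0 by (simp add: spacetime_conv_def ennreal_mult)
    also have "\<dots> \<le> ennreal ?M * (\<integral>\<^sup>+w. ennreal (norm (F (snd w) (fst w) * G (snd (z - w)) (fst (z - w)))) \<partial>Q)"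
      by (intro mult_left_mono ennreal_norm_integral_le) simp
    also have "\<dots> = (\<integral>\<^sup>+w. ennreal ?M * ennreal (norm (F (snd w) (fst w) * G (snd (z - w)) (fst (z - w)))) \<partial>Q)"
    proof (rule nn_integral_cmult[symmetric])
      have f: "(\<lambda>w. F (snd w) (fst w)) \<in> borel_measurable Q" and g: "(\<lambda>w. G (snd w) (fst w)) \<in> borel_measurable Q"
        by (auto intro!: measurable_Q_countI)
      have "(\<lambda>w::real \<times> int. z - w) \<in> Q \<rightarrow>\<^sub>M Q" by measurable
      from measurable_compose[OF this g] f
      show "(\<lambda>w. ennreal (norm (F (snd w) (fst w) * G (snd (z - w)) (fst (z - w))))) \<in> borel_measurable Q" by measurable
    qed
    also have "\<dots> \<le> (\<integral>\<^sup>+w. 36 * (A w * B (z - w) * ((e (snd z) + e (snd w) + e (snd (z - w))) * (\<nu> w + \<nu> (z - w)))) \<partial>Q)"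
    proof (rule nn_integral_mono)
      fix w :: "real \<times> int"
      define k where "k = snd z"
      define k1 where "k1 = snd w"
      define k2 where "k2 = snd (z - w)"
      have kk: "k = k1 + k2" by (simp add: k_def k1_def k2_def)
      have tt: "fst z = fst w + fst (z - w)" by simp
      let ?f = "norm (F k1 (fst w))" and ?g = "norm (G k2 (fst (z - w)))"
      show "ennreal ?M * ennreal (norm (F (snd w) (fst w) * G (snd (z - w)) (fst (z - w))))
        \<le> 36 * (A w * B (z - w) * ((e (snd z) + e (snd w) + e (snd (z - w))) * (\<nu> w + \<nu> (z - w))))"
      \<comment> \<open>\<open>kernel_bound\<close> speaks of nonzero frequencies. A vanishing input
        frequency is covered by F 0 = 0 and G 0 = 0, a vanishing output frequency by the convention
        that 0 powr e is 0 in \<open>out_weight\<close>.\<close>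
      proof (cases "k1 = 0 \<or> k2 = 0 \<or> k = 0")
        case True
        then have eq: "?M * norm (F (snd w) (fst w) * G (snd (z - w)) (fst (z - w))) = 0"
          using F0 G0 unfolding k_def[symmetric] k1_def[symmetric] k2_def[symmetric] by (auto simp: out_weight_def)
        show ?thesis unfolding ennreal_mult[OF M0 norm_ge_zero, symmetric] eq by simp
      next
        case False
        let ?w1 = "W k1 (fst w)" and ?w2 = "W k2 (fst (z - w))"
        have w: "?w1 > 0" "?w2 > 0" by (rule W_pos)+
        have kb: "?M * (1 / ?w1) * (1 / ?w2) \<le> 36 * (q k + q k1 + q k2) * (1 / ?w1 + 1 / ?w2)"
          using kernel_bound[of k1 k2 "fst w" "fst (z - w)"] False
          unfolding out_weight_def k_def[symmetric] kk[symmetric] tt[symmetric] by simp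
        have "?M * (?f * ?g) = (?M * (1 / ?w1) * (1 / ?w2)) * ((?w1 * ?f) * (?w2 * ?g))"
          using w by simp
        also have "\<dots> \<le> (36 * (q k + q k1 + q k2) * (1 / ?w1 + 1 / ?w2)) * ((?w1 * ?f) * (?w2 * ?g))"
          using w by (intro mult_right_mono[OF kb]) auto
        also have "\<dots> = 36 * (((?w1 * ?f) * (?w2 * ?g)) * ((q k + q k1 + q k2) * (1 / ?w1 + 1 / ?w2)))"
          by (simp only: mult_ac)
        finally have "ennreal (?M * (?f * ?g)) \<le> ennreal (36 * (((?w1 * ?f) * (?w2 * ?g)) * ((q k + q k1 + q k2) * (1 / ?w1 + 1 / ?w2))))"
          by (rule ennreal_leI)
        also have "\<dots> = 36 * (A w * B (z - w) * ((e k + e k1 + e k2) * (\<nu> w + \<nu> (z - w))))"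
        proof -
          have nn: "0 \<le> ?w1 * ?f" "0 \<le> ?w2 * ?g" "0 \<le> q k + q k1 + q k2" "0 \<le> 1 / ?w1 + 1 / ?w2" "0 \<le> 1 / ?w1" "0 \<le> 1 / ?w2"
            using w by auto
          have "ennreal (36 * (((?w1 * ?f) * (?w2 * ?g)) * ((q k + q k1 + q k2) * (1 / ?w1 + 1 / ?w2))))
            = ennreal 36 * (ennreal (?w1 * ?f) * ennreal (?w2 * ?g) * (ennreal (q k + q k1 + q k2) * ennreal (1 / ?w1 + 1 / ?w2)))"
            using nn by (simp only: ennreal_mult mult_nonneg_nonneg zero_le_numeral)
          also have "ennreal (q k + q k1 + q k2) = e k + e k1 + e k2"
            by (simp add: e_def ennreal_plus)
          also have "ennreal (1 / ?w1 + 1 / ?w2) = \<nu> w + \<nu> (z - w)"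
            using nn by (simp only: ennreal_plus \<nu>_def k1_def k2_def)
          finally show ?thesis by (simp add: A_def B_def k1_def k2_def)
        qed
        also have "?M * (?f * ?g) = ?M * norm (F (snd w) (fst w) * G (snd (z - w)) (fst (z - w)))"
          by (simp only: norm_mult k1_def k2_def)
        finally show ?thesis
          unfolding ennreal_mult[OF M0 norm_ge_zero, symmetric] k_def k1_def k2_def .
      qed
    qed
    also have "\<dots> = 36 * I z"
      unfolding I_def by (rule nn_integral_cmult) measurable
    finally show ?thesis .
  qed
  have "(\<integral>\<^sup>+z. (ennreal (out_weight (snd z) (fst z) * norm (spacetime_conv F G (snd z) (fst z))))\<^sup>2 \<partial>Q) \<le> (\<integral>\<^sup>+z. 1296 * (I z)\<^sup>2 \<partial>Q)"
  proof (rule nn_integral_mono)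
    fix z
    have "(ennreal (out_weight (snd z) (fst z) * norm (spacetime_conv F G (snd z) (fst z))))\<^sup>2 \<le> (36 * I z)\<^sup>2"
      by (rule power_mono[OF point]) simp
    then show "(ennreal (out_weight (snd z) (fst z) * norm (spacetime_conv F G (snd z) (fst z))))\<^sup>2 \<le> 1296 * (I z)\<^sup>2"
      by (simp add: power_mult_distrib)
  qed
  also have "\<dots> = 1296 * (\<integral>\<^sup>+z. (I z)\<^sup>2 \<partial>Q)" by (rule nn_integral_cmult) measurable
  also have "\<dots> \<le> 1296 * (40 * ((\<integral>\<^sup>+k. (e k)\<^sup>2 \<partial>cint) * (4 * tail_integral (1 + \<theta>)) * ((\<integral>\<^sup>+z. (A z)\<^sup>2 \<partial>Q) * (\<integral>\<^sup>+z. (B z)\<^sup>2 \<partial>Q))))"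
    unfolding I_def
    by (intro mult_left_mono convolution_estimate Am Bm \<nu>m)
      (simp_all only: \<nu>_def fst_conv snd_conv integral_inverse_W_sq_le zero_le)
  finally show ?thesis unfolding wA wB bilinear_const_def e_def by (simp only: mult.assoc)
qed

text \<open>Multiplication by \<open>cutoff T\<close> seen on the Fourier side, up to a factor 2 *
  pi.\<close>

definition localised_conv :: "real \<Rightarrow> (int \<Rightarrow> real \<Rightarrow> complex) \<Rightarrow> int \<Rightarrow> real \<Rightarrow> complex" where
  "localised_conv T H k \<tau> = (LINT s|lborel. time_ft (cutoff T) (\<tau> - s) * H k s)"

definition local_const :: ennreal where
  "local_const = ennreal (18\<^sup>2) * (tail_integral 2 * (tail_integral (1 + \<theta>) + head_integral (1 - \<theta>)))"

lemma local_const_finite: "local_const < \<infinity>"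
  using tail_integral_finite[of "1 + \<theta>"] tail_integral_finite[of 2] head_integral_finite[of "1 - \<theta>"] \<theta>
  by (simp add: local_const_def ennreal_mult_less_top)

text \<open>The norm contributes (b - 1)\<beta>, the derivative together with D contributes 1 -
  \<beta>\<theta>/2, and localisation contributes K^\<theta>. The frequency exponent of
  \<open>out_weight\<close> is the one that balances them. Replacing <k> by |k| goes the right way
  because the exponent - \<beta> + 2\<beta>\<theta> is nonpositive for \<theta> \<le> 1/2.\<close>

lemma frequency_factor_le:
  assumes "k \<noteq> 0"
  shows "(bracket (of_int k) powr ((b - 1) * \<beta>))\<^sup>2 * (\<bar>of_int k\<bar> powr (1 - \<beta> * \<theta> / 2))\<^sup>2 * K k powr \<theta>
    \<le> (\<bar>of_int k\<bar> powr (1 - \<beta> / 2 + \<beta> * \<theta> / 2))\<^sup>2"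
proof -
  let ?x = "\<bar>of_int k\<bar> :: real" and ?B = "bracket (of_int k)"
  have "(?B powr ((b - 1) * \<beta>))\<^sup>2 * K k powr \<theta> = ?B powr (- \<beta> + 2 * \<beta> * \<theta>)"
    unfolding power2_eq_square powr_powr powr_add[symmetric] by (simp add: algebra_simps)
  also have "\<dots> \<le> ?x powr (- \<beta> + 2 * \<beta> * \<theta>)"
    using assms bracket_ge_abs[of "of_int k"] \<beta> \<theta> mult_left_mono[of "2 * \<theta>" 1 \<beta>] by (intro powr_mono2') auto
  finally have "(?B powr ((b - 1) * \<beta>))\<^sup>2 * K k powr \<theta> * (?x powr (1 - \<beta> * \<theta> / 2))\<^sup>2
     \<le> ?x powr (- \<beta> + 2 * \<beta> * \<theta>) * (?x powr (1 - \<beta> * \<theta> / 2))\<^sup>2"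
    by (rule mult_right_mono) simp
  also have "\<dots> = (?x powr (1 - \<beta> / 2 + \<beta> * \<theta> / 2))\<^sup>2"
    unfolding power2_eq_square powr_add[symmetric] by (simp add: algebra_simps)
  finally show ?thesis by (simp only: mult_ac)
qed

text \<open>As b - 1 = \<theta>/2 - 1/2 lies strictly between -1/2 and 1/2, the output norm uses the
  first branch of the weight, whereas the inputs use the second.\<close>

lemma Z_weight_low: "Z_weight \<alpha> \<beta> (b - 1) k \<tau> = bracket (of_int k) powr ((b - 1) * \<beta>) * bracket ((\<tau> - disp \<alpha> k) / K k) powr (b - 1)"
  using \<theta> by (simp add: Z_weight_def)

text \<open>Mode by mode this is \<open>time_localisation\<close> with r = 1 - \<theta>: then - r =
  2(b - 1) is the modulation exponent of the squared output norm, and \<theta> - r = 2(\<theta> -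
  1/2) that of the squared \<open>out_weight\<close>. Of the factor (T K)^\<theta>, T^\<theta> is
  the gain and K^\<theta> goes to \<open>frequency_factor_le\<close>.\<close>

lemma localised_estimate:
  assumes T: "T > 0" and H [measurable]: "\<And>k. H k \<in> borel_measurable borel"
    and X [measurable]: "\<And>k. localised_conv T H k \<in> borel_measurable borel"
    and c: "c 0 = 0" "\<And>k. k \<noteq> 0 \<Longrightarrow> norm (c k) \<le> \<bar>of_int k\<bar> powr (1 - \<beta> * \<theta> / 2)"
  shows "(\<integral>\<^sup>+z. ennreal ((Z_weight \<alpha> \<beta> (b - 1) (snd z) (fst z) * norm (c (snd z) * localised_conv T H (snd z) (fst z)))\<^sup>2) \<partial>Q)
    \<le> ennreal (T powr \<theta>) * local_const * (\<integral>\<^sup>+z. (ennreal (out_weight (snd z) (fst z) * norm (H (snd z) (fst z))))\<^sup>2 \<partial>Q)"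
proof -
  have ow [measurable]: "out_weight k \<in> borel_measurable borel" for k unfolding out_weight_def by measurable
  have ow0: "0 \<le> out_weight k \<tau>" for k \<tau> by (simp add: out_weight_def)
  have tm [measurable]: "time_ft (cutoff T) \<in> borel_measurable borel" using cutoff_facts(4)[OF T] by auto
  have slice: "(\<integral>\<^sup>+\<tau>. ennreal ((Z_weight \<alpha> \<beta> (b - 1) k \<tau> * norm (c k * localised_conv T H k \<tau>))\<^sup>2) \<partial>lborel)
     \<le> ennreal (T powr \<theta>) * local_const * (\<integral>\<^sup>+\<tau>. (ennreal (out_weight k \<tau> * norm (H k \<tau>)))\<^sup>2 \<partial>lborel)" for k
  proof (cases "k = 0")
    case True
    then show ?thesis using c(1) by simp
  next
    case False
    define p where "p = (bracket (of_int k) powr ((b - 1) * \<beta>))\<^sup>2 * (\<bar>of_int k\<bar> powr (1 - \<beta> * \<theta> / 2))\<^sup>2"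
    have p0: "p \<ge> 0" by (simp add: p_def)
    have br: "bracket y powr - (1 - \<theta>) = (bracket y powr (b - 1))\<^sup>2" for y
    proof -
      have "b - 1 + (b - 1) = - (1 - \<theta>)" by simp
      then show ?thesis unfolding power2_eq_square powr_add[symmetric] by simp
    qed
    have br2: "bracket y powr (\<theta> - (1 - \<theta>)) = (bracket y powr (\<theta> - 1/2))\<^sup>2" for y
      by (simp add: power2_eq_square flip: powr_add)
    have "(\<integral>\<^sup>+\<tau>. ennreal ((Z_weight \<alpha> \<beta> (b - 1) k \<tau> * norm (c k * localised_conv T H k \<tau>))\<^sup>2) \<partial>lborel)
      \<le> (\<integral>\<^sup>+\<tau>. ennreal p * (ennreal (bracket ((\<tau> - disp \<alpha> k) / K k) powr - (1 - \<theta>)) * (\<integral>\<^sup>+s. ennreal (norm (time_ft (cutoff T) (\<tau> - s))) * ennreal (norm (H k s)) \<partial>lborel)\<^sup>2) \<partial>lborel)"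
    proof (rule nn_integral_mono)
      fix \<tau>
      let ?y = "bracket ((\<tau> - disp \<alpha> k) / K k)" and ?n = "norm (localised_conv T H k \<tau>)"
      have "(norm (c k))\<^sup>2 \<le> (\<bar>of_int k\<bar> powr (1 - \<beta> * \<theta> / 2))\<^sup>2"
        by (intro power_mono c False) simp
      then have "(bracket (of_int k) powr ((b - 1) * \<beta>))\<^sup>2 * (norm (c k))\<^sup>2 \<le> p"
        unfolding p_def by (rule mult_left_mono) simp
      then have "(bracket (of_int k) powr ((b - 1) * \<beta>))\<^sup>2 * (norm (c k))\<^sup>2 * (?y powr - (1 - \<theta>) * ?n\<^sup>2) \<le> p * (?y powr - (1 - \<theta>) * ?n\<^sup>2)"
        by (rule mult_right_mono) simp
      then have "(Z_weight \<alpha> \<beta> (b - 1) k \<tau> * norm (c k * localised_conv T H k \<tau>))\<^sup>2 \<le> p * (?y powr - (1 - \<theta>) * ?n\<^sup>2)"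
        unfolding Z_weight_low norm_mult br by (simp only: power_mult_distrib mult_ac)
      then have "ennreal ((Z_weight \<alpha> \<beta> (b - 1) k \<tau> * norm (c k * localised_conv T H k \<tau>))\<^sup>2) \<le> ennreal (p * (?y powr - (1 - \<theta>) * ?n\<^sup>2))"
        by (rule ennreal_leI)
      also have "\<dots> = ennreal p * (ennreal (?y powr - (1 - \<theta>)) * (ennreal ?n)\<^sup>2)"
        using p0 by (simp only: ennreal_mult ennreal_power norm_ge_zero powr_ge_zero zero_le_power2 mult_nonneg_nonneg)
      also have "\<dots> \<le> ennreal p * (ennreal (?y powr - (1 - \<theta>)) * (\<integral>\<^sup>+s. ennreal (norm (time_ft (cutoff T) (\<tau> - s))) * ennreal (norm (H k s)) \<partial>lborel)\<^sup>2)"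
      proof (intro mult_left_mono power_mono)
        show "ennreal ?n \<le> (\<integral>\<^sup>+s. ennreal (norm (time_ft (cutoff T) (\<tau> - s))) * ennreal (norm (H k s)) \<partial>lborel)"
          using ennreal_norm_integral_le[of lborel "\<lambda>s. time_ft (cutoff T) (\<tau> - s) * H k s"]
          by (simp add: localised_conv_def norm_mult ennreal_mult)
      qed auto
      finally show "ennreal ((Z_weight \<alpha> \<beta> (b - 1) k \<tau> * norm (c k * localised_conv T H k \<tau>))\<^sup>2)
        \<le> ennreal p * (ennreal (?y powr - (1 - \<theta>)) * (\<integral>\<^sup>+s. ennreal (norm (time_ft (cutoff T) (\<tau> - s))) * ennreal (norm (H k s)) \<partial>lborel)\<^sup>2)" .
    qed
    also have "\<dots> = ennreal p * (\<integral>\<^sup>+\<tau>. ennreal (bracket ((\<tau> - disp \<alpha> k) / K k) powr - (1 - \<theta>)) * (\<integral>\<^sup>+s. ennreal (norm (time_ft (cutoff T) (\<tau> - s))) * ennreal (norm (H k s)) \<partial>lborel)\<^sup>2 \<partial>lborel)"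
      by (rule nn_integral_cmult) measurable
    also have "\<dots> \<le> ennreal p * (ennreal (18\<^sup>2 * (T * K k) powr \<theta>) * (tail_integral 2 * (tail_integral (2 - (1 - \<theta>)) + head_integral (1 - \<theta>)))
      * (\<integral>\<^sup>+s. ennreal (bracket ((s - disp \<alpha> k) / K k) powr (\<theta> - (1 - \<theta>))) * (ennreal (norm (H k s)))\<^sup>2 \<partial>lborel))"
      by (intro mult_left_mono time_localisation[where ker = "\<lambda>y. norm (time_ft (cutoff T) y)" and h = "\<lambda>s. ennreal (norm (H k s))"])
        (use T K_pos[of k] \<theta> norm_ft_cutoff_le[OF T] tm in auto)
    also have "\<dots> = ennreal (T powr \<theta>) * local_const * (\<integral>\<^sup>+s. ennreal (p * K k powr \<theta>) * (ennreal (bracket ((s - disp \<alpha> k) / K k) powr (\<theta> - (1 - \<theta>))) * (ennreal (norm (H k s)))\<^sup>2) \<partial>lborel)"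
    proof -
      have "ennreal (18\<^sup>2 * (T * K k) powr \<theta>) = ennreal (18\<^sup>2) * ennreal (T powr \<theta>) * ennreal (K k powr \<theta>)"
        unfolding powr_mult by (simp only: ennreal_mult zero_le_power2 powr_ge_zero mult_nonneg_nonneg mult.assoc)
      moreover have "ennreal (p * K k powr \<theta>) = ennreal p * ennreal (K k powr \<theta>)"
        using p0 by (simp add: ennreal_mult)
      moreover have "2 - (1 - \<theta>) = 1 + \<theta>" by simp
      ultimately show ?thesis
        by (subst nn_integral_cmult) (auto simp: local_const_def mult_ac)
    qed
    also have "\<dots> \<le> ennreal (T powr \<theta>) * local_const * (\<integral>\<^sup>+\<tau>. (ennreal (out_weight k \<tau> * norm (H k \<tau>)))\<^sup>2 \<partial>lborel)"
    proof (intro mult_left_mono nn_integral_mono)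
      fix s
      have "p * K k powr \<theta> * (bracket ((s - disp \<alpha> k) / K k) powr (\<theta> - 1/2))\<^sup>2 \<le> (\<bar>of_int k\<bar> powr (1 - \<beta> / 2 + \<beta> * \<theta> / 2))\<^sup>2 * (bracket ((s - disp \<alpha> k) / K k) powr (\<theta> - 1/2))\<^sup>2"
        unfolding p_def by (intro mult_right_mono frequency_factor_le False) simp
      also have "\<dots> = (out_weight k s)\<^sup>2" by (simp only: out_weight_def power_mult_distrib)
      finally have "ennreal (p * K k powr \<theta> * bracket ((s - disp \<alpha> k) / K k) powr (\<theta> - (1 - \<theta>))) * (ennreal (norm (H k s)))\<^sup>2 \<le> ennreal ((out_weight k s)\<^sup>2) * (ennreal (norm (H k s)))\<^sup>2"
        unfolding br2 by (intro mult_right_mono ennreal_leI) auto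
      then show "ennreal (p * K k powr \<theta>) * (ennreal (bracket ((s - disp \<alpha> k) / K k) powr (\<theta> - (1 - \<theta>))) * (ennreal (norm (H k s)))\<^sup>2) \<le> (ennreal (out_weight k s * norm (H k s)))\<^sup>2"
        using p0 ow0 by (simp only: ennreal_mult ennreal_power power_mult_distrib norm_ge_zero powr_ge_zero mult_nonneg_nonneg mult.assoc[symmetric] zero_le_power2)
    qed auto
    finally show ?thesis .
  qed
  have "(\<integral>\<^sup>+z. ennreal ((Z_weight \<alpha> \<beta> (b - 1) (snd z) (fst z) * norm (c (snd z) * localised_conv T H (snd z) (fst z)))\<^sup>2) \<partial>Q)
     = (\<integral>\<^sup>+k. \<integral>\<^sup>+\<tau>. ennreal ((Z_weight \<alpha> \<beta> (b - 1) k \<tau> * norm (c k * localised_conv T H k \<tau>))\<^sup>2) \<partial>lborel \<partial>cint)"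
    by (subst nn_integral_Q) (auto intro!: measurable_Q_countI)
  also have "\<dots> \<le> (\<integral>\<^sup>+k. ennreal (T powr \<theta>) * local_const * (\<integral>\<^sup>+\<tau>. (ennreal (out_weight k \<tau> * norm (H k \<tau>)))\<^sup>2 \<partial>lborel) \<partial>cint)"
    by (intro nn_integral_mono slice)
  also have "\<dots> = ennreal (T powr \<theta>) * local_const * (\<integral>\<^sup>+k. \<integral>\<^sup>+\<tau>. (ennreal (out_weight k \<tau> * norm (H k \<tau>)))\<^sup>2 \<partial>lborel \<partial>cint)"
    by (rule nn_integral_cmult) simp
  also have "(\<integral>\<^sup>+k. \<integral>\<^sup>+\<tau>. (ennreal (out_weight k \<tau> * norm (H k \<tau>)))\<^sup>2 \<partial>lborel \<partial>cint) = (\<integral>\<^sup>+z. (ennreal (out_weight (snd z) (fst z) * norm (H (snd z) (fst z))))\<^sup>2 \<partial>Q)"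
    by (subst nn_integral_Q) (auto intro!: measurable_Q_countI)
  finally show ?thesis .
qed

end

section \<open>The extension of the product\<close>

lemma test_function_facts:
  assumes "test_function T \<phi>"
  shows "integrable lborel \<phi>" "\<And>t. t \<notin> {0..T} \<Longrightarrow> \<phi> t = 0"
proof -
  obtain a c where s: "smooth \<phi>" and ac: "0 < a" "c < T" and z: "\<And>t. t \<notin> {a..c} \<Longrightarrow> \<phi> t = 0"
    using assms unfolding test_function_def by blast
  have c: "continuous_on UNIV \<phi>" using smooth_continuous[OF s, of 0] by simp
  have "set_integrable lborel {a..c} \<phi>"
    by (rule borel_integrable_atLeastAtMost') (rule continuous_on_subset[OF c], simp)
  moreover have "(\<lambda>t. indicator {a..c} t *\<^sub>R \<phi> t) = \<phi>"
    using z by (auto simp: indicator_def)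
  ultimately show "integrable lborel \<phi>" by (simp add: set_integrable_def)
  show "\<phi> t = 0" if "t \<notin> {0..T}" for t using z[of t] ac that by auto
qed

lemma integrable_mult_bounded:
  fixes f g :: "real \<Rightarrow> complex"
  assumes f: "integrable lborel f" and g: "continuous_on UNIV g" "bounded (range g)"
  shows "integrable lborel (\<lambda>t. f t * g t)"
proof -
  obtain M where M: "\<And>t. norm (g t) \<le> M" using g(2) by (auto simp: bounded_iff)
  have M0: "0 \<le> M" using order_trans[OF norm_ge_zero M] .
  have [measurable]: "g \<in> borel_measurable borel" "f \<in> borel_measurable borel"
    using f g(1) by (auto intro: borel_measurable_continuous_onI)
  show ?thesis
  proof (rule Bochner_Integration.integrable_bound[OF integrable_mult_left[OF integrable_norm[OF f], of M]])
    show "AE t in lborel. norm (f t * g t) \<le> norm (norm (f t) * M)"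
    proof (rule AE_I2)
      fix t
      show "norm (f t * g t) \<le> norm (norm (f t) * M)"
        using mult_left_mono[OF M[of t] norm_ge_zero[of "f t"]] M0 by (simp add: norm_mult abs_mult)
    qed
  qed measurable
qed

lemma le_mult_Inf:
  fixes d P :: real
  assumes "S \<noteq> {}" "\<And>N. N \<in> S \<Longrightarrow> 0 \<le> N" "0 \<le> d" "\<And>N. N \<in> S \<Longrightarrow> P \<le> d * N"
  shows "P \<le> d * Inf S"
proof (cases "d = 0")
  case True
  then show ?thesis using assms(1,4) by auto
next
  case False
  then have "P / d \<le> Inf S" using assms by (intro cInf_greatest) (auto simp: field_simps)
  then show ?thesis using False assms(3) by (simp add: field_simps)
qed

context exponents
begin

text \<open>\<open>inv_ft_swap\<close> moves the transform onto the symbol. On [0,T] the cutoff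
  equals 1, and elsewhere the test function vanishes. Of the three factors 2 * pi, one comes from
  the convolution with the cutoff and two from the space-time convolution.\<close>

lemma product_distribution:
  assumes T: "T > 0"
    and u: "set_integrable lborel ({0..T} \<times> {-pi..pi}) (\<lambda>(t, x). u t x)"
    and v: "set_integrable lborel ({0..T} \<times> {-pi..pi}) (\<lambda>(t, x). v t x)"
    and F: "\<And>k. integrable lborel (F k)" and G: "\<And>k. integrable lborel (G k)"
    and F2: "integrable cint (\<lambda>k. (LINT \<tau>|lborel. norm (F k \<tau>))\<^sup>2)"
    and G2: "integrable cint (\<lambda>k. (LINT \<tau>|lborel. norm (G k \<tau>))\<^sup>2)"
    and uF: "AE t in lborel. t \<in> {0..T} \<longrightarrow> (\<forall>k. fcoeff (u t) k = inv_ft (F k) t)"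
    and vG: "AE t in lborel. t \<in> {0..T} \<longrightarrow> (\<forall>k. fcoeff (v t) k = inv_ft (G k) t)"
    and \<phi>: "test_function T \<phi>"
  shows "(LINT \<tau>|lborel. localised_conv T (spacetime_conv F G) k \<tau> * inv_ft \<phi> \<tau>) = of_real ((2 * pi) ^ 3) * fun_dist T (\<lambda>t x. u t x * v t x) k \<phi>"
proof -
  let ?H = "spacetime_conv F G k" and ?X = "localised_conv T (spacetime_conv F G) k"
    and ?P = "\<lambda>t. fcoeff (\<lambda>x. u t x * v t x) k" and ?c = "of_real ((2 * pi) ^ 3) :: complex"
  note cf = cutoff_facts[OF T]
  have Hi: "integrable lborel ?H" by (rule spacetime_convolution(1)[OF F G F2 G2])
  have lc: "?X = (\<lambda>\<tau>. LINT s|lborel. time_ft (cutoff T) (\<tau> - s) * ?H s)"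
    by (simp add: localised_conv_def[abs_def])
  have Xi: "integrable lborel ?X"
    unfolding lc by (rule time_convolution(1)[OF cf(4) Hi])
  have Xinv: "inv_ft ?X t = of_real (2 * pi) * cutoff T t * inv_ft ?H t" for t
    unfolding lc time_convolution(2)[OF cf(4) Hi] by (simp only: time_ft_inversion[OF cf])
  note tf = test_function_facts[OF \<phi>]
  have [measurable]: "\<phi> \<in> borel_measurable borel" using tf(1) by auto
  have Xm: "inv_ft ?X \<in> borel_measurable borel"
    by (rule inv_ft_measurable) (use Xi in auto)
  define u' where "u' = (\<lambda>(t, x). indicator {0..T} t *\<^sub>R indicator {-pi..pi} x *\<^sub>R u t x)"
  define v' where "v' = (\<lambda>(t, x). indicator {0..T} t *\<^sub>R indicator {-pi..pi} x *\<^sub>R v t x)"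
  have u'm [measurable]: "u' \<in> borel_measurable (borel \<Otimes>\<^sub>M borel)" unfolding u'_def by (rule torus_slices(3)[OF u])
  have v'm [measurable]: "v' \<in> borel_measurable (borel \<Otimes>\<^sub>M borel)" unfolding v'_def by (rule torus_slices(3)[OF v])
  have P: "indicator {0..T} t *\<^sub>R ?P t = (LINT x|lborel. u' (t, x) * v' (t, x) * cis (- (of_int k * x)))" for t
    unfolding fcoeff_def set_lebesgue_integral_def integral_scaleR_right[symmetric]
    by (intro Bochner_Integration.integral_cong refl) (auto simp: u'_def v'_def indicator_def cis_conv_exp mult_ac)
  have Pm: "(\<lambda>t. indicator {0..T} t *\<^sub>R ?P t) \<in> borel_measurable borel"
    unfolding P by measurable
  have "(LINT \<tau>|lborel. ?X \<tau> * inv_ft \<phi> \<tau>) = (LINT t|lborel. inv_ft ?X t * \<phi> t)"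
    by (rule inv_ft_swap[OF Xi tf(1)])
  also have "\<dots> = (LINT t|lborel. ?c * ((indicator {0..T} t *\<^sub>R ?P t) * \<phi> t))"
  proof (rule integral_cong_AE)
    show "AE t in lborel. inv_ft ?X t * \<phi> t = ?c * ((indicator {0..T} t *\<^sub>R ?P t) * \<phi> t)"
      using uF vG torus_slices(2)[OF u] torus_slices(2)[OF v]
    proof eventually_elim
      case (elim t)
      show ?case
      proof (cases "t \<in> {0..T}")
        case True
        \<comment> \<open>Restricting to [-pi, pi] gives functions that are Borel on the whole line
          and have the same coefficients.\<close>
        define U where "U x = indicator {-pi..pi} x *\<^sub>R u t x" for x
        define V where "V x = indicator {-pi..pi} x *\<^sub>R v t x" for x
        have "(\<lambda>x. u' (t, x)) \<in> borel_measurable borel" "(\<lambda>x. v' (t, x)) \<in> borel_measurable borel" by measurable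
        then have UV: "U \<in> borel_measurable borel" "V \<in> borel_measurable borel"
          using True by (auto simp: u'_def v'_def U_def[abs_def] V_def[abs_def])
        have "fcoeff U j = fcoeff (u t) j" "fcoeff V j = fcoeff (v t) j" for j
          by (auto intro!: fcoeff_cong simp: U_def V_def)
        then have c: "fcoeff U j = inv_ft (F j) t" "fcoeff V j = inv_ft (G j) t" for j
          using elim True by auto
        have "integrable circ U \<longleftrightarrow> integrable circ (u t)" "integrable circ V \<longleftrightarrow> integrable circ (v t)"
          by (auto intro!: Bochner_Integration.integrable_cong simp: U_def V_def)
        then have i: "integrable circ U" "integrable circ V" using elim True by auto
        have "inv_ft ?H t = of_real ((2 * pi)\<^sup>2) * fcoeff (\<lambda>x. U x * V x) k"
          by (rule fcoeff_product_eq[OF i(1) UV(1) c(1) i(2) UV(2) c(2) F G F2 G2])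
        also have "fcoeff (\<lambda>x. U x * V x) k = ?P t"
          by (rule fcoeff_cong) (simp add: U_def V_def)
        finally show ?thesis
          using True cutoff_eq_1[OF T, of t] unfolding Xinv by (simp add: power2_eq_square power3_eq_cube mult_ac)
      next
        case False
        then show ?thesis using tf(2) by simp
      qed
    qed
    show "(\<lambda>t. inv_ft ?X t * \<phi> t) \<in> borel_measurable lborel"
      using Xm by simp
    show "(\<lambda>t. ?c * ((indicator {0..T} t *\<^sub>R ?P t) * \<phi> t)) \<in> borel_measurable lborel"
      using borel_measurable_times[OF borel_measurable_const borel_measurable_times[OF Pm \<open>\<phi> \<in> borel_measurable borel\<close>]]
      by simp
  qed
  also have "\<dots> = ?c * fun_dist T (\<lambda>t x. u t x * v t x) k \<phi>"
    unfolding fun_dist_def set_lebesgue_integral_def mult_scaleR_left by (rule integral_mult_right_zero)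
  finally show "(LINT \<tau>|lborel. ?X \<tau> * inv_ft \<phi> \<tau>) = ?c * fun_dist T (\<lambda>t x. u t x * v t x) k \<phi>" .
qed

definition total_const :: real where
  "total_const = enn2real (local_const * bilinear_const)"

text \<open>The extension is explicit: its symbol is the multiplier of D and of the derivative
  applied to the localised convolution. Fourier inversion yields \<open>has_ft\<close>,
  \<open>product_distribution\<close> yields agreement on (0,T), and
  \<open>localised_estimate\<close> followed by \<open>bilinear_estimate\<close> bounds the
  norm.\<close>

lemma extension_of_product:
  assumes T: "T > 0"
    and u: "set_integrable lborel ({0..T} \<times> {-pi..pi}) (\<lambda>(t, x). u t x)"
    and v: "set_integrable lborel ({0..T} \<times> {-pi..pi}) (\<lambda>(t, x). v t x)"
    and w1: "has_Z_norm \<alpha> \<beta> b w1 N1" "agree_on T w1 (fun_dist T u)"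
    and w2: "has_Z_norm \<alpha> \<beta> b w2 N2" "agree_on T w2 (fun_dist T v)"
  shows "\<exists>w N. has_Z_norm \<alpha> \<beta> (b - 1) w N \<and>
     agree_on T w (D_pow (- \<beta> * (b - 1/2)) (d_x (fun_dist T (\<lambda>t x. u t x * v t x)))) \<and>
     N \<le> sqrt total_const * T powr (\<theta> / 2) * N1 * N2"
proof -
  obtain F where F: "F 0 = (\<lambda>_. 0)" "\<And>k. F k \<in> borel_measurable borel" "\<And>k. k \<noteq> 0 \<Longrightarrow> has_ft (w1 k) (F k)"
    and N1: "N1 \<ge> 0" and FN: "wnorm_sq F = ennreal (N1\<^sup>2)"
    using has_Z_normD[OF w1(1)] unfolding wnorm_sq_def by blast
  obtain G where G: "G 0 = (\<lambda>_. 0)" "\<And>k. G k \<in> borel_measurable borel" "\<And>k. k \<noteq> 0 \<Longrightarrow> has_ft (w2 k) (G k)"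
    and N2: "N2 \<ge> 0" and GN: "wnorm_sq G = ennreal (N2\<^sup>2)"
    using has_Z_normD[OF w2(1)] unfolding wnorm_sq_def by blast
  have w0: "\<And>\<phi>. schwartz \<phi> \<Longrightarrow> w1 0 \<phi> = 0" "\<And>\<phi>. schwartz \<phi> \<Longrightarrow> w2 0 \<phi> = 0"
    using w1(1) w2(1) by (auto simp: has_Z_norm_def)
  have Ffin: "wnorm_sq F < \<infinity>" and Gfin: "wnorm_sq G < \<infinity>" by (simp_all add: FN GN)
  have Fi: "\<And>k. integrable lborel (F k)" and F2: "integrable cint (\<lambda>k. (LINT \<tau>|lborel. norm (F k \<tau>))\<^sup>2)"
    using L1_bounds[OF F(2) Ffin] by blast+
  have Gi: "\<And>k. integrable lborel (G k)" and G2: "integrable cint (\<lambda>k. (LINT \<tau>|lborel. norm (G k \<tau>))\<^sup>2)"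
    using L1_bounds[OF G(2) Gfin] by blast+
  have uF: "AE t in lborel. t \<in> {0..T} \<longrightarrow> (\<forall>k. fcoeff (u t) k = inv_ft (F k) t)"
    by (rule fun_dist_modes[OF u F(1,3) Fi w0(1) w1(2)])
  have vG: "AE t in lborel. t \<in> {0..T} \<longrightarrow> (\<forall>k. fcoeff (v t) k = inv_ft (G k) t)"
    by (rule fun_dist_modes[OF v G(1,3) Gi w0(2) w2(2)])
  define H where "H = spacetime_conv F G"
  have Hi: "integrable lborel (H k)" for k unfolding H_def by (rule spacetime_convolution(1)[OF Fi Gi F2 G2])
  have Xi: "integrable lborel (localised_conv T H k)" for k
    using time_convolution(1)[OF cutoff_facts(4)[OF T] Hi[of k]] by (simp add: localised_conv_def[abs_def])
  have Hm: "H k \<in> borel_measurable borel" and Xm: "localised_conv T H k \<in> borel_measurable borel" for k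
    using Hi[of k] Xi[of k] by auto
  define m where "m k = (if k = 0 then 0 else of_real (\<bar>of_int k\<bar> powr (- \<beta> * (b - 1/2)))) * (\<i> * of_int k)" for k :: int
  \<comment> \<open>The denominator undoes the normalisation in \<open>product_distribution\<close>.
    Being at least 1, it leaves the multiplier bound \<open>cn\<close> intact.\<close>
  define c where "c k = m k / of_real ((2 * pi) ^ 3)" for k
  have c0: "c 0 = 0" by (simp add: c_def m_def)
  have cn: "norm (c k) \<le> \<bar>of_int k\<bar> powr (1 - \<beta> * \<theta> / 2)" if "k \<noteq> 0" for k
  proof -
    have "norm (m k) = \<bar>of_int k\<bar> powr (- \<beta> * (b - 1/2)) * \<bar>of_int k\<bar> powr 1"
      using that by (simp add: m_def norm_mult)
    also have "\<dots> = \<bar>of_int k\<bar> powr (1 - \<beta> * \<theta> / 2)"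
      unfolding powr_add[symmetric] by simp
    finally have mn: "norm (m k) = \<bar>of_int k\<bar> powr (1 - \<beta> * \<theta> / 2)" .
    have "1 \<le> (2 * pi) ^ 3" by (rule one_le_power) (use pi_gt3 in simp)
    then have "norm (m k) / (2 * pi) ^ 3 \<le> norm (m k) / 1"
      by (intro divide_left_mono) auto
    then show ?thesis using mn by (simp add: c_def norm_divide norm_power norm_mult power_mult_distrib)
  qed
  define X where "X k \<tau> = c k * localised_conv T H k \<tau>" for k \<tau>
  have XXi: "integrable lborel (X k)" for k unfolding X_def using Xi by simp
  have XXm: "X k \<in> borel_measurable borel" for k using XXi[of k] by auto
  \<comment> \<open>Mode 0 is set to zero, in agreement with the target, whose multipliers vanish
    there. Elsewhere the formula gives a value at test functions as well as at transforms of
    Schwartz functions.\<close>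
  define w where "w k \<phi> = (if k = 0 then 0 else (LINT \<tau>|lborel. X k \<tau> * inv_ft \<phi> \<tau>))" for k :: int and \<phi>
  let ?S = "\<lambda>z. (Z_weight \<alpha> \<beta> (b - 1) (snd z) (fst z) * norm (X (snd z) (fst z)))\<^sup>2"
  let ?M0 = "lborel \<Otimes>\<^sub>M count_space (- {0 :: int})"
  have Sm: "(\<lambda>\<tau>. ?S (\<tau>, k)) \<in> borel_measurable borel" for k
  proof -
    have [measurable]: "X k \<in> borel_measurable borel" by (rule XXm)
    show ?thesis unfolding fst_conv snd_conv by measurable
  qed
  have "(\<integral>\<^sup>+z. ennreal (?S z) \<partial>?M0) = (\<integral>\<^sup>+z. ennreal (?S z) \<partial>Q)"
    by (rule nn_integral_punctured) (use Sm c0 in \<open>auto simp: X_def\<close>)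
  also have "\<dots> \<le> ennreal (T powr \<theta>) * local_const * (\<integral>\<^sup>+z. (ennreal (out_weight (snd z) (fst z) * norm (H (snd z) (fst z))))\<^sup>2 \<partial>Q)"
    unfolding X_def by (rule localised_estimate[OF T Hm Xm c0 cn])
  also have "\<dots> \<le> ennreal (T powr \<theta>) * local_const * (bilinear_const * (wnorm_sq F * wnorm_sq G))"
    unfolding H_def by (intro mult_left_mono bilinear_estimate F(1,2) G(1,2)) simp
  also have "\<dots> = ennreal (T powr \<theta>) * ennreal total_const * (ennreal (N1\<^sup>2) * ennreal (N2\<^sup>2))"
  proof -
    \<comment> \<open>Finiteness of both constants guarantees that \<open>enn2real\<close> loses
      nothing.\<close>
    have "local_const * bilinear_const = ennreal total_const"
      unfolding total_const_def using local_const_finite bilinear_const_finite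
      by (intro ennreal_enn2real[symmetric]) (simp add: ennreal_mult_less_top)
    then show ?thesis unfolding FN GN by (metis mult.assoc)
  qed
  also have "\<dots> = ennreal (T powr \<theta> * total_const * (N1\<^sup>2 * N2\<^sup>2))"
    by (simp add: ennreal_mult total_const_def)
  finally have nn: "(\<integral>\<^sup>+z. ennreal (?S z) \<partial>?M0) \<le> ennreal (T powr \<theta> * total_const * (N1\<^sup>2 * N2\<^sup>2))" .
  have Sint: "integrable ?M0 ?S"
  proof (rule integrableI_bounded)
    show "?S \<in> borel_measurable ?M0" by (rule measurable_pair_countI) (rule Sm)
    show "(\<integral>\<^sup>+z. ennreal (norm (?S z)) \<partial>?M0) < \<infinity>"
      using nn by (simp add: order.strict_trans1)
  qed
  define N where "N = sqrt (LINT z|?M0. ?S z)"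
  have NZ: "has_Z_norm \<alpha> \<beta> (b - 1) w N"
    unfolding has_Z_norm_def
  proof (intro conjI allI impI exI[of _ X])
    show "w 0 \<phi> = 0" for \<phi> by (simp add: w_def)
    show "has_ft (w k) (X k)" if "k \<noteq> 0" for k
      unfolding has_ft_def
    proof (intro conjI allI impI XXm)
      fix \<phi> assume s: "schwartz \<phi>"
      note sf = schwartz_ft_integrable[OF s]
      show "integrable lborel (\<lambda>\<tau>. X k \<tau> * \<phi> \<tau>)"
        by (rule integrable_mult_bounded[OF XXi sf(3,4)])
      show "w k (time_ft \<phi>) = (LINT \<tau>|lborel. X k \<tau> * \<phi> \<tau>)"
        using that by (simp add: w_def time_ft_inversion[OF sf(3,4,1,2)])
    qed
    show "integrable ?M0 (\<lambda>(\<tau>, k). (Z_weight \<alpha> \<beta> (b - 1) k \<tau> * norm (X k \<tau>))\<^sup>2)"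
      using Sint by (simp add: case_prod_unfold)
    show "N = sqrt (LINT (\<tau>, k)|?M0. (Z_weight \<alpha> \<beta> (b - 1) k \<tau> * norm (X k \<tau>))\<^sup>2)"
      by (simp add: N_def case_prod_unfold)
  qed
  have ag: "agree_on T w (D_pow (- \<beta> * (b - 1/2)) (d_x (fun_dist T (\<lambda>t x. u t x * v t x))))"
    unfolding agree_on_def
  proof (intro allI impI)
    fix k \<phi> assume t: "test_function T \<phi>"
    let ?g = "fun_dist T (\<lambda>t x. u t x * v t x) k \<phi>"
    have rhs: "D_pow (- \<beta> * (b - 1/2)) (d_x (fun_dist T (\<lambda>t x. u t x * v t x))) k \<phi> = m k * ?g"
      by (simp add: D_pow_def d_x_def fourier_mult_def m_def)
    show "w k \<phi> = D_pow (- \<beta> * (b - 1/2)) (d_x (fun_dist T (\<lambda>t x. u t x * v t x))) k \<phi>"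
    proof (cases "k = 0")
      case True
      then show ?thesis unfolding rhs by (simp add: w_def m_def)
    next
      case False
      then have "w k \<phi> = c k * (LINT \<tau>|lborel. localised_conv T H k \<tau> * inv_ft \<phi> \<tau>)"
        by (simp add: w_def X_def mult.assoc)
      also have "\<dots> = c k * (of_real ((2 * pi) ^ 3) * ?g)"
        unfolding H_def product_distribution[OF T u v Fi Gi F2 G2 uF vG t] ..
      also have "\<dots> = m k * ?g"
        unfolding c_def by simp
      finally show ?thesis unfolding rhs .
    qed
  qed
  have "ennreal (LINT z|?M0. ?S z) \<le> ennreal (T powr \<theta> * total_const * (N1\<^sup>2 * N2\<^sup>2))"
    using nn nn_integral_eq_integral[OF Sint] by simp
  then have "(LINT z|?M0. ?S z) \<le> T powr \<theta> * total_const * (N1\<^sup>2 * N2\<^sup>2)"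
    by (subst (asm) ennreal_le_iff) (auto simp: total_const_def)
  then have "N \<le> sqrt (T powr \<theta> * total_const * (N1\<^sup>2 * N2\<^sup>2))"
    unfolding N_def by (rule real_sqrt_le_mono)
  also have "\<dots> = sqrt total_const * T powr (\<theta> / 2) * N1 * N2"
    using N1 N2 by (simp add: real_sqrt_mult powr_half_sqrt[symmetric] powr_powr mult_ac)
  finally show ?thesis using NZ ag by blast
qed

end

text \<open>It remains to choose the exponents and to pass from a bound for each pair of extensions
  to a bound between infima.\<close>

theorem lemma3:
  fixes \<alpha> \<beta> :: real
  assumes "\<alpha> > 1" and "2 - \<alpha> < \<beta>" and "\<beta> \<le> 1" and "\<beta> > 0"
  shows "\<exists>\<epsilon>>0. \<exists>b>1/2. \<exists>C>0. \<exists>T0>0. \<forall>T. 0 < T \<and> T < T0 \<longrightarrow>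
    (\<forall>u \<in> ZT_functions \<alpha> \<beta> b T. \<forall>v \<in> ZT_functions \<alpha> \<beta> b T.
       D_pow (- \<beta> * (b - 1/2)) (d_x (fun_dist T (\<lambda>t x. u t x * v t x)))
         \<in> ZT_space \<alpha> \<beta> (b - 1) T \<and>
       ZT_norm \<alpha> \<beta> (b - 1) T
           (D_pow (- \<beta> * (b - 1/2)) (d_x (fun_dist T (\<lambda>t x. u t x * v t x))))
         \<le> C * T powr \<epsilon> * ZT_norm \<alpha> \<beta> b T (fun_dist T u) * ZT_norm \<alpha> \<beta> b T (fun_dist T v))"
proof -
  \<comment> \<open>The excess (\<alpha> + \<beta>)/2 - 1 equals 2\<delta>. One \<delta> is kept as
    decay in frequency, and \<theta> is taken so small that its total loss \<theta>(1 + \<alpha>)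
    fits into the other.\<close>
  define \<delta> where "\<delta> = (\<alpha> + \<beta> - 2) / 4"
  define \<theta> where "\<theta> = min (1/2) (\<delta> / (1 + \<alpha>))"
  have \<delta>: "\<delta> > 0" using assms by (simp add: \<delta>_def)
  have \<theta>: "0 < \<theta>" "\<theta> \<le> 1/2"
    unfolding \<theta>_def using \<delta> assms by (simp, intro min.cobounded1)
  have "\<theta> * (1 + \<alpha>) \<le> \<delta> / (1 + \<alpha>) * (1 + \<alpha>)"
    using assms by (intro mult_right_mono) (auto simp: \<theta>_def)
  then have "\<theta> * (1 + \<alpha>) \<le> \<delta>" using assms by simp
  then have "1 - (\<alpha> + \<beta>) / 2 + \<theta> * (1 + \<alpha>) \<le> - \<delta>" by (simp add: \<delta>_def field_simps)
  then interpret exponents \<alpha> \<beta> \<theta> \<delta>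
    using assms \<theta> \<delta> by unfold_locales auto
  \<comment> \<open>The summand 1 ensures that the constant is positive.\<close>
  let ?C = "sqrt total_const + 1"
  have tc: "total_const \<ge> 0" by (simp add: total_const_def)
  have Cpos: "?C > 0" using tc by (simp add: add_nonneg_pos)
  have main: "D_pow (- \<beta> * (b - 1/2)) (d_x (fun_dist T (\<lambda>t x. u t x * v t x))) \<in> ZT_space \<alpha> \<beta> (b - 1) T \<and>
       ZT_norm \<alpha> \<beta> (b - 1) T (D_pow (- \<beta> * (b - 1/2)) (d_x (fun_dist T (\<lambda>t x. u t x * v t x))))
         \<le> ?C * T powr (\<theta> / 2) * ZT_norm \<alpha> \<beta> b T (fun_dist T u) * ZT_norm \<alpha> \<beta> b T (fun_dist T v)"
    if T: "0 < T" and u: "u \<in> ZT_functions \<alpha> \<beta> b T" and v: "v \<in> ZT_functions \<alpha> \<beta> b T" for T u v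
  proof -
    let ?g = "D_pow (- \<beta> * (b - 1/2)) (d_x (fun_dist T (\<lambda>t x. u t x * v t x)))"
    define S where "S g = {N. \<exists>w. has_Z_norm \<alpha> \<beta> b w N \<and> agree_on T w g}" for g
    define S' where "S' = {N. \<exists>w. has_Z_norm \<alpha> \<beta> (b - 1) w N \<and> agree_on T w ?g}"
    have nonneg: "N \<ge> 0" if "has_Z_norm \<alpha> \<beta> b' w N" for b' w N
      using has_Z_normD[OF that] by blast
    have ne: "S (fun_dist T u) \<noteq> {}" "S (fun_dist T v) \<noteq> {}"
      using u v by (auto simp: S_def ZT_functions_def ZT_space_def)
    have pos: "N \<ge> 0" if "N \<in> S g" for N g using that nonneg by (auto simp: S_def)
    have bdd: "bdd_below S'" unfolding S'_def bdd_below_def using nonneg by blast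
    have ui: "set_integrable lborel ({0..T} \<times> {-pi..pi}) (\<lambda>(t, x). u t x)"
      and vi: "set_integrable lborel ({0..T} \<times> {-pi..pi}) (\<lambda>(t, x). v t x)"
      using u v by (auto simp: ZT_functions_def)
    have step: "\<exists>N\<in>S'. N \<le> ?C * T powr (\<theta> / 2) * N1 * N2" if N1: "N1 \<in> S (fun_dist T u)" and N2: "N2 \<in> S (fun_dist T v)" for N1 N2
    proof -
      obtain w N where *: "has_Z_norm \<alpha> \<beta> (b - 1) w N" "agree_on T w ?g" "N \<le> sqrt total_const * T powr (\<theta> / 2) * N1 * N2"
        using N1 N2 extension_of_product[OF T ui vi] unfolding S_def by blast
      note *(3)
      also have "sqrt total_const * T powr (\<theta> / 2) * N1 * N2 \<le> ?C * T powr (\<theta> / 2) * N1 * N2"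
        using pos[OF N1] pos[OF N2] by (intro mult_right_mono) auto
      finally show ?thesis using *(1,2) unfolding S'_def by blast
    qed
    have inS: "?g \<in> ZT_space \<alpha> \<beta> (b - 1) T"
    proof -
      obtain N1 N2 where "N1 \<in> S (fun_dist T u)" "N2 \<in> S (fun_dist T v)" using ne by blast
      from step[OF this] show ?thesis unfolding S'_def ZT_space_def by blast
    qed
    have le: "Inf S' \<le> ?C * T powr (\<theta> / 2) * N1 * N2" if N12: "N1 \<in> S (fun_dist T u)" "N2 \<in> S (fun_dist T v)" for N1 N2
      using step[OF N12] cInf_lower[OF _ bdd] order_trans by blast
    have d0: "0 \<le> ?C * T powr (\<theta> / 2)" using Cpos by simp
    \<comment> \<open>The infima are taken one factor at a time: over extensions of v with N1 fixed,
      then over extensions of u with the infimum for v as part of the constant, whose sign is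
      settled by \<open>I0\<close>.\<close>
    have le1: "Inf S' \<le> ?C * T powr (\<theta> / 2) * N1 * Inf (S (fun_dist T v))" if "N1 \<in> S (fun_dist T u)" for N1
      by (rule le_mult_Inf[OF ne(2) pos]) (use le that pos[OF that] d0 in \<open>auto intro: mult_nonneg_nonneg\<close>)
    have I0: "0 \<le> Inf (S (fun_dist T v))"
      by (rule cInf_greatest[OF ne(2)]) (rule pos)
    have "Inf S' \<le> ?C * T powr (\<theta> / 2) * Inf (S (fun_dist T v)) * Inf (S (fun_dist T u))"
    proof (rule le_mult_Inf[OF ne(1) pos])
      show "0 \<le> ?C * T powr (\<theta> / 2) * Inf (S (fun_dist T v))" using d0 I0 by (rule mult_nonneg_nonneg)
      show "Inf S' \<le> ?C * T powr (\<theta> / 2) * Inf (S (fun_dist T v)) * N1" if "N1 \<in> S (fun_dist T u)" for N1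
        using le1[OF that] by (simp only: mult_ac)
    qed
    then have "ZT_norm \<alpha> \<beta> (b - 1) T ?g \<le> ?C * T powr (\<theta> / 2) * ZT_norm \<alpha> \<beta> b T (fun_dist T u) * ZT_norm \<alpha> \<beta> b T (fun_dist T v)"
      unfolding ZT_norm_def S_def[symmetric] S'_def[symmetric] by (simp only: mult_ac)
    then show ?thesis using inS by blast
  qed
  show ?thesis
    \<comment> \<open>The norm gains half of the power T^\<theta> of its square, so \<epsilon> is
      \<theta> / 2. As \<open>main\<close> covers every positive T, the threshold is taken to be
      1.\<close>
    by (rule exI[of _ "\<theta> / 2"], rule conjI, use \<theta> in simp,
        rule exI[of _ b], rule conjI, use \<theta> in simp,
        rule exI[of _ ?C], rule conjI, rule Cpos,
        rule exI[of _ 1], rule conjI, simp, use main in blast)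
qed

end
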